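(* Let $M$ be a model of ZFA + AC with set of atoms $A$. Let $\mathcal{G}$ be a group of permutations of $A$ such that either each $\eta\in\mathcal{G}$ moves only finitely many atoms, or there is a natural number $n\ge 2$ such that $\eta^n=1_A$ for all $\eta\in\mathcal{G}$. Let $\mathcal{F}$ be the normal filter of subgroups of $\mathcal{G}$ generated by $\{\mathrm{fix}_{\mathcal{G}}(E): E\in[A]^{<\omega}\}$. Then in the Fraenkel–Mostowski permutation model $\mathcal{N}$ determined by $M$, $\mathcal{G}$ and $\mathcal{F}$, the statements $CS$ and $CWF$ hold. Consequently, $vDCP$ and $LW$ hold in $\mathcal{N}$.
   Context: ZFA is Zermelo–Fraenkel set theory (without the Axiom of Choice) with the axiom of extensionality weakened to allow atoms. Permutation models: $[A]^{<\omega}$ is the set of finite subsets of $A$, and $\mathrm{fix}_{\mathcal{G}}(E)=\{\phi\in\mathcal{G}:\phi(y)=y \text{ for all } y\in E\}$. Each permutation of $A$ extends uniquely to a permutation of $M$ by $\in$-induction. For $x\in M$, $\mathrm{sym}_{\mathcal{G}}(x)=\{g\in\mathcal{G}: g(x)=x\}$; $x$ is $\mathcal{F}$-symmetric if $\mathrm{sym}_{\mathcal{G}}(x)\in\mathcal{F}$, and hereditarily $\mathcal{F}$-symmetric if $x$ and all elements of its transitive closure are $\mathcal{F}$-symmetric. The model $\mathcal{N}$ is the class of all hereditarily $\mathcal{F}$-symmetric elements of $M$; it is a model of ZFA. A subset $C$ of a poset $(P,\le)$ is cofinal if for every $x\in P$ there is $c\in C$ with $x\le c$. A subset $W\subseteq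 P$ is well-founded if every non-empty subset of $W$ has a $\le$-minimal element. $CS$: every poset without a maximal element has two disjoint cofinal subsets. $CWF$: every poset has a cofinal well-founded subset. $vDCP$ (van Douwen's Choice Principle): every family $\{(X_i,\le_i): i\in I\}$ of linearly ordered sets isomorphic to $(\mathbb{Z},\le)$ (usual ordering) has a choice function. $LW$: every linearly ordered set can be well-ordered. *)

theory Defs
  imports Main
begin

section \<open>Models of ZFA\<close>

text \<open>
  A structure for the language of ZFA: a universe, a binary membership relation, and an
  interpretation of the constant symbol for the set of atoms. Only the restriction of
  \<open>Mem\<close> to \<open>Univ\<close> matters. The structure need not be well-founded or \<open>\<omega>\<close>-standard
  from outside, so every set-theoretic notion below (natural number, finite, function, group,
  filter, transitive closure, ...) is the notion of the structure itself, i.e. its quantifiers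
  range over \<open>Univ\<close>.
\<close>

record 'm zfa_structure =
  Univ :: "'m set"
  Mem :: "'m \<Rightarrow> 'm \<Rightarrow> bool"
  Atoms :: 'm

datatype fm = Member nat nat | Equal nat nat | Neg fm | Conj fm fm | Forall nat fm

primrec sat :: "'m zfa_structure \<Rightarrow> fm \<Rightarrow> (nat \<Rightarrow> 'm) \<Rightarrow> bool" where
  "sat M (Member i j) v \<longleftrightarrow> Mem M (v i) (v j)"
| "sat M (Equal i j) v \<longleftrightarrow> v i = v j"
| "sat M (Neg p) v \<longleftrightarrow> \<not> sat M p v"
| "sat M (Conj p q) v \<longleftrightarrow> sat M p v \<and> sat M q v"
| "sat M (Forall i p) v \<longleftrightarrow> (\<forall>x\<in>Univ M. sat M p (v(i := x)))"

definition elems :: "'m zfa_structure \<Rightarrow> 'm \<Rightarrow> 'm set" where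
  "elems M x = {y \<in> Univ M. Mem M y x}"

definition isset :: "'m zfa_structure \<Rightarrow> 'm \<Rightarrow> bool" where
  "isset M x \<longleftrightarrow> x \<in> Univ M \<and> x \<notin> elems M (Atoms M)"

text \<open>
  \<open>represents M u X\<close>: the object \<open>u\<close> of the model is a set (not an atom) whose elements are
  exactly the members of the external collection \<open>X\<close>.
\<close>

definition represents :: "'m zfa_structure \<Rightarrow> 'm \<Rightarrow> 'm set \<Rightarrow> bool" where
  "represents M u X \<longleftrightarrow> isset M u \<and> elems M u = X"

definition is_empty :: "'m zfa_structure \<Rightarrow> 'm \<Rightarrow> bool" where
  "is_empty M z \<longleftrightarrow> represents M z {}"

definition is_succ :: "'m zfa_structure \<Rightarrow> 'm \<Rightarrow> 'm \<Rightarrow> bool" where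
  "is_succ M s x \<longleftrightarrow> represents M s (insert x (elems M x))"

definition is_inductive :: "'m zfa_structure \<Rightarrow> 'm \<Rightarrow> bool" where
  "is_inductive M I \<longleftrightarrow> isset M I \<and> (\<exists>z\<in>elems M I. is_empty M z) \<and>
     (\<forall>x\<in>elems M I. \<exists>s\<in>elems M I. is_succ M s x)"

text \<open>
  Separation and Replacement are first-order schemas: one instance for each formula \<open>p\<close> and each
  assignment \<open>v\<close> of parameters. The constant for the set of atoms may occur as a parameter, so
  it is not needed in the type of formulas.
\<close>

definition ZFA_model :: "'m zfa_structure \<Rightarrow> bool" where
  "ZFA_model M \<longleftrightarrow>
     Atoms M \<in> Univ M \<and> (\<forall>a\<in>elems M (Atoms M). elems M a = {}) \<and>
     (\<forall>x y. isset M x \<and> isset M y \<and> elems M x = elems M y \<longrightarrow> x = y) \<and>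
     (\<exists>z. is_empty M z) \<and>
     (\<forall>x\<in>Univ M. \<forall>y\<in>Univ M. \<exists>u. represents M u {x, y}) \<and>
     (\<forall>x\<in>Univ M. \<exists>u. represents M u (\<Union>y\<in>elems M x. elems M y)) \<and>
     (\<forall>x\<in>Univ M. \<exists>u. represents M u {y. isset M y \<and> elems M y \<subseteq> elems M x}) \<and>
     (\<exists>I. is_inductive M I) \<and>
     (\<forall>x\<in>Univ M. elems M x \<noteq> {} \<longrightarrow> (\<exists>y\<in>elems M x. elems M y \<inter> elems M x = {})) \<and>
     (\<forall>p v. range v \<subseteq> Univ M \<longrightarrow>
        (\<forall>x\<in>Univ M. \<exists>u. represents M u {y \<in> elems M x. sat M p (v(0 := y))})) \<and>
     (\<forall>p v. range v \<subseteq> Univ M \<longrightarrow>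
        (\<forall>x\<in>Univ M.
           (\<forall>y\<in>elems M x. \<forall>z\<in>Univ M. \<forall>z'\<in>Univ M.
              sat M p (v(0 := y, 1 := z)) \<and> sat M p (v(0 := y, 1 := z')) \<longrightarrow> z = z') \<longrightarrow>
           (\<exists>u. represents M u {z \<in> Univ M. \<exists>y\<in>elems M x. sat M p (v(0 := y, 1 := z))})))"


section \<open>Set-theoretic notions in a structure\<close>

text \<open>Kuratowski pairs.\<close>

definition is_pair :: "'m zfa_structure \<Rightarrow> 'm \<Rightarrow> 'm \<Rightarrow> 'm \<Rightarrow> bool" where
  "is_pair M p x y \<longleftrightarrow>
     (\<exists>u v. represents M u {x} \<and> represents M v {x, y} \<and> represents M p {u, v})"

definition related :: "'m zfa_structure \<Rightarrow> 'm \<Rightarrow> 'm \<Rightarrow> 'm \<Rightarrow> bool" where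
  "related M r x y \<longleftrightarrow> (\<exists>p\<in>elems M r. is_pair M p x y)"

definition is_fun :: "'m zfa_structure \<Rightarrow> 'm \<Rightarrow> 'm \<Rightarrow> bool" where
  "is_fun M f X \<longleftrightarrow> isset M f \<and>
     (\<forall>p\<in>elems M f. \<exists>x\<in>elems M X. \<exists>y. is_pair M p x y) \<and>
     (\<forall>x\<in>elems M X. \<exists>!y. related M f x y)"

definition is_bij :: "'m zfa_structure \<Rightarrow> 'm \<Rightarrow> 'm \<Rightarrow> 'm \<Rightarrow> bool" where
  "is_bij M f X Y \<longleftrightarrow> is_fun M f X \<and>
     (\<forall>x y. related M f x y \<longrightarrow> y \<in> elems M Y) \<and>
     (\<forall>y\<in>elems M Y. \<exists>!x. related M f x y)"

definition AC :: "'m zfa_structure \<Rightarrow> bool" where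
  "AC M \<longleftrightarrow> (\<forall>X. isset M X \<and> (\<forall>x\<in>elems M X. elems M x \<noteq> {}) \<longrightarrow>
     (\<exists>f. is_fun M f X \<and> (\<forall>x y. related M f x y \<longrightarrow> y \<in> elems M x)))"

definition is_nat :: "'m zfa_structure \<Rightarrow> 'm \<Rightarrow> bool" where
  "is_nat M n \<longleftrightarrow> n \<in> Univ M \<and> (\<forall>I. is_inductive M I \<longrightarrow> n \<in> elems M I)"

definition is_finite :: "'m zfa_structure \<Rightarrow> 'm \<Rightarrow> bool" where
  "is_finite M x \<longleftrightarrow> (\<exists>n f. is_nat M n \<and> is_bij M f n x)"

definition is_transitive :: "'m zfa_structure \<Rightarrow> 'm \<Rightarrow> bool" where
  "is_transitive M t \<longleftrightarrow> isset M t \<and> (\<forall>x\<in>elems M t. elems M x \<subseteq> elems M t)"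

definition trcl :: "'m zfa_structure \<Rightarrow> 'm \<Rightarrow> 'm set" where
  "trcl M x = {y \<in> Univ M. \<forall>t. is_transitive M t \<and> elems M x \<subseteq> elems M t \<longrightarrow> y \<in> elems M t}"


section \<open>Groups of permutations of the atoms\<close>

definition is_id :: "'m zfa_structure \<Rightarrow> 'm \<Rightarrow> bool" where
  "is_id M e \<longleftrightarrow> is_fun M e (Atoms M) \<and> (\<forall>a\<in>elems M (Atoms M). related M e a a)"

text \<open>\<open>is_comp M k g h\<close>: \<open>k\<close> is \<open>g \<circ> h\<close>, for permutations \<open>g\<close>, \<open>h\<close> of the atoms.\<close>

definition is_comp :: "'m zfa_structure \<Rightarrow> 'm \<Rightarrow> 'm \<Rightarrow> 'm \<Rightarrow> bool" where
  "is_comp M k g h \<longleftrightarrow> is_fun M k (Atoms M) \<and>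
     (\<forall>a b c. related M h a b \<and> related M g b c \<longrightarrow> related M k a c)"

definition is_inverse :: "'m zfa_structure \<Rightarrow> 'm \<Rightarrow> 'm \<Rightarrow> bool" where
  "is_inverse M k g \<longleftrightarrow> is_fun M k (Atoms M) \<and>
     (\<forall>a b. related M k a b \<longleftrightarrow> related M g b a)"

definition perm_group :: "'m zfa_structure \<Rightarrow> 'm \<Rightarrow> bool" where
  "perm_group M G \<longleftrightarrow> isset M G \<and>
     (\<forall>g\<in>elems M G. is_bij M g (Atoms M) (Atoms M)) \<and>
     (\<exists>e\<in>elems M G. is_id M e) \<and>
     (\<forall>g\<in>elems M G. \<forall>h\<in>elems M G. \<exists>k\<in>elems M G. is_comp M k g h) \<and>
     (\<forall>g\<in>elems M G. \<exists>k\<in>elems M G. is_inverse M k g)"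

definition moves_finitely_many :: "'m zfa_structure \<Rightarrow> 'm \<Rightarrow> bool" where
  "moves_finitely_many M g \<longleftrightarrow>
     (\<exists>S. represents M S {a \<in> elems M (Atoms M). \<not> related M g a a} \<and> is_finite M S)"

text \<open>
  \<open>is_power M g n k\<close>: \<open>k\<close> is the \<open>n\<close>-th power of \<open>g\<close>, for a natural number \<open>n\<close> of the model;
  the witness \<open>s\<close> is the sequence of the powers of \<open>g\<close> with exponents \<open>0, \<dots>, n\<close>.
\<close>

definition is_power :: "'m zfa_structure \<Rightarrow> 'm \<Rightarrow> 'm \<Rightarrow> 'm \<Rightarrow> bool" where
  "is_power M g n k \<longleftrightarrow> (\<exists>m s. is_succ M m n \<and> is_fun M s m \<and>
     (\<forall>z p. is_empty M z \<and> related M s z p \<longrightarrow> is_id M p) \<and>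
     (\<forall>i\<in>elems M n. \<forall>j p q. is_succ M j i \<and> related M s i p \<and> related M s j q
        \<longrightarrow> is_comp M q g p) \<and>
     related M s n k)"

definition nat_ge_2 :: "'m zfa_structure \<Rightarrow> 'm \<Rightarrow> bool" where
  "nat_ge_2 M n \<longleftrightarrow> is_nat M n \<and> (\<exists>z i. is_empty M z \<and> is_succ M i z \<and> i \<in> elems M n)"

definition bounded_exponent :: "'m zfa_structure \<Rightarrow> 'm \<Rightarrow> bool" where
  "bounded_exponent M G \<longleftrightarrow> (\<exists>n. nat_ge_2 M n \<and>
     (\<forall>g\<in>elems M G. \<exists>e. is_id M e \<and> is_power M g n e))"


section \<open>Normal filters and permutation models\<close>

definition subgroup :: "'m zfa_structure \<Rightarrow> 'm \<Rightarrow> 'm \<Rightarrow> bool" where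
  "subgroup M H G \<longleftrightarrow> perm_group M H \<and> elems M H \<subseteq> elems M G"

definition is_fix :: "'m zfa_structure \<Rightarrow> 'm \<Rightarrow> 'm \<Rightarrow> 'm \<Rightarrow> bool" where
  "is_fix M G E H \<longleftrightarrow> represents M H {g \<in> elems M G. \<forall>a\<in>elems M E. related M g a a}"

text \<open>\<open>is_conjugate M g H K\<close>: \<open>K\<close> is \<open>g H g\<inverse>\<close>.\<close>

definition is_conjugate :: "'m zfa_structure \<Rightarrow> 'm \<Rightarrow> 'm \<Rightarrow> 'm \<Rightarrow> bool" where
  "is_conjugate M g H K \<longleftrightarrow> represents M K
     {k. \<exists>h\<in>elems M H. \<exists>i j. is_inverse M i g \<and> is_comp M j h i \<and> is_comp M k g j}"

text \<open>
  Normal filters of subgroups as in Jech, \<^emph>\<open>The Axiom of Choice\<close>; the last clause says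
  that stabilizers of single atoms belong to the filter.
\<close>

definition normal_filter :: "'m zfa_structure \<Rightarrow> 'm \<Rightarrow> 'm \<Rightarrow> bool" where
  "normal_filter M G F \<longleftrightarrow> isset M F \<and>
     (\<forall>H\<in>elems M F. subgroup M H G) \<and>
     G \<in> elems M F \<and>
     (\<forall>H\<in>elems M F. \<forall>K. subgroup M K G \<and> elems M H \<subseteq> elems M K \<longrightarrow> K \<in> elems M F) \<and>
     (\<forall>H\<in>elems M F. \<forall>K\<in>elems M F. \<exists>L\<in>elems M F. represents M L (elems M H \<inter> elems M K)) \<and>
     (\<forall>g\<in>elems M G. \<forall>H\<in>elems M F. \<exists>K\<in>elems M F. is_conjugate M g H K) \<and>
     (\<forall>a\<in>elems M (Atoms M). \<exists>H\<in>elems M F. represents M H {g \<in> elems M G. related M g a a})"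

definition contains_finite_fixers :: "'m zfa_structure \<Rightarrow> 'm \<Rightarrow> 'm \<Rightarrow> bool" where
  "contains_finite_fixers M G F \<longleftrightarrow>
     (\<forall>E. isset M E \<and> elems M E \<subseteq> elems M (Atoms M) \<and> is_finite M E \<longrightarrow>
        (\<exists>H\<in>elems M F. is_fix M G E H))"

definition finite_support_filter :: "'m zfa_structure \<Rightarrow> 'm \<Rightarrow> 'm \<Rightarrow> bool" where
  "finite_support_filter M G F \<longleftrightarrow>
     normal_filter M G F \<and> contains_finite_fixers M G F \<and>
     (\<forall>F'. normal_filter M G F' \<and> contains_finite_fixers M G F' \<longrightarrow> elems M F \<subseteq> elems M F')"

text \<open>
  \<open>ext_maps M g x y\<close>: the extension of the permutation \<open>g\<close> of the atoms to the universe, given by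
  \<open>g x = {g z | z \<in> x}\<close> for sets \<open>x\<close>, maps \<open>x\<close> to \<open>y\<close>. The \<open>\<in>\<close>-recursion is carried out in the model:
  \<open>f\<close> is its solution on a transitive set \<open>t\<close> containing \<open>x\<close>. (An external map satisfying the
  recursion equations need not be unique if the model is externally ill-founded.)
\<close>

definition ext_maps :: "'m zfa_structure \<Rightarrow> 'm \<Rightarrow> 'm \<Rightarrow> 'm \<Rightarrow> bool" where
  "ext_maps M g x y \<longleftrightarrow> (\<exists>t f. is_transitive M t \<and> x \<in> elems M t \<and> is_fun M f t \<and>
     (\<forall>z w. related M f z w \<longrightarrow>
        (if z \<in> elems M (Atoms M) then related M g z w
         else represents M w {u. \<exists>v\<in>elems M z. related M f v u})) \<and>
     related M f x y)"

definition is_sym :: "'m zfa_structure \<Rightarrow> 'm \<Rightarrow> 'm \<Rightarrow> 'm \<Rightarrow> bool" where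
  "is_sym M G x H \<longleftrightarrow> represents M H {g \<in> elems M G. ext_maps M g x x}"

definition symmetric :: "'m zfa_structure \<Rightarrow> 'm \<Rightarrow> 'm \<Rightarrow> 'm \<Rightarrow> bool" where
  "symmetric M G F x \<longleftrightarrow> (\<exists>H\<in>elems M F. is_sym M G x H)"

definition hereditarily_symmetric :: "'m zfa_structure \<Rightarrow> 'm \<Rightarrow> 'm \<Rightarrow> 'm \<Rightarrow> bool" where
  "hereditarily_symmetric M G F x \<longleftrightarrow>
     symmetric M G F x \<and> (\<forall>y\<in>trcl M x. symmetric M G F y)"

definition permutation_model :: "'m zfa_structure \<Rightarrow> 'm \<Rightarrow> 'm \<Rightarrow> 'm zfa_structure" where
  "permutation_model M G F = M\<lparr>Univ := {x \<in> Univ M. hereditarily_symmetric M G F x}\<rparr>"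


section \<open>Choice principles in a structure\<close>

definition poset :: "'m zfa_structure \<Rightarrow> 'm \<Rightarrow> 'm \<Rightarrow> bool" where
  "poset M P R \<longleftrightarrow> isset M P \<and> isset M R \<and>
     (\<forall>p\<in>elems M R. \<exists>x\<in>elems M P. \<exists>y\<in>elems M P. is_pair M p x y) \<and>
     (\<forall>x\<in>elems M P. related M R x x) \<and>
     (\<forall>x y. related M R x y \<and> related M R y x \<longrightarrow> x = y) \<and>
     (\<forall>x y z. related M R x y \<and> related M R y z \<longrightarrow> related M R x z)"

definition linear_order :: "'m zfa_structure \<Rightarrow> 'm \<Rightarrow> 'm \<Rightarrow> bool" where
  "linear_order M P R \<longleftrightarrow> poset M P R \<and>
     (\<forall>x\<in>elems M P. \<forall>y\<in>elems M P. related M R x y \<or> related M R y x)"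

definition is_maximal :: "'m zfa_structure \<Rightarrow> 'm \<Rightarrow> 'm \<Rightarrow> 'm \<Rightarrow> bool" where
  "is_maximal M P R m \<longleftrightarrow> m \<in> elems M P \<and> (\<forall>x\<in>elems M P. related M R m x \<longrightarrow> x = m)"

definition is_minimal :: "'m zfa_structure \<Rightarrow> 'm \<Rightarrow> 'm \<Rightarrow> 'm \<Rightarrow> bool" where
  "is_minimal M S R m \<longleftrightarrow> m \<in> elems M S \<and> (\<forall>x\<in>elems M S. related M R x m \<longrightarrow> x = m)"

definition cofinal_subset :: "'m zfa_structure \<Rightarrow> 'm \<Rightarrow> 'm \<Rightarrow> 'm \<Rightarrow> bool" where
  "cofinal_subset M C P R \<longleftrightarrow> isset M C \<and> elems M C \<subseteq> elems M P \<and>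
     (\<forall>x\<in>elems M P. \<exists>c\<in>elems M C. related M R x c)"

definition well_founded_subset :: "'m zfa_structure \<Rightarrow> 'm \<Rightarrow> 'm \<Rightarrow> 'm \<Rightarrow> bool" where
  "well_founded_subset M W P R \<longleftrightarrow> isset M W \<and> elems M W \<subseteq> elems M P \<and>
     (\<forall>S. isset M S \<and> elems M S \<subseteq> elems M W \<and> elems M S \<noteq> {} \<longrightarrow> (\<exists>m. is_minimal M S R m))"

definition well_order :: "'m zfa_structure \<Rightarrow> 'm \<Rightarrow> 'm \<Rightarrow> bool" where
  "well_order M X R \<longleftrightarrow> linear_order M X R \<and> well_founded_subset M X X R"

definition order_iso :: "'m zfa_structure \<Rightarrow> 'm \<Rightarrow> 'm \<Rightarrow> 'm \<Rightarrow> 'm \<Rightarrow> 'm \<Rightarrow> bool" where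
  "order_iso M f X R Y S \<longleftrightarrow> is_bij M f X Y \<and>
     (\<forall>x y x' y'. related M f x x' \<and> related M f y y' \<longrightarrow>
        (related M R x y \<longleftrightarrow> related M S x' y'))"

text \<open>
  The integers of the structure, with the integer \<open>n \<ge> 0\<close> coded as the pair \<open>(0, n)\<close>
  and \<open>-n < 0\<close> coded as the pair \<open>(1, n)\<close>.
\<close>

definition nonneg_int :: "'m zfa_structure \<Rightarrow> 'm \<Rightarrow> 'm \<Rightarrow> bool" where
  "nonneg_int M x n \<longleftrightarrow> is_nat M n \<and> (\<exists>z. is_empty M z \<and> is_pair M x z n)"

definition neg_int :: "'m zfa_structure \<Rightarrow> 'm \<Rightarrow> 'm \<Rightarrow> bool" where
  "neg_int M x n \<longleftrightarrow> is_nat M n \<and> \<not> is_empty M n \<and>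
     (\<exists>z i. is_empty M z \<and> is_succ M i z \<and> is_pair M x i n)"

definition int_le :: "'m zfa_structure \<Rightarrow> 'm \<Rightarrow> 'm \<Rightarrow> bool" where
  "int_le M x y \<longleftrightarrow>
     (\<exists>m n. nonneg_int M x m \<and> nonneg_int M y n \<and> (m \<in> elems M n \<or> m = n)) \<or>
     (\<exists>m n. neg_int M x m \<and> nonneg_int M y n) \<or>
     (\<exists>m n. neg_int M x m \<and> neg_int M y n \<and> (n \<in> elems M m \<or> n = m))"

definition is_int_order :: "'m zfa_structure \<Rightarrow> 'm \<Rightarrow> 'm \<Rightarrow> bool" where
  "is_int_order M Z L \<longleftrightarrow>
     represents M Z {x. \<exists>n. nonneg_int M x n \<or> neg_int M x n} \<and>
     represents M L {p. \<exists>x y. int_le M x y \<and> is_pair M p x y}"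

definition iso_to_int :: "'m zfa_structure \<Rightarrow> 'm \<Rightarrow> 'm \<Rightarrow> bool" where
  "iso_to_int M X R \<longleftrightarrow> (\<exists>Z L f. is_int_order M Z L \<and> order_iso M f X R Z L)"

definition CS :: "'m zfa_structure \<Rightarrow> bool" where
  "CS M \<longleftrightarrow> (\<forall>P R. poset M P R \<and> (\<nexists>m. is_maximal M P R m) \<longrightarrow>
     (\<exists>C D. cofinal_subset M C P R \<and> cofinal_subset M D P R \<and> elems M C \<inter> elems M D = {}))"

definition CWF :: "'m zfa_structure \<Rightarrow> bool" where
  "CWF M \<longleftrightarrow> (\<forall>P R. poset M P R \<longrightarrow>
     (\<exists>W. cofinal_subset M W P R \<and> well_founded_subset M W P R))"

text \<open>A family of ordered sets is a function \<open>B\<close> with domain \<open>I\<close> and values \<open>B i = (X i, R i)\<close>.\<close>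

definition vDCP :: "'m zfa_structure \<Rightarrow> bool" where
  "vDCP M \<longleftrightarrow> (\<forall>I B. isset M I \<and> is_fun M B I \<and>
     (\<forall>i q. related M B i q \<longrightarrow>
        (\<exists>X R. is_pair M q X R \<and> linear_order M X R \<and> iso_to_int M X R)) \<longrightarrow>
     (\<exists>c. is_fun M c I \<and>
        (\<forall>i q X R x. related M B i q \<and> is_pair M q X R \<and> related M c i x \<longrightarrow> x \<in> elems M X)))"

definition LW :: "'m zfa_structure \<Rightarrow> bool" where
  "LW M \<longleftrightarrow> (\<forall>X R. linear_order M X R \<longrightarrow> (\<exists>S. well_order M X S))"

end

theory Submission
  imports Defs
begin

text \<open>
  Let a poset in the model be given, and let \<open>L\<close> be the intersection of the stabilizers of the
  poset and of its order, a group in the filter. Every permutation in the group is torsion: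
  this is clear for bounded exponent, and a permutation with finite support has finite order. So if
  \<open>x \<le> g x\<close> with \<open>g \<in> L\<close>, then \<open>x \<le> g x \<le> \<dots> \<le> g\<^sup>n x = x\<close>, that is, the \<open>L\<close>-orbits
  are antichains. Subsets of the poset that are unions of orbits belong to the model.

  Well-order the set of orbits in the ground model. The points \<open>x\<close> that are not below any
  point of an earlier orbit form a cofinal well-founded set. If there are no maximal points, sending
  each orbit to the first orbit having a point above it is an increasing function on
  orbits; any two-colouring of it gives two disjoint cofinal sets. In a linear order orbits are
  singletons, so all well-orders of it in the ground model belong to the permutation model. In a
  family of linear orders, a permutation fixing an index fixes each point over it, so a choice made
  at one index of every orbit extends equivariantly.

  All constructions are carried out inside the structure, so every application of
  separation or replacement requires a definability proof.
\<close>

section \<open>Definable predicates\<close>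

text \<open>The obstacle is that the structure, seen from outside, may be ill-founded and may
  contain nonstandard numbers. Finite order, finite support and iteration of maps therefore cannot
  be handled by counting in HOL; each is replaced by a minimality or closure statement about sets of
  the structure. Torsion of \<open>g\<close> means that every set of group elements that is closed
  under composition and contains \<open>g\<close> also contains the identity. The chain x \<le> g x
  \<le> ... then becomes one set, that of all \<open>k\<close> with g x \<le> k x. Finiteness is
  used in Tarski's form, and an even number of steps of a map is described by sets closed under the
  double step. Induction and recursion are available only for predicates given by first-order
  formulas with parameters, and \<open>dfn\<close> is the class of these predicates. For this reason
  choices such as least representatives are kept as relations wherever a set is formed from
  them.\<close>

primrec ren :: "(nat \<Rightarrow> nat) \<Rightarrow> fm \<Rightarrow> fm" where
  "ren f (Member i j) = Member (f i) (f j)"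
| "ren f (Equal i j) = Equal (f i) (f j)"
| "ren f (Neg p) = Neg (ren f p)"
| "ren f (Conj p q) = Conj (ren f p) (ren f q)"
| "ren f (Forall i p) = Forall (f i) (ren f p)"

text \<open>Injectivity keeps a renamed binder from catching a different variable: updating
  \<open>v\<close> at \<open>f i\<close> and then composing with \<open>f\<close> changes only index
  \<open>i\<close>.\<close>

lemma sat_ren: "inj f \<Longrightarrow> sat M (ren f p) v \<longleftrightarrow> sat M p (v \<circ> f)"
proof (induction p arbitrary: v)
  case (Forall i p)
  have "(v(f i := x)) \<circ> f = (v \<circ> f)(i := x)" for x
    using Forall.prems by (auto simp: fun_eq_iff inj_eq)
  then show ?case unfolding ren.simps sat.simps Forall.IH[OF Forall.prems] by (simp only:)
qed (auto simp: comp_def)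

inductive tm :: "'m zfa_structure \<Rightarrow> ((nat \<Rightarrow> 'm) \<Rightarrow> 'm) \<Rightarrow> bool" for M where
  tm_var: "tm M (\<lambda>v. v i)"
| tm_const: "c \<in> Univ M \<Longrightarrow> tm M (\<lambda>v. c)"

text \<open>
  Environments use de Bruijn indices, so that higher-order resolution with the introduction rules
  below suffices to verify that a concrete predicate is definable.
\<close>

inductive dfn :: "'m zfa_structure \<Rightarrow> ((nat \<Rightarrow> 'm) \<Rightarrow> bool) \<Rightarrow> bool" for M where
  dfn_Mem: "tm M s \<Longrightarrow> tm M t \<Longrightarrow> dfn M (\<lambda>v. Mem M (s v) (t v))"
| dfn_eq: "tm M s \<Longrightarrow> tm M t \<Longrightarrow> dfn M (\<lambda>v. s v = t v)"
| dfn_not: "dfn M P \<Longrightarrow> dfn M (\<lambda>v. \<not> P v)"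
| dfn_conj: "dfn M P \<Longrightarrow> dfn M Q \<Longrightarrow> dfn M (\<lambda>v. P v \<and> Q v)"
| dfn_all: "dfn M (\<lambda>v. R (v 0) (\<lambda>i. v (Suc i))) \<Longrightarrow> dfn M (\<lambda>v. \<forall>x\<in>Univ M. R x v)"
| dfn_cong: "dfn M P \<Longrightarrow> (\<And>v. range v \<subseteq> Univ M \<Longrightarrow> Q v = P v) \<Longrightarrow> dfn M Q"

text \<open>A formula sees a single environment. The arguments of a predicate go to the even indices
  and its parameters to the odd ones, so neither list runs out of room.\<close>

definition merge :: "(nat \<Rightarrow> 'm) \<Rightarrow> (nat \<Rightarrow> 'm) \<Rightarrow> nat \<Rightarrow> 'm" where
  "merge v w i = (if even i then v (i div 2) else w (i div 2))"

lemma merge_simps [simp]: "merge v w (2 * i) = v i" "merge v w (Suc (2 * i)) = w i"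
  by (auto simp: merge_def)

lemma range_merge: "range v \<subseteq> U \<Longrightarrow> range w \<subseteq> U \<Longrightarrow> range (merge v w) \<subseteq> U"
  by (auto simp: merge_def)

text \<open>A constant has to be stored as a parameter, and the caller chooses its slot
  \<open>k\<close>; the two sides of an atomic formula use slots 0 and 1 and so do not collide. The
  element \<open>a\<close> fills the slot when the term is a variable.\<close>

lemma tm_merge:
  assumes "tm M t" "a \<in> Univ M"
  obtains n c where "c \<in> Univ M" "\<And>v w. w k = c \<Longrightarrow> t v = merge v w n"
  using assms
proof cases
  case (tm_var i)
  with assms that[of a "2 * i"] show ?thesis by simp
next
  case (tm_const c)
  with that[of c "Suc (2 * k)"] show ?thesis by simp
qed

text \<open>Induction on the derivation of \<open>dfn\<close> matches each rule with a formula
  constructor, at the price of rearranging parameters with \<open>ren\<close>. After this,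
  definability is checked on HOL predicates, and only the two axiom schemas still mention
  formulas.\<close>

lemma dfn_sat:
  assumes "dfn M P" "a \<in> Univ M"
  shows "\<exists>p w. range w \<subseteq> Univ M \<and> (\<forall>v. range v \<subseteq> Univ M \<longrightarrow> P v = sat M p (merge v w))"
  using assms(1)
proof induction
  case (dfn_Mem s t)
  from tm_merge[OF dfn_Mem(1) assms(2), of 0] obtain m c
    where m: "c \<in> Univ M" "\<And>v w. w 0 = c \<Longrightarrow> s v = merge v w m" by metis
  from tm_merge[OF dfn_Mem(2) assms(2), of 1] obtain n d
    where n: "d \<in> Univ M" "\<And>v w. w 1 = d \<Longrightarrow> t v = merge v w n" by metis
  let ?w = "\<lambda>i. if i = 0 then c else d"
  have "Mem M (s v) (t v) = sat M (Member m n) (merge v ?w)" for v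
    using m(2)[of ?w v] n(2)[of ?w v] by simp
  moreover have "range ?w \<subseteq> Univ M" using m n by auto
  ultimately show ?case by blast
next
  case (dfn_eq s t)
  from tm_merge[OF dfn_eq(1) assms(2), of 0] obtain m c
    where m: "c \<in> Univ M" "\<And>v w. w 0 = c \<Longrightarrow> s v = merge v w m" by metis
  from tm_merge[OF dfn_eq(2) assms(2), of 1] obtain n d
    where n: "d \<in> Univ M" "\<And>v w. w 1 = d \<Longrightarrow> t v = merge v w n" by metis
  let ?w = "\<lambda>i. if i = 0 then c else d"
  have "(s v = t v) = sat M (Equal m n) (merge v ?w)" for v
    using m(2)[of ?w v] n(2)[of ?w v] by simp
  moreover have "range ?w \<subseteq> Univ M" using m n by auto
  ultimately show ?case by blast
next
  case (dfn_not P)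
  then obtain p w where "range w \<subseteq> Univ M"
    "\<forall>v. range v \<subseteq> Univ M \<longrightarrow> P v = sat M p (merge v w)" by blast
  then have "range w \<subseteq> Univ M \<and> (\<forall>v. range v \<subseteq> Univ M \<longrightarrow> (\<not> P v) = sat M (Neg p) (merge v w))"
    by simp
  then show ?case by blast
next
  case (dfn_conj P Q)
  then obtain p w q z where p: "range w \<subseteq> Univ M"
    "\<And>v. range v \<subseteq> Univ M \<Longrightarrow> P v = sat M p (merge v w)"
    and q: "range z \<subseteq> Univ M" "\<And>v. range v \<subseteq> Univ M \<Longrightarrow> Q v = sat M q (merge v z)"
    by metis
  \<comment> \<open>Two parameter lists are interleaved into one: \<open>w j\<close>, stored at
    index 2j+1, moves to 4j+1, and \<open>z j\<close> moves to 4j+3.\<close>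
  define f where "f i = (if even i then i else 2 * i - 1)" for i :: nat
  define g where "g i = (if even i then i else 2 * i + 1)" for i :: nat
  have "inj f" "inj g"
    unfolding inj_def f_def g_def by (auto; presburger)+
  have f: "merge v (merge w z) \<circ> f = merge v w" and g: "merge v (merge w z) \<circ> g = merge v z" for v
  proof -
    have "merge v (merge w z) (f i) = merge v w i \<and> merge v (merge w z) (g i) = merge v z i" for i
    proof (cases "even i")
      case True
      then show ?thesis by (simp add: merge_def f_def g_def)
    next
      case False
      then obtain j where "i = 2 * j + 1" using oddE by blast
      then have i: "i = Suc (2 * j)" "f i = Suc (2 * (2 * j))" "g i = Suc (2 * Suc (2 * j))"
        by (auto simp: f_def g_def)
      show ?thesis unfolding i(2,3) merge_simps unfolding i(1) merge_simps by simp
    qed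
    then show "merge v (merge w z) \<circ> f = merge v w" "merge v (merge w z) \<circ> g = merge v z"
      by (auto simp: fun_eq_iff)
  qed
  have "\<forall>v. range v \<subseteq> Univ M \<longrightarrow>
      (P v \<and> Q v) = sat M (Conj (ren f p) (ren g q)) (merge v (merge w z))"
    using p(2) q(2) by (simp add: sat_ren \<open>inj f\<close> \<open>inj g\<close> f g)
  moreover have "range (merge w z) \<subseteq> Univ M" using p(1) q(1) by (rule range_merge)
  ultimately show ?case by blast
next
  case (dfn_all R)
  then obtain p w where p: "range w \<subseteq> Univ M"
    "\<And>v. range v \<subseteq> Univ M \<Longrightarrow> R (v 0) (\<lambda>i. v (Suc i)) = sat M p (merge v w)" by metis
  \<comment> \<open>The de Bruijn variable 0 becomes the named variable 1, which is free because all
    parameters are shifted by one place; variable j+1 becomes variable j.\<close>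
  define f where "f i = (if i = 0 then 1 else if even i then i - 2 else i + 2)" for i :: nat
  define z where "z i = w (i - 1)" for i
  have "inj f"
    unfolding inj_def f_def by (auto; presburger)
  have f: "(merge v z)(1 := x) \<circ> f = merge (case_nat x v) w" for v x
  proof
    fix i
    show "((merge v z)(1 := x) \<circ> f) i = merge (case_nat x v) w i"
    proof (cases "even i")
      case True
      then obtain j where "i = 2 * j" by blast
      then show ?thesis by (cases j) (auto simp: merge_def f_def)
    next
      case False
      then obtain j where "i = 2 * j + 1" using oddE by blast
      then have i: "i = Suc (2 * j)" "f i = Suc (2 * Suc j)" by (auto simp: f_def)
      have "merge v z (f i) = w j" unfolding i(2) merge_simps z_def by simp
      then show ?thesis using i by (simp add: merge_def)
    qed
  qed
  have "(\<forall>x\<in>Univ M. R x v) = sat M (Forall 1 (ren f p)) (merge v z)" if "range v \<subseteq> Univ M" for v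
  proof -
    have "R x v = sat M p (merge (case_nat x v) w)" if "x \<in> Univ M" for x
      using p(2)[of "case_nat x v"] that \<open>range v \<subseteq> Univ M\<close>
      by (auto simp: image_subset_iff split: nat.split)
    then show ?thesis using f by (simp add: sat_ren \<open>inj f\<close>)
  qed
  moreover have "range z \<subseteq> Univ M" using p(1) by (auto simp: z_def)
  ultimately show ?case by blast
next
  case (dfn_cong P Q)
  then show ?case by metis
qed

lemma tm_subst:
  assumes "tm M t" "\<And>i. tm M (\<sigma> i)"
  shows "tm M (\<lambda>v. t (\<lambda>i. \<sigma> i v))"
  using assms(1) by cases (auto intro: assms(2) tm_const)

lemma tm_lift: "tm M t \<Longrightarrow> tm M (\<lambda>v. t (\<lambda>i. v (Suc i)))"
  by (rule tm_subst) (auto intro: tm_var)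

lemma tm_in_Univ: "tm M t \<Longrightarrow> range v \<subseteq> Univ M \<Longrightarrow> t v \<in> Univ M"
  by (auto elim!: tm.cases)

text \<open>Under a quantifier the substitution is lifted past the new variable 0. Thanks to this
  lemma a notion is proved definable once, for variables, and then used for arbitrary terms through
  \<open>dfn1\<close>, \<open>dfn2\<close> and \<open>dfn3\<close>.\<close>

lemma dfn_subst:
  assumes "dfn M P" "\<And>i. tm M (\<sigma> i)"
  shows "dfn M (\<lambda>v. P (\<lambda>i. \<sigma> i v))"
  using assms
proof (induction arbitrary: \<sigma>)
  case (dfn_all R)
  let ?\<sigma> = "\<lambda>i v. case i of 0 \<Rightarrow> v 0 | Suc j \<Rightarrow> \<sigma> j (\<lambda>i. v (Suc i))"
  have "tm M (?\<sigma> i)" for i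
    using dfn_all.prems by (cases i) (auto intro: tm_var tm_lift)
  from dfn_all.IH[of ?\<sigma>, OF this]
  have "dfn M (\<lambda>v. (\<lambda>x w. R x (\<lambda>i. \<sigma> i w)) (v 0) (\<lambda>i. v (Suc i)))" by simp
  then show ?case by (rule dfn.dfn_all)
next
  case (dfn_cong P Q)
  have "range (\<lambda>i. \<sigma> i v) \<subseteq> Univ M" if "range v \<subseteq> Univ M" for v
    using tm_in_Univ[OF dfn_cong.prems that] by auto
  then show ?case using dfn_cong by (intro dfn.dfn_cong[OF dfn_cong.IH]) auto
next
  case (dfn_Mem s t)
  then show ?case by (intro dfn.dfn_Mem tm_subst[OF dfn_Mem(1)] tm_subst[OF dfn_Mem(2)])
next
  case (dfn_eq s t)
  then show ?case by (intro dfn.dfn_eq tm_subst[OF dfn_eq(1)] tm_subst[OF dfn_eq(2)])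
qed (auto intro: dfn.intros)

section \<open>Derived closure rules for definability\<close>

lemma dfn1: "dfn M (\<lambda>v. Q (v 0)) \<Longrightarrow> tm M s \<Longrightarrow> dfn M (\<lambda>v. Q (s v))"
  using dfn_subst[of M "\<lambda>v. Q (v 0)" "\<lambda>_. s"] by simp

lemma dfn2: "dfn M (\<lambda>v. Q (v 0) (v 1)) \<Longrightarrow> tm M s \<Longrightarrow> tm M t \<Longrightarrow> dfn M (\<lambda>v. Q (s v) (t v))"
  using dfn_subst[of M "\<lambda>v. Q (v 0) (v 1)" "\<lambda>i. if i = 0 then s else t"] by simp

lemma dfn3: "dfn M (\<lambda>v. Q (v 0) (v 1) (v 2)) \<Longrightarrow> tm M s \<Longrightarrow> tm M t \<Longrightarrow> tm M u \<Longrightarrow>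
    dfn M (\<lambda>v. Q (s v) (t v) (u v))"
  using dfn_subst[of M "\<lambda>v. Q (v 0) (v 1) (v 2)"
      "\<lambda>i. if i = 0 then s else if i = 1 then t else u"] by simp

lemma dfn_disj: "dfn M P \<Longrightarrow> dfn M Q \<Longrightarrow> dfn M (\<lambda>v. P v \<or> Q v)"
  by (rule dfn_cong[OF dfn_not[OF dfn_conj[OF dfn_not dfn_not]]]) auto

lemma dfn_imp: "dfn M P \<Longrightarrow> dfn M Q \<Longrightarrow> dfn M (\<lambda>v. P v \<longrightarrow> Q v)"
  by (rule dfn_cong[OF dfn_disj[OF dfn_not]]) auto

lemma dfn_iff: "dfn M P \<Longrightarrow> dfn M Q \<Longrightarrow> dfn M (\<lambda>v. P v \<longleftrightarrow> Q v)"
  by (rule dfn_cong[OF dfn_conj[OF dfn_imp[of M P Q] dfn_imp[of M Q P]]]) auto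

lemma dfn_ex: "dfn M (\<lambda>v. R (v 0) (\<lambda>i. v (Suc i))) \<Longrightarrow> dfn M (\<lambda>v. \<exists>x\<in>Univ M. R x v)"
  using dfn_not[OF dfn_all[of M "\<lambda>x v. \<not> R x v"]] by (simp add: dfn_not)

lemma dfn_bool: "dfn M (\<lambda>v. b)"
proof -
  have "dfn M (\<lambda>v. v 0 = v 0)" by (intro dfn_eq tm_var)
  then have t: "dfn M (\<lambda>v. True)" by simp
  show ?thesis using t dfn_not[OF t] by (cases b) auto
qed

lemma dfn_elem: "tm M s \<Longrightarrow> tm M t \<Longrightarrow> dfn M (\<lambda>v. s v \<in> elems M (t v))"
  by (rule dfn_cong[OF dfn_Mem]) (auto simp: elems_def tm_in_Univ)

lemma dfn_ball:
  assumes "tm M t" "dfn M (\<lambda>v. R (v 0) (\<lambda>i. v (Suc i)))"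
  shows "dfn M (\<lambda>v. \<forall>x\<in>elems M (t v). R x v)"
proof -
  have "dfn M (\<lambda>v. \<forall>x\<in>Univ M. Mem M x (t v) \<longrightarrow> R x v)"
    by (intro dfn_all dfn_imp dfn_Mem tm_var tm_lift assms)
  then show ?thesis by (rule dfn_cong) (auto simp: elems_def)
qed

lemma dfn_bex:
  assumes "tm M t" "dfn M (\<lambda>v. R (v 0) (\<lambda>i. v (Suc i)))"
  shows "dfn M (\<lambda>v. \<exists>x\<in>elems M (t v). R x v)"
  using dfn_not[OF dfn_ball[OF assms(1), of "\<lambda>x v. \<not> R x v"]] assms(2)
  by (simp add: dfn_not)

text \<open>The definitions of set-theoretic notions often quantify over the whole type. Such a
  quantifier may be read over \<open>Univ\<close> if every witness, or dually every counterexample,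
  lies there.\<close>

lemma dfn_ex_unbounded: "dfn M (\<lambda>v. R (v 0) (\<lambda>i. v (Suc i))) \<Longrightarrow>
    (\<And>x v. range v \<subseteq> Univ M \<Longrightarrow> R x v \<Longrightarrow> x \<in> Univ M) \<Longrightarrow> dfn M (\<lambda>v. \<exists>x. R x v)"
  by (rule dfn_cong[OF dfn_ex[of M R]]) auto

lemma dfn_all_unbounded: "dfn M (\<lambda>v. R (v 0) (\<lambda>i. v (Suc i))) \<Longrightarrow>
    (\<And>x v. range v \<subseteq> Univ M \<Longrightarrow> \<not> R x v \<Longrightarrow> x \<in> Univ M) \<Longrightarrow> dfn M (\<lambda>v. \<forall>x. R x v)"
  by (rule dfn_cong[OF dfn_all[of M R]]) blast+

lemma dfn_insert: "dfn M (\<lambda>v. s v = t v \<or> s v \<in> X v) \<Longrightarrow> dfn M (\<lambda>v. s v \<in> insert (t v) (X v))"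
  by simp

lemma dfn_Collect: "dfn M (\<lambda>v. P (s v) v) \<Longrightarrow> dfn M (\<lambda>v. s v \<in> {z. P z v})"
  by simp

text \<open>\<open>X\<close> is an external set rather than an object of the structure, so it is its
  membership predicate that has to be definable.\<close>

lemma dfn_represents:
  assumes "tm M s" "dfn M (\<lambda>v. v 0 \<in> X (\<lambda>i. v (Suc i)))"
    "\<And>v. range v \<subseteq> Univ M \<Longrightarrow> X v \<subseteq> Univ M" "Atoms M \<in> Univ M"
  shows "dfn M (\<lambda>v. represents M (s v) (X v))"
proof -
  have "dfn M (\<lambda>v. \<not> s v \<in> elems M (Atoms M) \<and> (\<forall>z\<in>Univ M. z \<in> elems M (s v) \<longleftrightarrow> z \<in> X v))"
    using assms(1,2,4)
    by (intro dfn_conj dfn_not dfn_elem dfn_all dfn_iff tm_const tm_var tm_lift) auto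
  then show ?thesis
    by (rule dfn_cong)
      (use assms in \<open>auto simp: represents_def isset_def tm_in_Univ elems_def set_eq_iff subset_iff\<close>)
qed

lemma dfn_in_empty: "dfn M (\<lambda>v. s v \<in> {})"
  by (simp add: dfn_bool)

lemmas dfn_intros = tm_var tm_const dfn_eq dfn_bool dfn_in_empty dfn_insert dfn_Collect dfn_not dfn_conj
  dfn_disj dfn_imp dfn_iff dfn_elem dfn_ball dfn_bex dfn_all dfn_ex dfn_represents

section \<open>Elementary set theory in a model of ZFA\<close>

lemma elems_Univ: "x \<in> elems M y \<Longrightarrow> x \<in> Univ M"
  by (simp add: elems_def)

lemma isset_Univ: "isset M x \<Longrightarrow> x \<in> Univ M"
  by (simp add: isset_def)

lemma is_pair_Univ:
  assumes "is_pair M p x y"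
  shows "p \<in> Univ M" "x \<in> Univ M" "y \<in> Univ M"
proof -
  from assms obtain u v where "elems M u = {x}" "elems M v = {x, y}" "isset M p"
    by (auto simp: is_pair_def represents_def)
  then show "p \<in> Univ M" "x \<in> Univ M" "y \<in> Univ M"
    using elems_Univ[of _ M u] elems_Univ[of _ M v] by (auto simp: isset_def)
qed

lemma related_Univ:
  assumes "related M r x y" shows "x \<in> Univ M" "y \<in> Univ M"
  using assms is_pair_Univ by (auto simp: related_def)

locale zfa =
  fixes M :: "'m zfa_structure"
  assumes ZFA: "ZFA_model M"
begin

abbreviation U where "U \<equiv> Univ M"
abbreviation E where "E \<equiv> elems M"
abbreviation A where "A \<equiv> Atoms M"

lemma A_Univ: "A \<in> U"
  using ZFA by (simp add: ZFA_model_def)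

lemma atom_empty: "a \<in> E A \<Longrightarrow> E a = {}"
  using ZFA by (simp add: ZFA_model_def)

lemma isset_extensional: "isset M x \<Longrightarrow> isset M y \<Longrightarrow> E x = E y \<Longrightarrow> x = y"
  using ZFA[unfolded ZFA_model_def, THEN conjunct2, THEN conjunct2, THEN conjunct1] by blast

lemma ex_empty: "\<exists>z. isset M z \<and> E z = {}"
  using ZFA by (auto simp: ZFA_model_def is_empty_def represents_def)

lemma ex_upair: "x \<in> U \<Longrightarrow> y \<in> U \<Longrightarrow> \<exists>u. isset M u \<and> E u = {x, y}"
  using ZFA[unfolded ZFA_model_def, THEN conjunct2, THEN conjunct2, THEN conjunct2, THEN conjunct2, THEN conjunct1]
  unfolding represents_def by blast

lemma ex_Union: "x \<in> U \<Longrightarrow> \<exists>u. isset M u \<and> E u = (\<Union>y\<in>E x. E y)"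
  using ZFA[unfolded ZFA_model_def, THEN conjunct2, THEN conjunct2, THEN conjunct2, THEN conjunct2, THEN conjunct2, THEN conjunct1]
  unfolding represents_def by blast

lemma ex_Pow: "x \<in> U \<Longrightarrow> \<exists>u. isset M u \<and> E u = {y. isset M y \<and> E y \<subseteq> E x}"
  using ZFA[unfolded ZFA_model_def, THEN conjunct2, THEN conjunct2, THEN conjunct2, THEN conjunct2, THEN conjunct2, THEN conjunct2, THEN conjunct1]
  unfolding represents_def by blast

lemma foundation: "x \<in> U \<Longrightarrow> E x \<noteq> {} \<Longrightarrow> \<exists>y\<in>E x. E y \<inter> E x = {}"
  using ZFA[unfolded ZFA_model_def, THEN conjunct2, THEN conjunct2, THEN conjunct2, THEN conjunct2, THEN conjunct2, THEN conjunct2, THEN conjunct2, THEN conjunct2, THEN conjunct1] by blast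

lemma ex_inductive: "\<exists>I. is_inductive M I"
  using ZFA[unfolded ZFA_model_def, THEN conjunct2, THEN conjunct2, THEN conjunct2, THEN conjunct2, THEN conjunct2, THEN conjunct2, THEN conjunct2, THEN conjunct1] .

text \<open>Index 0, which the schema varies, is also the place of variable 0 in
  \<open>merge\<close>, so the formula from \<open>dfn_sat\<close> is used unchanged.\<close>

lemma separation:
  assumes "dfn M (\<lambda>v. P (v 0))" "x \<in> U"
  shows "\<exists>u. isset M u \<and> E u = {y \<in> E x. P y}"
proof -
  from dfn_sat[OF assms] obtain p w where w: "range w \<subseteq> U"
    and p: "\<And>v. range v \<subseteq> U \<Longrightarrow> P (v 0) = sat M p (merge v w)" by blast
  let ?v = "merge (\<lambda>_. x) w"
  have v: "range ?v \<subseteq> U" using w assms(2) by (intro range_merge) auto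
  have "sat M p (?v(0 := y)) = P y" if "y \<in> E x" for y
  proof -
    have "?v(0 := y) = merge ((\<lambda>_. x)(0 := y)) w" by (auto simp: fun_eq_iff merge_def)
    moreover have "range ((\<lambda>_. x)(0 := y)) \<subseteq> U" using assms(2) elems_Univ[OF that] by auto
    ultimately show ?thesis using p by (metis fun_upd_same)
  qed
  then have "{y \<in> E x. sat M p (?v(0 := y))} = {y \<in> E x. P y}" by blast
  moreover have "\<exists>u. represents M u {y \<in> E x. sat M p (?v(0 := y))}"
    using ZFA[unfolded ZFA_model_def, THEN conjunct2, THEN conjunct2, THEN conjunct2, THEN conjunct2, THEN conjunct2, THEN conjunct2, THEN conjunct2, THEN conjunct2, THEN conjunct2, THEN conjunct1] v assms(2) by blast
  ultimately show ?thesis by (simp add: represents_def)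
qed

lemma replacement:
  assumes "dfn M (\<lambda>v. P (v 0) (v 1))" "x \<in> U"
    and single: "\<And>y z z'. y \<in> E x \<Longrightarrow> z \<in> U \<Longrightarrow> z' \<in> U \<Longrightarrow> P y z \<Longrightarrow> P y z' \<Longrightarrow> z = z'"
  shows "\<exists>u. isset M u \<and> E u = {z \<in> U. \<exists>y\<in>E x. P y z}"
proof -
  from dfn_sat[OF assms(1,2)] obtain p w where w: "range w \<subseteq> U"
    and p: "\<And>v. range v \<subseteq> U \<Longrightarrow> P (v 0) (v 1) = sat M p (merge v w)" by blast
  \<comment> \<open>The schema expects argument and value at indices 0 and 1, while
    \<open>merge\<close> puts them at 0 and 2 and keeps a parameter at 1. Swapping 1 and 2 repairs
    this.\<close>
  define f where "f = id(1 := 2, 2 := 1 :: nat)"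
  have "inj f" by (auto simp: inj_def f_def)
  let ?v = "merge (\<lambda>_. x) w \<circ> f"
  have v: "range ?v \<subseteq> U" using range_merge[OF _ w, of "\<lambda>_. x"] assms(2) by auto
  have P: "sat M (ren f p) (?v(0 := y, 1 := z)) = P y z" if "y \<in> U" "z \<in> U" for y z
  proof -
    have "?v(0 := y, 1 := z) \<circ> f = merge ((\<lambda>_. x)(0 := y, 1 := z)) w"
      by (auto simp: fun_eq_iff merge_def f_def elim!: oddE)
    moreover have "range ((\<lambda>_. x)(0 := y, 1 := z)) \<subseteq> U" using assms(2) that by auto
    from p[OF this] have "sat M p (merge ((\<lambda>_. x)(0 := y, 1 := z)) w) = P y z" by simp
    ultimately show ?thesis by (simp only: sat_ren[OF \<open>inj f\<close>])
  qed
  have "\<forall>y\<in>E x. \<forall>z\<in>U. \<forall>z'\<in>U. sat M (ren f p) (?v(0 := y, 1 := z)) \<and>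
      sat M (ren f p) (?v(0 := y, 1 := z')) \<longrightarrow> z = z'"
    using P single elems_Univ[of _ M x] by metis
  then have "\<exists>u. represents M u {z \<in> U. \<exists>y\<in>E x. sat M (ren f p) (?v(0 := y, 1 := z))}"
    using ZFA[unfolded ZFA_model_def, THEN conjunct2, THEN conjunct2, THEN conjunct2, THEN conjunct2, THEN conjunct2, THEN conjunct2, THEN conjunct2, THEN conjunct2, THEN conjunct2, THEN conjunct2] v assms(2) by blast
  moreover have "{z \<in> U. \<exists>y\<in>E x. sat M (ren f p) (?v(0 := y, 1 := z))} = {z \<in> U. \<exists>y\<in>E x. P y z}"
    using P elems_Univ[of _ M x] by blast
  ultimately show ?thesis by (simp add: represents_def)
qed

lemma dfn_isset: "tm M s \<Longrightarrow> dfn M (\<lambda>v. isset M (s v))"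
proof (rule dfn1)
  have "dfn M (\<lambda>v. v 0 \<notin> E A)" by (intro dfn_intros A_Univ)
  then show "dfn M (\<lambda>v. isset M (v 0))"
    by (rule dfn_cong) (auto simp: isset_def)
qed

lemma dfn_is_pair: "tm M s \<Longrightarrow> tm M t \<Longrightarrow> tm M u \<Longrightarrow> dfn M (\<lambda>v. is_pair M (s v) (t v) (u v))"
proof (rule dfn3)
  show "dfn M (\<lambda>v. is_pair M (v 0) (v 1) (v 2))"
    unfolding is_pair_def
    by (intro dfn_intros dfn_ex_unbounded)
      (auto simp: image_subset_iff represents_def isset_def A_Univ)
qed

lemma dfn_related: "tm M s \<Longrightarrow> tm M t \<Longrightarrow> tm M u \<Longrightarrow> dfn M (\<lambda>v. related M (s v) (t v) (u v))"
proof (rule dfn3)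
  show "dfn M (\<lambda>v. related M (v 0) (v 1) (v 2))"
    unfolding related_def by (intro dfn_intros dfn_is_pair)
qed

lemmas dfn_rules = dfn_intros dfn_isset dfn_is_pair dfn_related

section \<open>Unions, pairs and relations\<close>

lemma ex_Un: "x \<in> U \<Longrightarrow> y \<in> U \<Longrightarrow> \<exists>u. isset M u \<and> E u = E x \<union> E y"
  using ex_upair[of x y] ex_Union isset_Univ by (metis UN_insert UN_empty Un_empty_right)

lemma ex_insert: "x \<in> U \<Longrightarrow> y \<in> U \<Longrightarrow> \<exists>u. isset M u \<and> E u = insert x (E y)"
  using ex_upair[of x x] ex_Un[of _ y] by (metis insert_absorb2 insert_is_Un isset_Univ)

lemma ex_pair: "x \<in> U \<Longrightarrow> y \<in> U \<Longrightarrow> \<exists>p. is_pair M p x y"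
  unfolding is_pair_def represents_def
  using ex_upair[of x x] ex_upair[of x y] ex_upair isset_Univ by (metis insert_absorb2)

lemma is_pair_unique: "is_pair M p x y \<Longrightarrow> is_pair M q x y \<Longrightarrow> p = q"
  unfolding is_pair_def represents_def using isset_extensional by metis

lemma is_pair_inject: "is_pair M p x y \<Longrightarrow> is_pair M p x' y' \<Longrightarrow> x = x' \<and> y = y'"
proof -
  assume "is_pair M p x y" "is_pair M p x' y'"
  then obtain u v u' v' where "E u = {x}" "E v = {x, y}" "E p = {u, v}"
    "E u' = {x'}" "E v' = {x', y'}" "E p = {u', v'}"
    unfolding is_pair_def represents_def by blast
  then show ?thesis by (auto simp: doubleton_eq_iff)
qed

lemma related_pair: "is_pair M p x y \<Longrightarrow> related M r x y \<longleftrightarrow> p \<in> E r"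
  unfolding related_def using is_pair_unique by blast

text \<open>A Kuratowski pair is a set of sets of points, so all pairs lie in the double power set
  of the union. A superset of the product is enough, since \<open>ex_rel\<close> separates from
  it.\<close>

lemma ex_Times:
  assumes "X \<in> U" "Y \<in> U"
  shows "\<exists>T. isset M T \<and> (\<forall>x\<in>E X. \<forall>y\<in>E Y. \<forall>p. is_pair M p x y \<longrightarrow> p \<in> E T)"
proof -
  obtain Z where Z: "isset M Z" "E Z = E X \<union> E Y" using ex_Un[OF assms] by blast
  obtain Q where Q: "isset M Q" "E Q = {y. isset M y \<and> E y \<subseteq> E Z}"
    using ex_Pow[OF isset_Univ[OF Z(1)]] by blast
  obtain T where T: "isset M T" "E T = {y. isset M y \<and> E y \<subseteq> E Q}"
    using ex_Pow[OF isset_Univ[OF Q(1)]] by blast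
  have "p \<in> E T" if "x \<in> E X" "y \<in> E Y" "is_pair M p x y" for x y p
    using that unfolding is_pair_def represents_def T(2) Q(2) Z(2) by auto
  then show ?thesis using T(1) by blast
qed

definition is_rel :: "'m \<Rightarrow> 'm \<Rightarrow> 'm \<Rightarrow> bool" where
  "is_rel S X Y \<longleftrightarrow> isset M S \<and> (\<forall>p\<in>E S. \<exists>x\<in>E X. \<exists>y\<in>E Y. is_pair M p x y)"

lemma ex_rel:
  assumes "dfn M (\<lambda>v. Q (v 0) (v 1))" "X \<in> U" "Y \<in> U"
  shows "\<exists>S. is_rel S X Y \<and> (\<forall>x y. related M S x y \<longleftrightarrow> x \<in> E X \<and> y \<in> E Y \<and> Q x y)"
proof -
  obtain T where T: "isset M T" "\<And>x y p. x \<in> E X \<Longrightarrow> y \<in> E Y \<Longrightarrow> is_pair M p x y \<Longrightarrow> p \<in> E T"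
    using ex_Times[OF assms(2,3)] by blast
  have "\<exists>S. isset M S \<and> E S = {p \<in> E T. \<exists>x\<in>E X. \<exists>y\<in>E Y. is_pair M p x y \<and> Q x y}"
    using assms isset_Univ[OF T(1)]
    by (intro separation dfn_rules dfn2[of M Q, OF assms(1)])
  then obtain S where S: "isset M S"
    "E S = {p \<in> E T. \<exists>x\<in>E X. \<exists>y\<in>E Y. is_pair M p x y \<and> Q x y}" by blast
  have "related M S x y \<longleftrightarrow> x \<in> E X \<and> y \<in> E Y \<and> Q x y" for x y
  proof
    assume "related M S x y"
    then show "x \<in> E X \<and> y \<in> E Y \<and> Q x y"
      unfolding related_def S(2) using is_pair_inject by blast
  next
    assume *: "x \<in> E X \<and> y \<in> E Y \<and> Q x y"
    then obtain p where "is_pair M p x y" using ex_pair elems_Univ by metis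
    then show "related M S x y" using * T(2) unfolding related_def S(2) by blast
  qed
  then show ?thesis using S unfolding is_rel_def by blast
qed

text \<open>Foundation is applied to the set of counterexamples in \<open>t\<close>. Definability of
  \<open>P\<close> makes this a set of the structure; for arbitrary predicates induction can fail in
  an externally ill-founded structure.\<close>

lemma transitive_induct:
  assumes "dfn M (\<lambda>v. P (v 0))" "is_transitive M t" "x \<in> E t"
    and step: "\<And>x. x \<in> E t \<Longrightarrow> (\<And>y. y \<in> E x \<Longrightarrow> P y) \<Longrightarrow> P x"
  shows "P x"
proof (rule ccontr)
  assume "\<not> P x"
  have "t \<in> U" using assms(2) by (simp add: is_transitive_def isset_def)
  have "\<exists>u. isset M u \<and> E u = {y \<in> E t. \<not> P y}"
    using assms(1) \<open>t \<in> U\<close> by (intro separation dfn_not)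
  then obtain u where u: "isset M u" "E u = {y \<in> E t. \<not> P y}" by blast
  with \<open>\<not> P x\<close> assms(3) foundation[OF isset_Univ] obtain y
    where "y \<in> E u" "E y \<inter> E u = {}" by blast
  then show False using step[of y] assms(2) u unfolding is_transitive_def by blast
qed

lemma is_succ_elems: "is_succ M s x \<Longrightarrow> E s = insert x (E x)"
  by (simp add: is_succ_def represents_def)

lemma is_empty_unique: "is_empty M z \<Longrightarrow> is_empty M z' \<Longrightarrow> z = z'"
  unfolding is_empty_def represents_def using isset_extensional by metis

lemma dfn_is_empty: "tm M s \<Longrightarrow> dfn M (\<lambda>v. is_empty M (s v))"
proof (rule dfn1)
  show "dfn M (\<lambda>v. is_empty M (v 0))"
    unfolding is_empty_def by (intro dfn_intros) (auto simp: A_Univ dfn_bool)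
qed

text \<open>The members of an inductive set that satisfy \<open>Q\<close> form an inductive set
  again, so nonstandard natural numbers are covered as well.\<close>

lemma nat_induct [consumes 1, case_names dfn empty succ]:
  assumes "is_nat M n" "dfn M (\<lambda>v. Q (v 0))"
    and "\<And>z. is_empty M z \<Longrightarrow> Q z" "\<And>i j. i \<in> U \<Longrightarrow> Q i \<Longrightarrow> is_succ M j i \<Longrightarrow> Q j"
  shows "Q n"
proof -
  obtain I where I: "is_inductive M I" using ex_inductive by blast
  then have "I \<in> U" by (simp add: is_inductive_def isset_def)
  with assms(2) have "\<exists>J. isset M J \<and> E J = {y \<in> E I. Q y}" by (intro separation)
  then obtain J where J: "isset M J" "E J = {y \<in> E I. Q y}" by blast
  have "is_inductive M J"
    using I J assms(3,4) elems_Univ unfolding is_inductive_def by (metis (mono_tags, lifting) mem_Collect_eq)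
  then show ?thesis using assms(1) J by (auto simp: is_nat_def)
qed

lemma nat_transitive:
  assumes "is_nat M n"
  shows "\<forall>i\<in>E n. E i \<subseteq> E n"
proof -
  have "\<forall>i\<in>E n. \<forall>j\<in>E i. j \<in> E n"
    using assms
  proof (induction rule: nat_induct)
    case dfn
    show ?case by (intro dfn_rules)
  next
    case (empty z)
    then show ?case by (simp add: is_empty_def represents_def)
  next
    case (succ i j)
    have "E j = insert i (E i)" using succ(2) by (rule is_succ_elems)
    then show ?case using succ(3) by (metis insert_iff)
  qed
  then show ?thesis by blast
qed

end

section \<open>The action of permutations of the atoms on the universe\<close>

context zfa
begin

lemma fun_domain: "is_fun M f X \<Longrightarrow> related M f x y \<Longrightarrow> x \<in> E X"
  unfolding is_fun_def related_def using is_pair_inject by metis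

lemma fun_total: "is_fun M f X \<Longrightarrow> x \<in> E X \<Longrightarrow> \<exists>y. related M f x y"
  unfolding is_fun_def by blast

lemma fun_unique: "is_fun M f X \<Longrightarrow> related M f x y \<Longrightarrow> related M f x z \<Longrightarrow> y = z"
  using fun_domain[of f X x y] unfolding is_fun_def by blast

text \<open>Unique existence is rewritten with quantifiers over \<open>U\<close>, the form in which
  the definability rules apply.\<close>

lemma is_fun_iff: "is_fun M f X \<longleftrightarrow> isset M f \<and> (\<forall>p\<in>E f. \<exists>x\<in>E X. \<exists>y\<in>U. is_pair M p x y) \<and>
    (\<forall>x\<in>E X. \<exists>y\<in>U. related M f x y \<and> (\<forall>z\<in>U. related M f x z \<longrightarrow> z = y))"
proof -
  have "(\<exists>!y. related M f x y) \<longleftrightarrow> (\<exists>y\<in>U. related M f x y \<and> (\<forall>z\<in>U. related M f x z \<longrightarrow> z = y))" for x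
    using related_Univ by metis
  moreover have "(\<exists>y. is_pair M p x y) \<longleftrightarrow> (\<exists>y\<in>U. is_pair M p x y)" for p x
    using is_pair_Univ by metis
  ultimately show ?thesis unfolding is_fun_def by presburger
qed

lemma dfn_is_transitive: "tm M s \<Longrightarrow> dfn M (\<lambda>v. is_transitive M (s v))"
proof (rule dfn1)
  have "dfn M (\<lambda>v. isset M (v 0) \<and> (\<forall>x\<in>E (v 0). \<forall>y\<in>E x. y \<in> E (v 0)))"
    by (intro dfn_rules)
  then show "dfn M (\<lambda>v. is_transitive M (v 0))"
    by (rule dfn_cong) (auto simp: is_transitive_def)
qed

lemma dfn_is_fun: "tm M s \<Longrightarrow> tm M t \<Longrightarrow> dfn M (\<lambda>v. is_fun M (s v) (t v))"
proof (rule dfn2)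
  show "dfn M (\<lambda>v. is_fun M (v 0) (v 1))"
    unfolding is_fun_iff by (intro dfn_rules)
qed

text \<open>A solution, on the transitive set \<open>t\<close>, of the recursion in
  \<open>ext_maps\<close>. It is named because the recursion theorem is proved by comparing and
  gluing such solutions.\<close>

definition approx :: "'m \<Rightarrow> 'm \<Rightarrow> 'm \<Rightarrow> bool" where
  "approx g t f \<longleftrightarrow> is_transitive M t \<and> is_fun M f t \<and>
     (\<forall>z w. related M f z w \<longrightarrow>
        (if z \<in> E A then related M g z w
         else represents M w {u. \<exists>v\<in>E z. related M f v u}))"

lemma ext_maps_iff: "ext_maps M g x y \<longleftrightarrow> (\<exists>t f. approx g t f \<and> x \<in> E t \<and> related M f x y)"
  unfolding ext_maps_def approx_def by blast

lemma approx_fun: "approx g t f \<Longrightarrow> is_fun M f t"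
  by (simp add: approx_def)

lemma approx_transitive: "approx g t f \<Longrightarrow> is_transitive M t"
  by (simp add: approx_def)

lemma approx_atom: "approx g t f \<Longrightarrow> related M f z w \<Longrightarrow> z \<in> E A \<Longrightarrow> related M g z w"
  by (simp add: approx_def)

lemma approx_set:
  assumes "approx g t f" "related M f z w" "z \<notin> E A"
  shows "isset M w \<and> E w = {u. \<exists>v\<in>E z. related M f v u}"
proof -
  have "if z \<in> E A then related M g z w else represents M w {u. \<exists>v\<in>E z. related M f v u}"
    using assms(1,2) unfolding approx_def by blast
  then show ?thesis using assms(3) by (simp add: represents_def)
qed

lemma transitiveD: "is_transitive M t \<Longrightarrow> x \<in> E t \<Longrightarrow> y \<in> E x \<Longrightarrow> y \<in> E t"
  by (auto simp: is_transitive_def)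

lemma transitive_Univ: "is_transitive M t \<Longrightarrow> t \<in> U"
  by (auto simp: is_transitive_def isset_def)

lemma approx_domain: "approx g t f \<Longrightarrow> related M f x y \<Longrightarrow> x \<in> E t"
  by (rule fun_domain[OF approx_fun])

lemma approx_total: "approx g t f \<Longrightarrow> x \<in> E t \<Longrightarrow> \<exists>y. related M f x y"
  by (rule fun_total[OF approx_fun])

lemma approx_single: "approx g t f \<Longrightarrow> related M f x y \<Longrightarrow> related M f x z \<Longrightarrow> y = z"
  by (rule fun_unique[OF approx_fun])

lemma approx_elem: "approx g t f \<Longrightarrow> x \<in> E t \<Longrightarrow> v \<in> E x \<Longrightarrow> v \<in> E t"
  by (rule transitiveD[OF approx_transitive])

lemma ext_mapsI: "approx g t f \<Longrightarrow> related M f x y \<Longrightarrow> ext_maps M g x y"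
  using approx_domain[of g t f x y] unfolding ext_maps_iff by blast

lemma ext_maps_Univ: "ext_maps M g x y \<Longrightarrow> x \<in> U \<and> y \<in> U"
  using related_Univ unfolding ext_maps_iff by metis

lemma dfn_ext_maps: "tm M s \<Longrightarrow> tm M t \<Longrightarrow> tm M u \<Longrightarrow> dfn M (\<lambda>v. ext_maps M (s v) (t v) (u v))"
proof (rule dfn3)
  have t: "t \<in> U" if "is_transitive M t" for t using that by (simp add: is_transitive_def isset_def)
  have f: "f \<in> U" if "is_fun M f t" for f t using that by (simp add: is_fun_def isset_def)
  show "dfn M (\<lambda>v. ext_maps M (v 0) (v 1) (v 2))"
    unfolding ext_maps_def if_bool_eq_conj
    by (intro dfn_rules dfn_is_transitive dfn_is_fun dfn_ex_unbounded dfn_all_unbounded)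
      (auto intro: t f A_Univ related_Univ)
qed

definition perm :: "'m \<Rightarrow> bool" where
  "perm g \<longleftrightarrow> is_bij M g A A"

lemma perm_fun: "perm g \<Longrightarrow> is_fun M g A"
  by (simp add: perm_def is_bij_def)

lemma perm_atoms: "perm g \<Longrightarrow> related M g a b \<Longrightarrow> a \<in> E A \<and> b \<in> E A"
  using fun_domain[OF perm_fun] unfolding perm_def is_bij_def by blast

lemma perm_inject: "perm g \<Longrightarrow> related M g a b \<Longrightarrow> related M g a' b \<Longrightarrow> a = a'"
  using perm_atoms[of g a b] unfolding perm_def is_bij_def by blast

text \<open>Membership induction: the value at a set is determined by the values at its elements,
  and these lie in both transitive domains.\<close>

lemma approx_unique:
  assumes "perm g" "approx g t f" "approx g t' f'" "related M f x y" "related M f' x y'"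
  shows "y = y'"
proof -
  have "\<forall>y\<in>U. \<forall>y'\<in>U. related M f x y \<and> related M f' x y' \<longrightarrow> y = y'"
  proof (rule transitive_induct)
    show "is_transitive M t" using assms(2) by (rule approx_transitive)
    show "x \<in> E t" using assms(2,4) by (rule approx_domain)
    show "dfn M (\<lambda>v. \<forall>y\<in>U. \<forall>y'\<in>U. related M f (v 0) y \<and> related M f' (v 0) y' \<longrightarrow> y = y')"
      by (intro dfn_rules) (use assms(2,3) in \<open>auto simp: approx_def is_fun_def isset_def\<close>)
  next
    fix x assume x: "x \<in> E t"
      and IH: "\<And>v. v \<in> E x \<Longrightarrow> \<forall>y\<in>U. \<forall>y'\<in>U. related M f v y \<and> related M f' v y' \<longrightarrow> y = y'"
    have "y = y'" if f: "related M f x y" "related M f' x y'" for y y'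
    proof (cases "x \<in> E A")
      case True
      then show ?thesis
        using fun_unique[OF perm_fun[OF assms(1)]] approx_atom[OF assms(2) f(1)]
          approx_atom[OF assms(3) f(2)] by blast
    next
      case False
      note y = approx_set[OF assms(2) f(1) False] approx_set[OF assms(3) f(2) False]
      have "related M f v u \<longleftrightarrow> related M f' v u" if "v \<in> E x" for v u
      proof -
        have "x \<in> E t'" using approx_domain[OF assms(3) f(2)] .
        then have vt: "v \<in> E t" "v \<in> E t'"
          using approx_elem[OF assms(2) x that] approx_elem[OF assms(3) _ that] by auto
        obtain w where w: "related M f v w" using approx_total[OF assms(2) vt(1)] by blast
        obtain w' where w': "related M f' v w'" using approx_total[OF assms(3) vt(2)] by blast
        have "w = w'" using IH[OF that] w w' related_Univ(2)[OF w] related_Univ(2)[OF w'] by blast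
        then show ?thesis using approx_single[OF assms(2) w] approx_single[OF assms(3) w'] w w' by blast
      qed
      then have "E y = E y'" using y by auto
      then show ?thesis using y isset_extensional[of y y'] by blast
    qed
    then show "\<forall>y\<in>U. \<forall>y'\<in>U. related M f x y \<and> related M f' x y' \<longrightarrow> y = y'" by blast
  qed
  then show ?thesis using assms(4,5) related_Univ by metis
qed

lemma ext_maps_unique: "perm g \<Longrightarrow> ext_maps M g x y \<Longrightarrow> ext_maps M g x z \<Longrightarrow> y = z"
  unfolding ext_maps_iff using approx_unique by blast

lemma approx_ext_maps:
  assumes "perm g" "approx g t f" "x \<in> E t"
  shows "ext_maps M g x y \<longleftrightarrow> related M f x y"
  using approx_total[OF assms(2,3)] ext_mapsI[OF assms(2), of x]
    ext_maps_unique[OF assms(1), of x] by metis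

text \<open>Solutions agree wherever both are defined. Hence \<open>ext_maps\<close> is
  single-valued, and replacement turns its restriction to \<open>D\<close> into one
  solution.\<close>

lemma approx_glue:
  assumes "perm g" "is_transitive M D" "\<And>u. u \<in> E D \<Longrightarrow> \<exists>w. ext_maps M g u w"
  shows "\<exists>f. approx g D f"
proof -
  have "g \<in> U" using perm_fun[OF assms(1)] by (simp add: is_fun_def isset_def)
  have "\<exists>f. isset M f \<and> E f = {p \<in> U. \<exists>u\<in>E D. \<exists>w\<in>U. ext_maps M g u w \<and> is_pair M p u w}"
  proof (rule replacement)
    show "dfn M (\<lambda>v. \<exists>w\<in>U. ext_maps M g (v 0) w \<and> is_pair M (v 1) (v 0) w)"
      by (intro dfn_rules dfn_ext_maps \<open>g \<in> U\<close>)
    show "D \<in> U" using assms(2) by (rule transitive_Univ)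
    show "z = z'" if "\<exists>w\<in>U. ext_maps M g y w \<and> is_pair M z y w"
      "\<exists>w\<in>U. ext_maps M g y w \<and> is_pair M z' y w" for y z z'
      using that ext_maps_unique[OF assms(1), of y] is_pair_unique[of z y] by metis
  qed
  then obtain f where f: "isset M f"
    "E f = {p \<in> U. \<exists>u\<in>E D. \<exists>w\<in>U. ext_maps M g u w \<and> is_pair M p u w}" by blast
  have rel: "related M f u w \<longleftrightarrow> u \<in> E D \<and> ext_maps M g u w" for u w
  proof
    assume "related M f u w"
    then show "u \<in> E D \<and> ext_maps M g u w"
      unfolding related_def f(2) using is_pair_inject by fast
  next
    assume *: "u \<in> E D \<and> ext_maps M g u w"
    then obtain p where "is_pair M p u w" "u \<in> U" "w \<in> U"
      using ext_maps_Univ[of g u w] ex_pair[of u w] by blast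
    then show "related M f u w" using * is_pair_Univ(1)[of M] unfolding related_def f(2) by blast
  qed
  have "is_fun M f D"
    unfolding is_fun_def rel
  proof (intro conjI ballI)
    show "\<exists>!y. x \<in> E D \<and> ext_maps M g x y" if "x \<in> E D" for x
      using assms(3)[OF that] ext_maps_unique[OF assms(1), of x] that by blast
  qed (use f in blast)+
  moreover have "if z \<in> E A then related M g z w else represents M w {u. \<exists>v\<in>E z. related M f v u}"
    if "related M f z w" for z w
  proof -
    from that have z: "z \<in> E D" "ext_maps M g z w" by (auto simp: rel)
    then obtain t' f' where a: "approx g t' f'" "z \<in> E t'" "related M f' z w"
      unfolding ext_maps_iff by blast
    have "related M f' v u \<longleftrightarrow> related M f v u" if "v \<in> E z" for v u
      using transitiveD[OF assms(2) z(1) that] approx_elem[OF a(1,2) that]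
        approx_ext_maps[OF assms(1) a(1)] rel by simp
    then have "{u. \<exists>v\<in>E z. related M f v u} = {u. \<exists>v\<in>E z. related M f' v u}" by blast
    then show ?thesis using a(1,3) unfolding approx_def by presburger
  qed
  ultimately show ?thesis using assms(2) unfolding approx_def by blast
qed

lemma ex_image:
  assumes "perm g" "approx g D f" "x \<in> U" "E x \<subseteq> E D"
  shows "\<exists>w. isset M w \<and> E w = {u. \<exists>v\<in>E x. related M f v u}"
proof -
  have "\<exists>w. isset M w \<and> E w = {u \<in> U. \<exists>v\<in>E x. related M f v u}"
  proof (rule replacement)
    have "f \<in> U" using approx_fun[OF assms(2)] by (simp add: is_fun_def isset_def)
    then show "dfn M (\<lambda>v. related M f (v 0) (v 1))" by (intro dfn_rules)
  qed (use assms(3) approx_single[OF assms(2)] in auto)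
  moreover have "{u \<in> U. \<exists>v\<in>E x. related M f v u} = {u. \<exists>v\<in>E x. related M f v u}"
    by (auto dest: related_Univ)
  ultimately show ?thesis by simp
qed

text \<open>The existence half of the recursion theorem. By the induction hypothesis the elements of
  \<open>x\<close> lie in the set \<open>D\<close> of those points of \<open>t\<close> where the
  extension is already defined; gluing over \<open>D\<close> and adjoining a value at
  \<open>x\<close> gives a larger solution.\<close>

lemma ext_maps_total:
  assumes g: "perm g" and t: "is_transitive M t" "x \<in> E t"
  shows "\<exists>y\<in>U. ext_maps M g x y"
  using _ t
proof (rule transitive_induct)
  have gU: "g \<in> U" using perm_fun[OF g] by (simp add: is_fun_def isset_def)
  then show "dfn M (\<lambda>v. \<exists>y\<in>U. ext_maps M g (v 0) y)" by (intro dfn_rules dfn_ext_maps)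
  fix x assume x: "x \<in> E t" and IH: "\<And>v. v \<in> E x \<Longrightarrow> \<exists>y\<in>U. ext_maps M g v y"
  have xU: "x \<in> U" using x by (rule elems_Univ)
  have "\<exists>D. isset M D \<and> E D = {v \<in> E t. \<exists>y\<in>U. ext_maps M g v y}"
    by (intro separation dfn_rules dfn_ext_maps gU transitive_Univ[OF t(1)])
  then obtain D where D: "isset M D" "E D = {v \<in> E t. \<exists>y\<in>U. ext_maps M g v y}" by blast
  \<comment> \<open>This makes \<open>D\<close> transitive: a solution defined at \<open>v\<close>
    is defined at all elements of \<open>v\<close>.\<close>
  have "\<exists>y. ext_maps M g u y" if v: "ext_maps M g v w" "u \<in> E v" for u v w
  proof -
    from v(1) obtain t' f' where a: "approx g t' f'" "v \<in> E t'" unfolding ext_maps_iff by blast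
    show ?thesis using approx_total[OF a(1) approx_elem[OF a v(2)]] ext_mapsI[OF a(1), of u] by blast
  qed
  then have Dt: "is_transitive M D"
    unfolding is_transitive_def D(2) using D(1) transitiveD[OF t(1)] ext_maps_Univ[of g] by blast
  then obtain f where f: "approx g D f" using approx_glue[OF g] D(2) by blast
  have xD: "E x \<subseteq> E D" using transitiveD[OF t(1) x] IH unfolding D(2) by blast
  show "\<exists>y\<in>U. ext_maps M g x y"
  proof (cases "x \<in> E D")
    case True
    then show ?thesis unfolding D(2) by blast
  next
    case False
    obtain w where w: "w \<in> U"
      "if x \<in> E A then related M g x w else represents M w {u. \<exists>v\<in>E x. related M f v u}"
      using fun_total[OF perm_fun[OF g], of x] related_Univ[of M g x] ex_image[OF g f xU xD]
      by (cases "x \<in> E A") (auto simp: represents_def isset_def)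
    obtain p where p: "is_pair M p x w" using ex_pair[OF xU w(1)] by blast
    have "f \<in> U" using approx_fun[OF f] by (simp add: is_fun_def isset_def)
    then obtain f' where f': "isset M f'" "E f' = insert p (E f)"
      using ex_insert is_pair_Univ(1)[OF p] by metis
    obtain D' where D': "isset M D'" "E D' = insert x (E D)"
      using ex_insert[OF xU isset_Univ[OF D(1)]] by blast
    have rel: "related M f' z y \<longleftrightarrow> related M f z y \<or> z = x \<and> y = w" for z y
      unfolding related_def f'(2) using p is_pair_inject by blast
    have "is_transitive M D'"
      unfolding is_transitive_def D'(2) using D'(1) xD transitiveD[OF Dt] by auto
    moreover have "is_fun M f' D'"
    proof -
      have "\<exists>!y. related M f' z y" if "z \<in> E D'" for z
        using that approx_total[OF f, of z] approx_domain[OF f, of z] approx_single[OF f, of z] False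
        unfolding D'(2) rel by auto
      moreover have "\<forall>p\<in>E f'. \<exists>x\<in>E D'. \<exists>y. is_pair M p x y"
        using approx_fun[OF f] p unfolding D'(2) f'(2) is_fun_def by auto
      ultimately show ?thesis using f'(1) unfolding is_fun_def by blast
    qed
    moreover have "if z \<in> E A then related M g z y
        else represents M y {u. \<exists>v\<in>E z. related M f' v u}" if zy: "related M f' z y" for z y
    proof -
      have "E z \<subseteq> E D"
        using zy xD approx_domain[OF f, of z y] transitiveD[OF Dt, of z] unfolding rel by auto
      then have "{u. \<exists>v\<in>E z. related M f' v u} = {u. \<exists>v\<in>E z. related M f v u}"
        using False unfolding rel by auto
      then show ?thesis using zy w(2) f unfolding rel approx_def by presburger
    qed
    ultimately have "approx g D' f'" unfolding approx_def by blast
    then have "ext_maps M g x w" using rel ext_mapsI by blast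
    then show ?thesis using w(1) by blast
  qed
qed

text \<open>The extension of a permutation is defined exactly at these objects. Every symmetric
  object is one of them (\<open>symmetric_tset\<close>), so transitive closures do not have to be
  constructed.\<close>

definition tset :: "'m \<Rightarrow> bool" where
  "tset x \<longleftrightarrow> (\<exists>t. is_transitive M t \<and> x \<in> E t)"

definition act :: "'m \<Rightarrow> 'm \<Rightarrow> 'm" where
  "act g x = (THE y. ext_maps M g x y)"

lemma tset_elem: "tset x \<Longrightarrow> y \<in> E x \<Longrightarrow> tset y"
  using transitiveD unfolding tset_def by blast

lemma tset_Univ: "tset x \<Longrightarrow> x \<in> U"
  using elems_Univ unfolding tset_def by metis

lemma ext_maps_tset: "ext_maps M g x y \<Longrightarrow> tset x"
  using approx_transitive unfolding ext_maps_iff tset_def by blast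

lemma ext_maps_act: "perm g \<Longrightarrow> tset x \<Longrightarrow> ext_maps M g x y \<longleftrightarrow> y = act g x"
  using ext_maps_total ext_maps_unique the_equality[of "ext_maps M g x"]
  unfolding act_def tset_def by metis

lemma act_Univ: "perm g \<Longrightarrow> tset x \<Longrightarrow> act g x \<in> U"
  using ext_maps_act ext_maps_Univ by blast

lemma act_atom: "perm g \<Longrightarrow> tset x \<Longrightarrow> x \<in> E A \<Longrightarrow> related M g x (act g x)"
  using ext_maps_act[of g x "act g x"] approx_atom unfolding ext_maps_iff by blast

lemma act_set:
  assumes "perm g" "tset x" "isset M x"
  shows "isset M (act g x)" "E (act g x) = act g ` E x"
proof -
  have "ext_maps M g x (act g x)" using ext_maps_act assms by blast
  then obtain t f where f: "approx g t f" "x \<in> E t" "related M f x (act g x)"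
    unfolding ext_maps_iff by blast
  have "x \<notin> E A" using assms(3) by (simp add: isset_def)
  note s = approx_set[OF f(1,3) this]
  then show "isset M (act g x)" by blast
  have "related M f v u \<longleftrightarrow> u = act g v" if "v \<in> E x" for u v
    using approx_ext_maps[OF assms(1) f(1)] transitiveD[OF approx_transitive[OF f(1)] f(2) that]
      ext_maps_act[OF assms(1) tset_elem[OF assms(2) that]] by blast
  then show "E (act g x) = act g ` E x" using s by auto
qed

lemma tset_cases: "tset x \<Longrightarrow> x \<in> E A \<or> isset M x"
  using tset_Univ by (auto simp: isset_def)

text \<open>A transitive set is carried to a transitive set: an atom goes to an atom, which has no
  elements, and the image of a set consists of images.\<close>

lemma tset_act:
  assumes g: "perm g" and x: "tset x"
  shows "tset (act g x)"
proof -
  obtain t where t: "is_transitive M t" "x \<in> E t" using x unfolding tset_def by blast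
  have gU: "g \<in> U" using perm_fun[OF g] by (simp add: is_fun_def isset_def)
  have "\<exists>r. isset M r \<and> E r = {u \<in> U. \<exists>z\<in>E t. ext_maps M g z u}"
  proof (rule replacement)
    show "dfn M (\<lambda>v. ext_maps M g (v 0) (v 1))" by (intro dfn_rules dfn_ext_maps gU)
  qed (use ext_maps_unique[OF g] transitive_Univ[OF t(1)] in auto)
  then obtain r where r: "isset M r" "E r = {u \<in> U. \<exists>z\<in>E t. ext_maps M g z u}" by blast
  have tt: "tset z" if "z \<in> E t" for z using that t(1) unfolding tset_def by blast
  have Er: "E r = act g ` E t"
    unfolding r(2) using ext_maps_act[OF g tt] act_Univ[OF g tt] by auto
  have "E (act g z) \<subseteq> E r" if z: "z \<in> E t" for z
  proof (cases "z \<in> E A")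
    case True
    then show ?thesis
      using perm_atoms[OF g act_atom[OF g tt[OF z] True]] atom_empty by auto
  next
    case False
    then show ?thesis
      using act_set(2)[OF g tt[OF z]] tset_cases[OF tt[OF z]] transitiveD[OF t(1) z] Er by auto
  qed
  then have "is_transitive M r" unfolding is_transitive_def using r(1) Er by auto
  then show ?thesis using Er t(2) unfolding tset_def by auto
qed

text \<open>Membership induction. The claim is phrased through \<open>ext_maps\<close>, whose
  definability is known, because \<open>act\<close> is a HOL description operator and not a
  predicate of the structure.\<close>

lemma act_comp:
  assumes k: "perm k" and g: "perm g" and h: "perm h" and c: "is_comp M k g h" and x: "tset x"
  shows "act k x = act g (act h x)"
proof -
  obtain t where t: "is_transitive M t" "x \<in> E t" using x unfolding tset_def by blast
  have tt: "tset z" if "z \<in> E t" for z using that t(1) unfolding tset_def by blast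
  have kU: "k \<in> U" "g \<in> U" "h \<in> U"
    using perm_fun[OF k] perm_fun[OF g] perm_fun[OF h] by (auto simp: is_fun_def isset_def)
  have "\<exists>y\<in>U. \<exists>z\<in>U. ext_maps M h x y \<and> ext_maps M g y z \<and> ext_maps M k x z"
    using _ t
  proof (rule transitive_induct)
    show "dfn M (\<lambda>v. \<exists>y\<in>U. \<exists>z\<in>U. ext_maps M h (v 0) y \<and> ext_maps M g y z \<and> ext_maps M k (v 0) z)"
      by (intro dfn_rules dfn_ext_maps kU)
  next
    fix x assume xt: "x \<in> E t"
      and IH: "\<And>v. v \<in> E x \<Longrightarrow>
        \<exists>y\<in>U. \<exists>z\<in>U. ext_maps M h v y \<and> ext_maps M g y z \<and> ext_maps M k v z"
    note xx = tt[OF xt]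
    have "act k x = act g (act h x)"
      using tset_cases[OF xx]
    proof
      assume "x \<in> E A"
      then have r: "related M h x (act h x)" "related M k x (act k x)"
        using act_atom xx k h by auto
      then have "act h x \<in> E A" using perm_atoms[OF h] by blast
      then have "related M g (act h x) (act g (act h x))"
        using act_atom[OF g tset_act[OF h xx]] by blast
      then have "related M k x (act g (act h x))" using c r(1) unfolding is_comp_def by blast
      then show ?thesis using r(2) fun_unique[OF perm_fun[OF k]] by blast
    next
      assume s: "isset M x"
      have "act k v = act g (act h v)" if "v \<in> E x" for v
        using IH[OF that] ext_maps_act k g h tset_elem[OF xx that] tset_act by metis
      then have "act k ` E x = act g ` act h ` E x" by (force simp: image_image)
      then show ?thesis
        using act_set[OF k xx s] act_set[OF h xx s] act_set[OF g tset_act[OF h xx]]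
        by (metis isset_extensional)
    qed
    then show "\<exists>y\<in>U. \<exists>z\<in>U. ext_maps M h x y \<and> ext_maps M g y z \<and> ext_maps M k x z"
      using ext_maps_act k g h xx tset_act act_Univ by metis
  qed
  then show ?thesis using ext_maps_act k g h x tset_act by metis
qed

lemma act_id:
  assumes e: "perm e" "is_id M e" and x: "tset x"
  shows "act e x = x"
proof -
  obtain t where t: "is_transitive M t" "x \<in> E t" using x unfolding tset_def by blast
  have eU: "e \<in> U" using perm_fun[OF e(1)] by (auto simp: is_fun_def isset_def)
  have "ext_maps M e x x"
    using _ t
  proof (rule transitive_induct)
    show "dfn M (\<lambda>v. ext_maps M e (v 0) (v 0))" by (intro dfn_rules dfn_ext_maps eU)
  next
    fix x assume xt: "x \<in> E t" and IH: "\<And>v. v \<in> E x \<Longrightarrow> ext_maps M e v v"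
    have xx: "tset x" using xt t(1) unfolding tset_def by blast
    have "act e x = x"
      using tset_cases[OF xx]
    proof
      assume "x \<in> E A"
      then show ?thesis
        using act_atom[OF e(1) xx] e(2) fun_unique[OF perm_fun[OF e(1)]] unfolding is_id_def by blast
    next
      assume s: "isset M x"
      have "act e v = v" if "v \<in> E x" for v
        using IH[OF that] ext_maps_act[OF e(1) tset_elem[OF xx that]] by simp
      then have "E (act e x) = E x" using act_set(2)[OF e(1) xx s] by simp
      then show ?thesis using act_set(1)[OF e(1) xx s] s isset_extensional by blast
    qed
    then show "ext_maps M e x x" using ext_maps_act[OF e(1) xx] by simp
  qed
  then show ?thesis using ext_maps_act[OF e(1) x] by simp
qed

end

section \<open>The action of a group of permutations\<close>

locale zfa_group = zfa M for M :: "'m zfa_structure" +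
  fixes G :: 'm
  assumes group: "perm_group M G"
begin

lemma G_Univ: "G \<in> U"
  using group by (simp add: perm_group_def isset_def)

lemma G_perm: "g \<in> E G \<Longrightarrow> perm g"
  using group by (simp add: perm_group_def perm_def)

lemma G_id: "\<exists>e\<in>E G. is_id M e"
  using group by (simp add: perm_group_def)

lemma G_comp: "g \<in> E G \<Longrightarrow> h \<in> E G \<Longrightarrow> \<exists>k\<in>E G. is_comp M k g h"
  using group by (simp add: perm_group_def)

lemma G_inverse: "g \<in> E G \<Longrightarrow> \<exists>k\<in>E G. is_inverse M k g"
  using group by (simp add: perm_group_def)

lemma inverse_comp:
  assumes "g \<in> E G" "k \<in> E G" "is_inverse M k g" "e \<in> E G" "is_id M e"
  shows "is_comp M e k g" "is_comp M e g k"
proof -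
  have k: "related M k a b \<longleftrightarrow> related M g b a" for a b
    using assms(3) by (simp add: is_inverse_def)
  have e: "is_fun M e A" "a \<in> E A \<Longrightarrow> related M e a a" for a
    using assms(5) by (auto simp: is_id_def)
  show "is_comp M e k g"
    unfolding is_comp_def k
    using e perm_atoms perm_inject G_perm[OF assms(1)] by metis
  show "is_comp M e g k"
    unfolding is_comp_def k
    using e perm_atoms fun_unique[OF perm_fun] G_perm[OF assms(1)] by metis
qed

lemma act_inverse:
  assumes "g \<in> E G" "k \<in> E G" "is_inverse M k g" "tset x"
  shows "act k (act g x) = x" "act g (act k x) = x"
proof -
  obtain e where e: "e \<in> E G" "is_id M e" using G_id by blast
  note c = inverse_comp[OF assms(1-3) e]
  show "act k (act g x) = x" "act g (act k x) = x"
    using act_comp[OF _ _ _ c(1) assms(4)] act_comp[OF _ _ _ c(2) assms(4)] act_id[OF _ e(2) assms(4)]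
      G_perm assms(1,2) e(1) by auto
qed

lemma act_inject:
  assumes "g \<in> E G" "tset x" "tset y" "act g x = act g y"
  shows "x = y"
  using G_inverse[OF assms(1)] act_inverse(1)[OF assms(1)] assms(2-4) by metis

lemma act_pair:
  assumes g: "g \<in> E G" and p: "tset p" "is_pair M p x y"
  shows "is_pair M (act g p) (act g x) (act g y)"
proof -
  obtain u v where uv: "represents M u {x}" "represents M v {x, y}" "represents M p {u, v}"
    using p(2) unfolding is_pair_def by blast
  have "tset u" "tset v" using tset_elem[OF p(1)] uv(3) unfolding represents_def by auto
  then have "represents M (act g u) {act g x}" "represents M (act g v) {act g x, act g y}"
    "represents M (act g p) {act g u, act g v}"
    using uv p(1) act_set[OF G_perm[OF g]] unfolding represents_def by auto
  then show ?thesis unfolding is_pair_def by blast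
qed

lemma act_elem_iff:
  assumes "g \<in> E G" "tset x" "tset y"
  shows "act g y \<in> E (act g x) \<longleftrightarrow> y \<in> E x"
  using tset_cases[OF assms(2)]
proof
  assume "x \<in> E A"
  then have "act g x \<in> E A"
    using act_atom[OF G_perm[OF assms(1)] assms(2)] perm_atoms[OF G_perm[OF assms(1)]] by blast
  then show ?thesis using \<open>x \<in> E A\<close> atom_empty by simp
next
  assume "isset M x"
  then show ?thesis
    using act_set(2)[OF G_perm[OF assms(1)] assms(2)] act_inject[OF assms(1) assms(3)]
      tset_elem[OF assms(2)] by auto
qed

lemma act_related:
  assumes g: "g \<in> E G" and r: "tset r" and xy: "related M r x y"
  shows "related M (act g r) (act g x) (act g y)"
proof -
  obtain p where p: "p \<in> E r" "is_pair M p x y" using xy unfolding related_def by blast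
  then have "tset p" using tset_elem[OF r] by blast
  then show ?thesis
    using act_pair[OF g _ p(2)] act_elem_iff[OF g r] p(1) unfolding related_def by blast
qed

end

section \<open>Groups of torsion permutations\<close>

context zfa
begin

lemma fun_extensional:
  assumes "is_fun M f X" "is_fun M g X" "\<And>x y. x \<in> E X \<Longrightarrow> related M f x y \<Longrightarrow> related M g x y"
  shows "f = g"
proof -
  have r: "related M f x y \<longleftrightarrow> related M g x y" for x y
    using fun_domain[OF assms(1), of x y] fun_domain[OF assms(2), of x y] assms(3)
      fun_total[OF assms(1), of x] fun_unique[OF assms(2), of x y] by blast
  have "\<exists>x y. is_pair M p x y" if "p \<in> E f \<or> p \<in> E g" for p
    using that assms(1,2) unfolding is_fun_def by blast
  then have "E f = E g"
    using r related_pair by (metis set_eqI)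
  then show ?thesis using assms(1,2) isset_extensional unfolding is_fun_def by blast
qed

text \<open>\<open>is_comp\<close> bounds the graph of \<open>k\<close> from below, and
  \<open>k\<close> is a function on the atoms, so nothing is left open. This identifies a composite
  found in a subgroup with one found in the whole group.\<close>

lemma comp_unique:
  assumes "is_fun M g A" "is_fun M h A" "\<And>a b. related M h a b \<Longrightarrow> b \<in> E A"
    "is_comp M k g h" "is_comp M k' g h"
  shows "k = k'"
proof (rule fun_extensional)
  show "is_fun M k A" "is_fun M k' A" using assms(4,5) by (auto simp: is_comp_def)
  fix x y assume "x \<in> E A" "related M k x y"
  moreover obtain b where b: "related M h x b" using fun_total[OF assms(2) \<open>x \<in> E A\<close>] by blast
  moreover obtain c where "related M g b c" using fun_total[OF assms(1) assms(3)[OF b]] by blast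
  ultimately have "related M k x c" "related M k' x c" using assms(4,5) unfolding is_comp_def by blast+
  then show "related M k' x y"
    using fun_unique[OF \<open>is_fun M k A\<close> \<open>related M k x y\<close>] by blast
qed

text \<open>Tarski's form of finiteness: a nonempty family of subsets of \<open>S\<close> has an
  inclusion-minimal member. It yields minimal supports and minimal orbits without any
  counting.\<close>

definition Tarski_finite :: "'m \<Rightarrow> bool" where
  "Tarski_finite S \<longleftrightarrow> (\<forall>C\<in>U. (\<exists>a. a \<in> E C) \<and> (\<forall>a\<in>E C. isset M a \<and> E a \<subseteq> E S) \<longrightarrow>
     (\<exists>a\<in>E C. \<forall>b\<in>E C. E b \<subseteq> E a \<longrightarrow> b = a))"

lemma Tarski_finite_minimal:
  assumes "Tarski_finite S" "C \<in> U" "c \<in> E C" "\<And>a. a \<in> E C \<Longrightarrow> isset M a \<and> E a \<subseteq> E S"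
  obtains a where "a \<in> E C" "\<And>b. b \<in> E C \<Longrightarrow> E b \<subseteq> E a \<Longrightarrow> b = a"
proof -
  have "\<exists>a\<in>E C. \<forall>b\<in>E C. E b \<subseteq> E a \<longrightarrow> b = a"
    using assms(1)[unfolded Tarski_finite_def, rule_format, OF assms(2)] assms(3,4) by auto
  then show ?thesis using that by auto
qed

lemma dfn_subset:
  assumes "tm M s" "tm M t" shows "dfn M (\<lambda>v. E (s v) \<subseteq> E (t v))"
  unfolding subset_eq
proof (rule dfn2[OF _ assms])
  show "dfn M (\<lambda>v. \<forall>x\<in>E (v 0). x \<in> E (v 1))" by (intro dfn_rules)
qed

lemma dfn_Tarski_finite: "tm M s \<Longrightarrow> dfn M (\<lambda>v. Tarski_finite (s v))"
proof (rule dfn1)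
  show "dfn M (\<lambda>v. Tarski_finite (v 0))"
    unfolding Tarski_finite_def
    by (intro dfn_rules dfn_subset dfn_ex_unbounded) (auto simp: elems_def)
qed

lemma dfn_is_bij: "tm M s \<Longrightarrow> tm M t \<Longrightarrow> tm M u \<Longrightarrow> dfn M (\<lambda>v. is_bij M (s v) (t v) (u v))"
proof (rule dfn3)
  have "is_bij M f X Y \<longleftrightarrow> is_fun M f X \<and> (\<forall>x\<in>U. \<forall>y\<in>U. related M f x y \<longrightarrow> y \<in> E Y) \<and>
     (\<forall>y\<in>E Y. \<exists>x\<in>U. related M f x y \<and> (\<forall>z\<in>U. related M f z y \<longrightarrow> z = x))" for f X Y
  proof -
    have "(\<exists>!x. related M f x y) \<longleftrightarrow> (\<exists>x\<in>U. related M f x y \<and> (\<forall>z\<in>U. related M f z y \<longrightarrow> z = x))" for y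
      using related_Univ[of M f] by metis
    moreover have "(\<forall>x y. related M f x y \<longrightarrow> y \<in> E Y) \<longleftrightarrow>
        (\<forall>x\<in>U. \<forall>y\<in>U. related M f x y \<longrightarrow> y \<in> E Y)"
      using related_Univ[of M f] by metis
    ultimately show ?thesis unfolding is_bij_def by presburger
  qed
  then show "dfn M (\<lambda>v. is_bij M (v 0) (v 1) (v 2))"
    by (simp only:) (intro dfn_rules dfn_is_fun)
qed

text \<open>If some member of the family avoids \<open>a\<close>, a minimal one among those is
  minimal in the whole family, since its subsets avoid \<open>a\<close> too. Otherwise
  \<open>a\<close> is removed from all members, and a minimal member of the reduced family gets
  \<open>a\<close> back.\<close>

lemma Tarski_finite_insert:
  assumes T: "Tarski_finite T" "T \<in> U" and S: "E S = insert a (E T)"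
  shows "Tarski_finite S"
  unfolding Tarski_finite_def
proof (intro ballI impI, elim conjE)
  fix C assume C: "C \<in> U" "\<exists>c. c \<in> E C" "\<forall>c\<in>E C. isset M c \<and> E c \<subseteq> E S"
  have "a \<in> U" using S elems_Univ[of a M S] by simp
  show "\<exists>c\<in>E C. \<forall>b\<in>E C. E b \<subseteq> E c \<longrightarrow> b = c"
  proof (cases "\<exists>c\<in>E C. a \<notin> E c")
    case True
    have "\<exists>D. isset M D \<and> E D = {c \<in> E C. a \<notin> E c}"
      by (intro separation dfn_rules C \<open>a \<in> U\<close>)
    then obtain D where D: "isset M D" "E D = {c \<in> E C. a \<notin> E c}" by blast
    obtain c0 where "c0 \<in> E D" using True unfolding D(2) by blast
    moreover have "isset M c \<and> E c \<subseteq> E T" if "c \<in> E D" for c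
      using that C(3) unfolding S D(2) by auto
    ultimately obtain c where c: "c \<in> E D" "\<And>b. b \<in> E D \<Longrightarrow> E b \<subseteq> E c \<Longrightarrow> b = c"
      using Tarski_finite_minimal[OF T(1) isset_Univ[OF D(1)]] by metis
    then show ?thesis unfolding D(2) by blast
  next
    case False
    obtain Q where Q: "isset M Q" "E Q = {y. isset M y \<and> E y \<subseteq> E T}" using ex_Pow[OF T(2)] by blast
    have "\<exists>D. isset M D \<and> E D = {b \<in> E Q. \<exists>c\<in>E C. \<forall>x\<in>U. x \<in> E c \<longleftrightarrow> x = a \<or> x \<in> E b}"
      by (intro separation dfn_rules C \<open>a \<in> U\<close> isset_Univ[OF Q(1)])
    then obtain D where D: "isset M D"
      "E D = {b \<in> E Q. \<exists>c\<in>E C. \<forall>x\<in>U. x \<in> E c \<longleftrightarrow> x = a \<or> x \<in> E b}" by blast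
    have D_iff: "b \<in> E D \<longleftrightarrow> isset M b \<and> E b \<subseteq> E T \<and> (\<exists>c\<in>E C. E c = insert a (E b))" for b
      unfolding D(2) Q(2) set_eq_iff insert_iff mem_Collect_eq
      using elems_Univ[of _ M] \<open>a \<in> U\<close> by metis
    have red: "\<exists>b\<in>E D. E b = E c - {a}" if c: "c \<in> E C" for c
    proof -
      have "\<exists>b. isset M b \<and> E b = {x \<in> E c. x \<noteq> a}"
        by (intro separation dfn_rules \<open>a \<in> U\<close> elems_Univ[OF c])
      then obtain b where b: "isset M b" "E b = E c - {a}" by auto
      then have "b \<in> E D" unfolding D_iff using False C(3) c unfolding S b(2) by (auto simp: b(1))
      then show ?thesis using b(2) by auto
    qed
    obtain b0 where "b0 \<in> E D" using C(2) red by blast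
    moreover have "isset M c \<and> E c \<subseteq> E T" if "c \<in> E D" for c
      using that unfolding D_iff by blast
    ultimately obtain b where b: "b \<in> E D" "\<And>b'. b' \<in> E D \<Longrightarrow> E b' \<subseteq> E b \<Longrightarrow> b' = b"
      using Tarski_finite_minimal[OF T(1) isset_Univ[OF D(1)]] by metis
    then obtain c where c: "c \<in> E C" "E c = insert a (E b)" unfolding D_iff by blast
    have "c' = c" if c': "c' \<in> E C" "E c' \<subseteq> E c" for c'
    proof -
      obtain b' where b': "b' \<in> E D" "E b' = E c' - {a}" using red[OF c'(1)] by blast
      then have "E b' \<subseteq> E b" using c'(2) unfolding c(2) b'(2) by auto
      then have "E b = E c' - {a}" using b(2)[OF b'(1)] b'(2) by blast
      then have "E c' = E c" using False c'(1) unfolding c(2) by auto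
      then show ?thesis using isset_extensional[of c' c] C(3) c(1) c'(1) by auto
    qed
    then show ?thesis using c(1) by blast
  qed
qed

text \<open>Induction on the length of an enumeration. The enumeration and the set are quantified
  inside the claim because the step passes to the restriction of \<open>f\<close> to
  \<open>i\<close> and to its image.\<close>

lemma finite_imp_Tarski_finite:
  assumes "is_finite M S" "S \<in> U"
  shows "Tarski_finite S"
proof -
  obtain n f where n: "is_nat M n" "is_bij M f n S" using assms(1) unfolding is_finite_def by blast
  have "\<forall>f\<in>U. \<forall>S\<in>U. is_bij M f n S \<longrightarrow> Tarski_finite S"
    using n(1)
  proof (induction rule: nat_induct)
    case dfn
    show ?case by (intro dfn_rules dfn_is_bij dfn_Tarski_finite)
  next
    case (empty z)
    show ?case
    proof (intro ballI impI)
      fix f S assume "is_bij M f z S"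
      moreover have "E z = {}" using empty by (simp add: is_empty_def represents_def)
      ultimately have "E S = {}" using fun_domain unfolding is_bij_def by blast
      then show "Tarski_finite S"
        unfolding Tarski_finite_def using isset_extensional by (metis subset_empty)
    qed
  next
    case (succ i j)
    show ?case
    proof (intro ballI impI)
      fix f S assume f: "f \<in> U" "S \<in> U" "is_bij M f j S"
      have j: "E j = insert i (E i)" using succ(2) by (rule is_succ_elems)
      have fj: "is_fun M f j" "\<And>x y. related M f x y \<Longrightarrow> y \<in> E S"
        "\<And>y. y \<in> E S \<Longrightarrow> \<exists>!x. related M f x y"
        using f(3) unfolding is_bij_def by blast+
      obtain a where a: "related M f i a" using fun_total[OF fj(1), of i] j by blast
      have "\<exists>T. isset M T \<and> E T = {y \<in> E S. \<exists>x\<in>E i. related M f x y}"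
        by (intro separation dfn_rules f succ(1))
      then obtain T where T: "isset M T" "E T = {y \<in> E S. \<exists>x\<in>E i. related M f x y}" by blast
      have S: "E S = insert a (E T)"
      proof -
        have "y = a \<or> y \<in> E T" if y: "y \<in> E S" for y
        proof -
          obtain x where x: "related M f x y" using fj(3)[OF y] by blast
          then have "x = i \<or> x \<in> E i" using fun_domain[OF fj(1) x] j by blast
          then show ?thesis using fun_unique[OF fj(1) a] x y unfolding T(2) by blast
        qed
        then show ?thesis using fj(2)[OF a] unfolding T(2) by blast
      qed
      have "\<exists>g. is_rel g i T \<and> (\<forall>x y. related M g x y \<longleftrightarrow> x \<in> E i \<and> y \<in> E T \<and> related M f x y)"
        by (intro ex_rel dfn_rules f succ(1) isset_Univ[OF T(1)])
      then obtain g where g: "is_rel g i T"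
        "\<And>x y. related M g x y \<longleftrightarrow> x \<in> E i \<and> y \<in> E T \<and> related M f x y" by blast
      have "\<exists>!y. related M g x y" if x: "x \<in> E i" for x
      proof -
        obtain y where y: "related M f x y" using fun_total[OF fj(1), of x] x unfolding j by blast
        then have "related M g x y" unfolding g(2) T(2) using x fj(2)[OF y] by auto
        then show ?thesis using fun_unique[OF fj(1) y] unfolding g(2) by auto
      qed
      then have "is_fun M g i"
        using g(1) unfolding is_fun_def is_rel_def by blast
      moreover have "\<exists>!x. related M g x y" if "y \<in> E T" for y
        using that fj(3)[of y] unfolding g(2) T(2) by blast
      ultimately have "is_bij M g i T"
        using g(2) unfolding is_bij_def by blast
      moreover have "g \<in> U" using g(1) isset_Univ unfolding is_rel_def by auto
      ultimately have "Tarski_finite T" using succ(3) isset_Univ[OF T(1)] by auto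
      then show "Tarski_finite S" using isset_Univ[OF T(1)] S by (rule Tarski_finite_insert)
    qed
  qed
  moreover have "f \<in> U" using n(2) isset_Univ unfolding is_bij_def is_fun_def by auto
  ultimately show ?thesis using n(2) assms(2) by auto
qed

end

context zfa_group
begin

text \<open>Inside the structure this says that some power of \<open>g\<close> with positive
  exponent is the identity, but it mentions neither powers nor numbers.\<close>

definition torsion :: "'m \<Rightarrow> bool" where
  "torsion g \<longleftrightarrow> (\<forall>S. isset M S \<and> E S \<subseteq> E G \<and> g \<in> E S \<and>
     (\<forall>k\<in>E S. \<forall>l\<in>E S. \<forall>m\<in>E G. is_comp M m k l \<longrightarrow> m \<in> E S) \<longrightarrow> (\<exists>e\<in>E S. is_id M e))"

lemma G_fun: "g \<in> E G \<Longrightarrow> is_fun M g A"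
  by (rule perm_fun[OF G_perm])

lemma G_comp_unique:
  "g \<in> E G \<Longrightarrow> h \<in> E G \<Longrightarrow> is_comp M k g h \<Longrightarrow> is_comp M k' g h \<Longrightarrow> k = k'"
  using perm_atoms[OF G_perm] by (intro comp_unique[of g h k k'] G_fun) blast+

text \<open>The given sequence of powers of \<open>g\<close> starts at the identity and ends at the
  identity; from exponent 1 onwards it stays inside any set that contains \<open>g\<close> and is
  closed under composition.\<close>

lemma bounded_exponent_torsion:
  assumes "bounded_exponent M G" "g \<in> E G"
  shows "torsion g"
  unfolding torsion_def
proof (intro allI impI, elim conjE)
  fix S assume S: "isset M S" "E S \<subseteq> E G" "g \<in> E S"
    "\<forall>k\<in>E S. \<forall>l\<in>E S. \<forall>m\<in>E G. is_comp M m k l \<longrightarrow> m \<in> E S"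
  obtain n e m s where n: "nat_ge_2 M n" "is_id M e" and m: "is_succ M m n" "is_fun M s m"
    and s0: "\<And>z p. is_empty M z \<Longrightarrow> related M s z p \<Longrightarrow> is_id M p"
    and s: "\<And>i j p q. i \<in> E n \<Longrightarrow> is_succ M j i \<Longrightarrow> related M s i p \<Longrightarrow> related M s j q \<Longrightarrow>
      is_comp M q g p"
    and e: "related M s n e"
    using assms unfolding bounded_exponent_def is_power_def by metis
  have nat: "is_nat M n" using n(1) by (simp add: nat_ge_2_def)
  have Em: "E m = insert n (E n)" using m(1) by (rule is_succ_elems)
  have U: "m \<in> U" "s \<in> U" "S \<in> U"
    using m S(1) by (auto simp: is_succ_def represents_def is_fun_def isset_def)
  \<comment> \<open>Exponent 0 is excluded, since whether the identity lies in \<open>S\<close> is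
    the question. The guard keeps the claim within the domain of the sequence.\<close>
  have "n \<in> E m \<longrightarrow> is_empty M n \<or> (\<forall>p\<in>U. related M s n p \<longrightarrow> p \<in> E S)"
    using nat
  proof (induction rule: nat_induct)
    case dfn
    show ?case by (intro dfn_rules dfn_is_empty U)
  next
    case (succ i j)
    have "q \<in> E S" if j: "j \<in> E m" and q: "related M s j q" for q
    proof -
      have "i \<in> E j" using is_succ_elems[OF succ(2)] by blast
      then have i: "i \<in> E n" using j nat_transitive[OF nat] unfolding Em by blast
      obtain p where p: "related M s i p" using fun_total[OF m(2), of i] i unfolding Em by blast
      have c: "is_comp M q g p" using s[OF i succ(2) p q] .
      show ?thesis
      proof (cases "is_empty M i")
        case True
        \<comment> \<open>Exponent 1: here \<open>q\<close> is \<open>g\<close> composed with the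
          identity.\<close>
        then have "is_id M p" using s0 p by blast
        then have "related M q a b" if "a \<in> E A" "related M g a b" for a b
          using that c unfolding is_comp_def is_id_def by blast
        then have "g = q"
          using c by (intro fun_extensional[OF G_fun[OF assms(2)]]) (auto simp: is_comp_def)
        then show ?thesis using S(3) by simp
      next
        case False
        then have pS: "p \<in> E S" using succ(3) i p related_Univ(2)[OF p] unfolding Em by blast
        then obtain l where l: "l \<in> E G" "is_comp M l g p" using G_comp[OF assms(2)] S(2) by blast
        then have "l \<in> E S" using S(3,4) pS by blast
        moreover have "l = q" using G_comp_unique[OF assms(2) _ l(2) c] pS S(2) by blast
        ultimately show ?thesis by simp
      qed
    qed
    then show ?case by blast
  qed simp
  moreover have "\<not> is_empty M n"
    using n(1) by (auto simp: nat_ge_2_def is_empty_def represents_def)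
  ultimately have "e \<in> E S" using e related_Univ(2)[OF e] unfolding Em by blast
  then show "\<exists>e\<in>E S. is_id M e" using n(2) by blast
qed

text \<open>
  In a subsemigroup take \<open>k\<close> with minimal support \<open>B\<close>. If \<open>B\<close> is nonempty, choose \<open>c \<in> B\<close>
  for which the orbit of \<open>c\<close> under the elements supported by \<open>B\<close> is minimal. The orbit of \<open>k c\<close>
  is then the same, so it contains \<open>k c\<close>, and an element fixing \<open>k c\<close> has smaller support.
\<close>

lemma finite_support_torsion:
  assumes "moves_finitely_many M g" "g \<in> E G"
  shows "torsion g"
  unfolding torsion_def
proof (intro allI impI, elim conjE)
  fix W assume W: "isset M W" "E W \<subseteq> E G" "g \<in> E W"
    "\<forall>k\<in>E W. \<forall>l\<in>E W. \<forall>m\<in>E G. is_comp M m k l \<longrightarrow> m \<in> E W"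
  have WU: "W \<in> U" using W(1) by (rule isset_Univ)
  obtain S where S: "isset M S" "E S = {a \<in> E A. \<not> related M g a a}" "is_finite M S"
    using assms(1) unfolding moves_finitely_many_def represents_def by blast
  have SU: "S \<in> U" using S(1) by (rule isset_Univ)
  have fin: "Tarski_finite S" using S(3) SU by (rule finite_imp_Tarski_finite)
  obtain Q where Q: "isset M Q" "E Q = {y. isset M y \<and> E y \<subseteq> E S}" using ex_Pow[OF SU] by blast
  have QU: "Q \<in> U" using Q(1) by (rule isset_Univ)
  have "\<exists>C. isset M C \<and> E C = {B \<in> E Q. \<exists>k\<in>E W. \<forall>a\<in>E A. a \<in> E B \<longleftrightarrow> \<not> related M k a a}"
    by (intro separation dfn_rules WU A_Univ QU)
  then obtain C where C: "isset M C"
    "E C = {B \<in> E Q. \<exists>k\<in>E W. \<forall>a\<in>E A. a \<in> E B \<longleftrightarrow> \<not> related M k a a}" by blast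
  have "S \<in> E C" unfolding C(2) Q(2) using S(1,2) W(3) by auto
  moreover have "isset M B \<and> E B \<subseteq> E S" if "B \<in> E C" for B using that unfolding C(2) Q(2) by auto
  ultimately obtain B where B: "B \<in> E C" "\<And>B'. B' \<in> E C \<Longrightarrow> E B' \<subseteq> E B \<Longrightarrow> B' = B"
    using Tarski_finite_minimal[OF fin isset_Univ[OF C(1)]] by metis
  then have BS: "isset M B" "E B \<subseteq> E S" unfolding C(2) Q(2) by blast+
  have BU: "B \<in> U" using BS(1) by (rule isset_Univ)
  obtain k where k: "k \<in> E W" "\<And>a. a \<in> E A \<Longrightarrow> a \<in> E B \<longleftrightarrow> \<not> related M k a a"
    using B(1) unfolding C(2) by blast
  have "E B = {}"
  proof (rule ccontr)
    assume "E B \<noteq> {}"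
    then obtain c0 where c0: "c0 \<in> E B" by blast
    define W' where "W' = {l \<in> E W. \<forall>a\<in>E A. a \<notin> E B \<longrightarrow> related M l a a}"
    have kW': "k \<in> W'" using k unfolding W'_def by blast
    \<comment> \<open>A permutation supported by \<open>B\<close> maps \<open>B\<close> into itself:
      a value outside \<open>B\<close> would be a fixed point and so would have two
      preimages.\<close>
    have stays: "b \<in> E B" if "l \<in> W'" "c \<in> E B" "related M l c b" for l b c
    proof (rule ccontr)
      assume b: "b \<notin> E B"
      have l: "perm l" using that(1) W(2) G_perm unfolding W'_def by blast
      then have "b \<in> E A" using perm_atoms that(3) by blast
      then have "related M l b b" using that(1) b unfolding W'_def by blast
      then show False using perm_inject[OF l that(3)] that(2) b by blast
    qed
    define orb where "orb c = {b. \<exists>l\<in>W'. related M l c b}" for c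
    have "\<exists>D. isset M D \<and> E D = {R \<in> E Q. \<exists>c\<in>E B. \<forall>b\<in>U. b \<in> E R \<longleftrightarrow>
        (\<exists>l\<in>E W. (\<forall>a\<in>E A. a \<notin> E B \<longrightarrow> related M l a a) \<and> related M l c b)}"
      by (intro separation dfn_rules WU A_Univ QU BU)
    then obtain D where D: "isset M D" "E D = {R \<in> E Q. \<exists>c\<in>E B. \<forall>b\<in>U. b \<in> E R \<longleftrightarrow>
        (\<exists>l\<in>E W. (\<forall>a\<in>E A. a \<notin> E B \<longrightarrow> related M l a a) \<and> related M l c b)}" by blast
    have "(\<forall>b\<in>U. b \<in> E R \<longleftrightarrow>
        (\<exists>l\<in>E W. (\<forall>a\<in>E A. a \<notin> E B \<longrightarrow> related M l a a) \<and> related M l c b)) \<longleftrightarrow> E R = orb c" for R c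
      unfolding orb_def W'_def set_eq_iff mem_Collect_eq
      using elems_Univ[of _ M R] related_Univ(2)[of M] by (smt (verit, best) mem_Collect_eq)
    then have D_iff: "R \<in> E D \<longleftrightarrow> isset M R \<and> E R \<subseteq> E S \<and> (\<exists>c\<in>E B. E R = orb c)" for R
      unfolding D(2) Q(2) by simp
    have orbit: "\<exists>R\<in>E D. E R = orb c" if c: "c \<in> E B" for c
    proof -
      have "\<exists>R. isset M R \<and> E R = {b \<in> E S. \<exists>l\<in>E W. (\<forall>a\<in>E A. a \<notin> E B \<longrightarrow> related M l a a) \<and>
          related M l c b}"
        by (intro separation dfn_rules WU A_Univ SU BU elems_Univ[OF c])
      then obtain R where R: "isset M R" "E R = {b \<in> E S. \<exists>l\<in>E W.
          (\<forall>a\<in>E A. a \<notin> E B \<longrightarrow> related M l a a) \<and> related M l c b}" by blast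
      have "E R = orb c"
        unfolding R(2) orb_def using stays[OF _ c] BS(2) unfolding W'_def by auto
      then show ?thesis using R D_iff c by blast
    qed
    obtain R0 where "R0 \<in> E D" using orbit[OF c0] by blast
    moreover have "isset M R \<and> E R \<subseteq> E S" if "R \<in> E D" for R using that unfolding D_iff by blast
    ultimately obtain R where R: "R \<in> E D" "\<And>R'. R' \<in> E D \<Longrightarrow> E R' \<subseteq> E R \<Longrightarrow> R' = R"
      using Tarski_finite_minimal[OF fin isset_Univ[OF D(1)]] by metis
    then obtain c where c: "c \<in> E B" "E R = orb c" unfolding D_iff by blast
    have kG: "k \<in> E G" using k(1) W(2) by blast
    have "c \<in> E A" using c(1) BS(2) S(2) by blast
    then obtain b where b: "related M k c b" using fun_total[OF G_fun[OF kG]] by blast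
    then have bB: "b \<in> E B" using stays[OF kW' c(1)] by blast
    obtain R' where R': "R' \<in> E D" "E R' = orb b" using orbit[OF bB] by blast
    have "orb b \<subseteq> orb c"
    proof
      fix d assume "d \<in> orb b"
      then obtain l where l: "l \<in> W'" "related M l b d" unfolding orb_def by blast
      then have lW: "l \<in> E W" "l \<in> E G" using W(2) unfolding W'_def by auto
      obtain m where m: "m \<in> E G" "is_comp M m l k" using G_comp[OF lW(2) kG] by blast
      then have "m \<in> E W" using W(4) lW(1) k(1) by blast
      moreover have "related M m a a" if "a \<in> E A" "a \<notin> E B" for a
        using that k(2) l(1) m(2) unfolding W'_def is_comp_def by blast
      moreover have "related M m c d" using m(2) b l(2) unfolding is_comp_def by blast
      ultimately show "d \<in> orb c" unfolding orb_def W'_def by blast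
    qed
    then have "orb b = orb c" using R(2)[OF R'(1)] R'(2) c(2) by simp
    moreover have "b \<in> orb c" using kW' b unfolding orb_def by blast
    ultimately obtain l where l: "l \<in> W'" "related M l b b" unfolding orb_def by blast
    have "\<exists>B'. isset M B' \<and> E B' = {a \<in> E S. \<not> related M l a a}"
      by (intro separation dfn_rules SU) (use l(1) elems_Univ in \<open>auto simp: W'_def\<close>)
    then obtain B' where B': "isset M B'" "E B' = {a \<in> E S. \<not> related M l a a}" by blast
    have "E B' \<subseteq> E B" using l(1) S(2) unfolding B'(2) W'_def by blast
    moreover have "B' \<in> E C"
    proof -
      have "a \<in> E B' \<longleftrightarrow> \<not> related M l a a" if "a \<in> E A" for a
        using that l(1) BS(2) unfolding B'(2) W'_def by blast
      then show ?thesis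
        using l(1) B' unfolding C(2) Q(2) W'_def by blast
    qed
    ultimately have "B' = B" using B(2) by blast
    then show False using bB l(2) B'(2) by blast
  qed
  then have "is_id M k"
    using k W(2) G_fun unfolding is_id_def by blast
  then show "\<exists>e\<in>E W. is_id M e" using k(1) by blast
qed

text \<open>In place of the powers of \<open>g\<close>, consider the \<open>k\<close> in
  \<open>K\<close> with g x \<le> k x. They include \<open>g\<close>, and they are closed under
  composition because x \<le> g x \<le> l x gives g x \<le> k x \<le> k (l x). Torsion puts the
  identity among them, so g x \<le> x.\<close>

lemma torsion_antichain:
  assumes "torsion g" and K: "K \<in> U" "E K \<subseteq> E G" "g \<in> E K"
    "\<And>k l m. k \<in> E K \<Longrightarrow> l \<in> E K \<Longrightarrow> m \<in> E G \<Longrightarrow> is_comp M m k l \<Longrightarrow> m \<in> E K"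
    and R: "R \<in> U" "\<And>y z. related M R y z \<Longrightarrow> related M R z z"
    "\<And>x y z. related M R x y \<Longrightarrow> related M R y z \<Longrightarrow> related M R x z"
    "\<And>y z. related M R y z \<Longrightarrow> related M R z y \<Longrightarrow> y = z"
    and inv: "\<And>k y z. k \<in> E K \<Longrightarrow> related M R y z \<Longrightarrow> related M R (act k y) (act k z)"
    and x: "tset x" "related M R x (act g x)"
  shows "act g x = x"
proof -
  let ?b = "act g x"
  have bU: "?b \<in> U" using x(2) related_Univ by metis
  have "\<exists>S. isset M S \<and> E S = {k \<in> E K. \<exists>z\<in>U. ext_maps M k x z \<and> related M R ?b z}"
    by (intro separation dfn_rules dfn_ext_maps K R bU tset_Univ x)
  then obtain S where S: "isset M S"
    "E S = {k \<in> E K. \<exists>z\<in>U. ext_maps M k x z \<and> related M R ?b z}" by blast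
  have S_iff: "k \<in> E S \<longleftrightarrow> k \<in> E K \<and> related M R ?b (act k x)" for k
    using ext_maps_act[OF G_perm x(1), of k] K(2) act_Univ[OF G_perm x(1), of k] unfolding S(2) by auto
  have "m \<in> E S" if "k \<in> E S" "l \<in> E S" "m \<in> E G" "is_comp M m k l" for k l m
  proof -
    have kl: "k \<in> E K" "l \<in> E K" "related M R ?b (act k x)" "related M R ?b (act l x)"
      using that unfolding S_iff by auto
    then have "related M R x (act l x)" using R(3) x(2) by blast
    then have "related M R (act k x) (act k (act l x))" by (rule inv[OF kl(1)])
    then have "related M R ?b (act k (act l x))" using R(3) kl(3) by blast
    moreover have "act m x = act k (act l x)"
      using kl(1,2) K(2) that by (intro act_comp G_perm x) auto
    ultimately show ?thesis using K(4) kl that unfolding S_iff by metis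
  qed
  moreover have "g \<in> E S" unfolding S_iff using K(3) R(2) x(2) by blast
  moreover have "E S \<subseteq> E G" using K(2) unfolding S_iff by (auto simp: S_iff)
  ultimately obtain e where e: "e \<in> E S" "is_id M e"
    using assms(1) S(1) unfolding torsion_def by blast
  then have "related M R ?b x"
    using act_id[OF G_perm _ x(1), of e] K(2) unfolding S_iff by auto
  then show ?thesis using R(4) x(2) by blast
qed

end

section \<open>The well-ordering theorem inside a model\<close>

text \<open>
  Zermelo's argument: the least family of subsets of \<open>X\<close> that is closed under unions and under
  adding the chosen element of the complement is a chain, and its initial segments well-order \<open>X\<close>.
\<close>

locale choice_tower = zfa M for M :: "'m zfa_structure" +
  fixes X :: 'm and pick :: "'m \<Rightarrow> 'm \<Rightarrow> bool"
  assumes X: "isset M X"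
    and dfn_pick0: "dfn M (\<lambda>v. pick (v 0) (v 1))"
    and pick_ex: "\<And>a. isset M a \<Longrightarrow> E a \<subseteq> E X \<Longrightarrow> E a \<noteq> E X \<Longrightarrow> \<exists>c. pick a c"
    and pick_unique: "\<And>a c d. pick a c \<Longrightarrow> pick a d \<Longrightarrow> c = d"
    and pick_in: "\<And>a c. pick a c \<Longrightarrow> c \<in> E X \<and> c \<notin> E a"
begin

lemma dfn_pick: "tm M s \<Longrightarrow> tm M t \<Longrightarrow> dfn M (\<lambda>v. pick (s v) (t v))"
  by (rule dfn2[of M pick, OF dfn_pick0])

definition is_Union :: "'m \<Rightarrow> 'm \<Rightarrow> bool" where
  "is_Union b D \<longleftrightarrow> isset M b \<and> (\<forall>x\<in>U. x \<in> E b \<longleftrightarrow> (\<exists>a\<in>E D. x \<in> E a))"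

definition is_insert :: "'m \<Rightarrow> 'm \<Rightarrow> 'm \<Rightarrow> bool" where
  "is_insert b c a \<longleftrightarrow> isset M b \<and> (\<forall>x\<in>U. x \<in> E b \<longleftrightarrow> x = c \<or> x \<in> E a)"

lemma is_UnionD: "is_Union b D \<Longrightarrow> E b = (\<Union>a\<in>E D. E a)"
  unfolding is_Union_def using elems_Univ[of _ M] by auto

lemma is_insertD: "is_insert b c a \<Longrightarrow> c \<in> U \<Longrightarrow> E b = insert c (E a)"
  unfolding is_insert_def using elems_Univ[of _ M] by auto

lemma is_insertI: "c \<in> U \<Longrightarrow> a \<in> U \<Longrightarrow> \<exists>b. is_insert b c a"
  unfolding is_insert_def using ex_insert[of c a] by auto

lemma is_UnionI: "D \<in> U \<Longrightarrow> \<exists>b. is_Union b D"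
  unfolding is_Union_def using ex_Union[of D] by (metis UN_iff)

lemma pick_Univ: "pick a c \<Longrightarrow> c \<in> U"
  using pick_in elems_Univ by metis

text \<open>\<open>D\<close> may be empty, and then its union puts the empty set into every closed
  family; this takes the place of a base case.\<close>

definition closed :: "'m \<Rightarrow> bool" where
  "closed C \<longleftrightarrow> (\<forall>D\<in>U. \<forall>b\<in>U. E D \<subseteq> E C \<and> is_Union b D \<longrightarrow> b \<in> E C) \<and>
     (\<forall>a\<in>E C. \<forall>c\<in>U. \<forall>b\<in>U. pick a c \<and> is_insert b c a \<longrightarrow> b \<in> E C)"

lemma dfn_closed: "tm M s \<Longrightarrow> dfn M (\<lambda>v. closed (s v))"
proof (rule dfn1)
  show "dfn M (\<lambda>v. closed (v 0))"
    unfolding closed_def is_Union_def is_insert_def by (intro dfn_rules dfn_subset dfn_pick)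
qed

definition in_tower :: "'m \<Rightarrow> bool" where
  "in_tower a \<longleftrightarrow> isset M a \<and> E a \<subseteq> E X \<and> (\<forall>C\<in>U. closed C \<longrightarrow> a \<in> E C)"

lemma ex_tower: "\<exists>T. isset M T \<and> E T = {a. in_tower a}"
proof -
  obtain Q where Q: "isset M Q" "E Q = {y. isset M y \<and> E y \<subseteq> E X}"
    using ex_Pow[OF isset_Univ[OF X]] by blast
  have "\<exists>T. isset M T \<and> E T = {a \<in> E Q. \<forall>C\<in>U. closed C \<longrightarrow> a \<in> E C}"
    by (intro separation dfn_rules dfn_closed isset_Univ[OF Q(1)])
  then show ?thesis unfolding Q(2) in_tower_def by (simp add: conj_assoc)
qed

definition tower :: 'm where
  "tower = (SOME T. isset M T \<and> E T = {a. in_tower a})"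

lemma tower: "isset M tower" "E tower = {a. in_tower a}"
  using someI_ex[OF ex_tower] unfolding tower_def by auto

lemma tower_Univ: "tower \<in> U"
  using tower(1) by (rule isset_Univ)

lemma tower_set: "a \<in> E tower \<Longrightarrow> isset M a" "a \<in> E tower \<Longrightarrow> E a \<subseteq> E X"
  unfolding tower(2) in_tower_def by auto

lemma tower_Union:
  assumes "D \<in> U" "E D \<subseteq> E tower" "is_Union b D"
  shows "b \<in> E tower"
proof -
  have b: "isset M b" using assms(3) by (simp add: is_Union_def)
  have "E b \<subseteq> E X" using is_UnionD[OF assms(3)] tower_set(2) assms(2) by auto
  moreover have "b \<in> E C" if C: "C \<in> U" "closed C" for C
  proof -
    have "E D \<subseteq> E C" using assms(2) C unfolding tower(2) in_tower_def by auto
    then show ?thesis using C(2) assms(1,3) isset_Univ[OF b] unfolding closed_def by auto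
  qed
  ultimately show ?thesis using b unfolding tower(2) in_tower_def by auto
qed

lemma tower_insert:
  assumes "a \<in> E tower" "pick a c" "is_insert b c a"
  shows "b \<in> E tower"
proof -
  have b: "isset M b" using assms(3) by (simp add: is_insert_def)
  have "E b \<subseteq> E X"
    using is_insertD[OF assms(3) pick_Univ[OF assms(2)]] tower_set(2)[OF assms(1)] pick_in[OF assms(2)]
    by auto
  moreover have "b \<in> E C" if C: "C \<in> U" "closed C" for C
  proof -
    have "a \<in> E C" using assms(1) C unfolding tower(2) in_tower_def by auto
    then show ?thesis
      using C(2) assms(2,3) isset_Univ[OF b] pick_Univ[OF assms(2)] unfolding closed_def by auto
  qed
  ultimately show ?thesis using b unfolding tower(2) in_tower_def by auto
qed

lemma tower_induct [consumes 1, case_names dfn Union insert]: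
  assumes "a \<in> E tower" "dfn M (\<lambda>v. P (v 0))"
    and Union: "\<And>D b. E D \<subseteq> E tower \<Longrightarrow> (\<And>a. a \<in> E D \<Longrightarrow> P a) \<Longrightarrow>
      E b = (\<Union>a\<in>E D. E a) \<Longrightarrow> P b"
    and insert: "\<And>a c b. a \<in> E tower \<Longrightarrow> b \<in> E tower \<Longrightarrow> P a \<Longrightarrow> pick a c \<Longrightarrow>
      E b = insert c (E a) \<Longrightarrow> P b"
  shows "P a"
proof -
  have "\<exists>C. isset M C \<and> E C = {a \<in> E tower. P a}"
    using assms(2) by (intro separation tower_Univ)
  then obtain C where C: "isset M C" "E C = {a \<in> E tower. P a}" by blast
  have "closed C"
    unfolding closed_def
  proof (intro conjI ballI impI; elim conjE)
    fix D b assume D: "D \<in> U" "E D \<subseteq> E C" "is_Union b D"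
    then have "E D \<subseteq> E tower" "\<And>a. a \<in> E D \<Longrightarrow> P a" unfolding C(2) by auto
    then show "b \<in> E C"
      using Union[OF _ _ is_UnionD[OF D(3)]] tower_Union[OF D(1) _ D(3)] unfolding C(2) by auto
  next
    fix a c b assume a: "a \<in> E C" and c: "c \<in> U" "pick a c" "is_insert b c a"
    then have "a \<in> E tower" "P a" unfolding C(2) by auto
    then show "b \<in> E C"
      using insert[OF _ _ _ c(2) is_insertD[OF c(3,1)]] tower_insert[OF _ c(2,3)] unfolding C(2) by auto
  qed
  then have "a \<in> E C"
    using assms(1) isset_Univ[OF C(1)] unfolding tower(2) in_tower_def by auto
  then show ?thesis unfolding C(2) by auto
qed

definition comparable :: "'m \<Rightarrow> bool" where
  "comparable b \<longleftrightarrow> (\<forall>a\<in>E tower. E a \<subseteq> E b \<or> E b \<subseteq> E a)"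

text \<open>Induction on \<open>a\<close>. Let \<open>e\<close> be the successor of
  \<open>a\<close>, with \<open>a\<close> contained in \<open>b\<close>. Comparability of
  \<open>b\<close> leaves the case that \<open>b\<close> is contained in \<open>e\<close>; as
  \<open>e\<close> adds one point to \<open>a\<close>, the set \<open>b\<close> equals
  \<open>e\<close> or \<open>a\<close>. If it equals \<open>a\<close>, uniqueness of
  \<open>pick\<close> makes the added point \<open>c\<close>.\<close>

lemma comparable_insert:
  assumes a: "a \<in> E tower" and b: "b \<in> E tower" "comparable b" and c: "pick b c"
  shows "E a \<subseteq> E b \<or> insert c (E b) \<subseteq> E a"
proof -
  have cU: "c \<in> U" "b \<in> U" using pick_Univ[OF c] elems_Univ[OF b(1)] by auto
  have "E a \<subseteq> E b \<or> (c \<in> E a \<and> E b \<subseteq> E a)"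
    using a
  proof (induction rule: tower_induct)
    case dfn
    show ?case by (intro dfn_rules dfn_subset cU)
  next
    case (Union D d)
    show ?case
    proof (cases "\<exists>a\<in>E D. c \<in> E a \<and> E b \<subseteq> E a")
      case True
      then show ?thesis unfolding Union(2) by fast
    next
      case False
      then show ?thesis unfolding Union(2) using Union(3) by fast
    qed
  next
    case (insert a d e)
    have "E e \<subseteq> E b \<or> E b \<subseteq> E e"
      using b(2) insert(2) unfolding comparable_def by blast
    moreover have "d = c" if "E a = E b"
    proof -
      have "a = b" using isset_extensional[OF tower_set(1)[OF insert(1)] tower_set(1)[OF b(1)] that] .
      then show ?thesis using pick_unique insert(3) c by simp
    qed
    ultimately show ?case using insert(5) unfolding insert(4) by blast
  qed
  then show ?thesis by blast
qed

lemma tower_comparable: "b \<in> E tower \<Longrightarrow> comparable b"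
proof (induction rule: tower_induct)
  case dfn
  show ?case unfolding comparable_def by (intro dfn_rules dfn_subset tower_Univ)
next
  case (Union D b)
  then have "E a \<subseteq> E d \<or> E d \<subseteq> E a" if "a \<in> E tower" "d \<in> E D" for a d
    using that unfolding comparable_def by blast
  then show ?case unfolding comparable_def Union(2) by (meson UN_least UN_upper subset_trans)
next
  case (insert a c b)
  then show ?case using comparable_insert[OF _ insert(1,5,3)] unfolding comparable_def insert(4) by blast
qed

lemma tower_gap:
  "a \<in> E tower \<Longrightarrow> b \<in> E tower \<Longrightarrow> pick b c \<Longrightarrow> E a \<subseteq> E b \<or> insert c (E b) \<subseteq> E a"
  using comparable_insert tower_comparable by blast

text \<open>
  The union of the members of the tower that miss a nonempty set \<open>T\<close> is the largest such member,
  so the element added to it next lies in \<open>T\<close>.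
\<close>

lemma tower_first:
  assumes T: "T \<in> U" "E T \<subseteq> E X" "E T \<noteq> {}"
  obtains b c where "b \<in> E tower" "pick b c" "c \<in> E T" "E b \<inter> E T = {}"
    "E b = (\<Union>a\<in>{a \<in> E tower. E a \<inter> E T = {}}. E a)"
proof -
  have "\<exists>D. isset M D \<and> E D = {a \<in> E tower. \<forall>x\<in>E T. x \<notin> E a}"
    by (intro separation dfn_rules tower_Univ T)
  moreover have "{a \<in> E tower. \<forall>x\<in>E T. x \<notin> E a} = {a \<in> E tower. E a \<inter> E T = {}}" by blast
  ultimately obtain D where D: "isset M D" "E D = {a \<in> E tower. E a \<inter> E T = {}}" by metis
  obtain b where b: "is_Union b D" using is_UnionI[OF isset_Univ[OF D(1)]] by blast
  have Eb: "E b = (\<Union>a\<in>{a \<in> E tower. E a \<inter> E T = {}}. E a)" using is_UnionD[OF b] D(2) by simp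
  have bT: "b \<in> E tower" using tower_Union[OF isset_Univ[OF D(1)] _ b] D(2) by auto
  have disj: "E b \<inter> E T = {}" unfolding Eb by blast
  then have "E b \<noteq> E X" using T(2,3) by auto
  then obtain c where c: "pick b c" using pick_ex tower_set[OF bT] by blast
  obtain d where d: "is_insert d c b" using is_insertI[OF pick_Univ[OF c] elems_Univ[OF bT]] by blast
  have Ed: "E d = insert c (E b)" using is_insertD[OF d pick_Univ[OF c]] .
  have dT: "d \<in> E tower" using tower_insert[OF bT c d] .
  have "c \<in> E T"
  proof (rule ccontr)
    assume "c \<notin> E T"
    then have "E d \<inter> E T = {}" using disj unfolding Ed by blast
    then have "E d \<subseteq> E b" using dT unfolding Eb by blast
    then show False using pick_in[OF c] unfolding Ed by blast
  qed
  then show ?thesis using that bT c disj Eb by blast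
qed

definition before :: "'m \<Rightarrow> 'm \<Rightarrow> bool" where
  "before x y \<longleftrightarrow> (\<forall>a\<in>E tower. y \<in> E a \<longrightarrow> x \<in> E a)"

text \<open>The least point is the one added to the largest member of the tower missing
  \<open>T\<close>: a member that meets \<open>T\<close> is not contained in that one, so by
  \<open>tower_gap\<close> it contains the added point.\<close>

lemma before_least:
  assumes T: "T \<in> U" "E T \<subseteq> E X" "E T \<noteq> {}"
  shows "\<exists>m\<in>E T. \<forall>t\<in>E T. before m t"
proof -
  obtain b c where b: "b \<in> E tower" "pick b c" "c \<in> E T" "E b \<inter> E T = {}"
    using tower_first[OF T] by metis
  have "before c t" if t: "t \<in> E T" for t
    unfolding before_def
  proof (intro ballI impI)
    fix a assume a: "a \<in> E tower" "t \<in> E a"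
    show "c \<in> E a" using tower_gap[OF a(1) b(1,2)] b(4) t a(2) by blast
  qed
  then show ?thesis using b(3) by blast
qed

text \<open>Points lying in the same members of the tower have the same largest member missing them.
  The point picked after that member is both \<open>x\<close> and \<open>y\<close>.\<close>

lemma before_antisym:
  assumes "x \<in> E X" "y \<in> E X" "before x y" "before y x"
  shows "x = y"
proof -
  have same: "x \<in> E a \<longleftrightarrow> y \<in> E a" if "a \<in> E tower" for a
    using assms(3,4) that unfolding before_def by blast
  obtain S T where S: "isset M S" "E S = {x}" and T: "isset M T" "E T = {y}"
    using ex_upair[of x x] ex_upair[of y y] elems_Univ[OF assms(1)] elems_Univ[OF assms(2)] by auto
  obtain a c where a: "a \<in> E tower" "pick a c" "c \<in> E S"
    "E a = (\<Union>a\<in>{a \<in> E tower. E a \<inter> E S = {}}. E a)"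
    by (rule tower_first[of S]) (use S assms isset_Univ in auto)
  obtain b d where b: "b \<in> E tower" "pick b d" "d \<in> E T"
    "E b = (\<Union>a\<in>{a \<in> E tower. E a \<inter> E T = {}}. E a)"
    by (rule tower_first[of T]) (use T assms isset_Univ in auto)
  have "{a \<in> E tower. E a \<inter> E S = {}} = {a \<in> E tower. E a \<inter> E T = {}}"
    unfolding S(2) T(2) using same by auto
  then have "E a = E b" using a(4) b(4) by simp
  then have "a = b" using isset_extensional tower_set(1) a(1) b(1) by blast
  then show ?thesis using pick_unique a(2,3) b(2,3) unfolding S(2) T(2) by blast
qed

lemma well_ordering_relation:
  "\<exists>S. is_rel S X X \<and> (\<forall>x y. related M S x y \<longleftrightarrow> x \<in> E X \<and> y \<in> E X \<and> before x y)"
  unfolding before_def by (intro ex_rel dfn_rules tower_Univ isset_Univ[OF X])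

end

context zfa
begin

text \<open>Least elements, rather than the minimal ones of \<open>well_order\<close>, are asked of
  all nonempty subsets in the ground structure, so that every orbit has a definite
  representative.\<close>

definition wo :: "'m \<Rightarrow> 'm \<Rightarrow> bool" where
  "wo S X \<longleftrightarrow> is_rel S X X \<and>
     (\<forall>x y. related M S x y \<longrightarrow> x \<in> E X \<and> y \<in> E X) \<and> (\<forall>x\<in>E X. related M S x x) \<and>
     (\<forall>x y. related M S x y \<and> related M S y x \<longrightarrow> x = y) \<and>
     (\<forall>x y z. related M S x y \<and> related M S y z \<longrightarrow> related M S x z) \<and>
     (\<forall>T\<in>U. E T \<subseteq> E X \<and> E T \<noteq> {} \<longrightarrow> (\<exists>m\<in>E T. \<forall>t\<in>E T. related M S m t))"

lemma well_ordering:
  assumes "AC M" "isset M X"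
  shows "\<exists>S. wo S X"
proof -
  obtain Q where Q: "isset M Q" "E Q = {y. isset M y \<and> E y \<subseteq> E X}"
    using ex_Pow[OF isset_Univ[OF assms(2)]] by blast
  have "\<exists>P. isset M P \<and> E P = {y \<in> E Q. \<exists>z\<in>E y. True}"
    by (intro separation dfn_rules isset_Univ[OF Q(1)])
  then obtain P where P: "isset M P" "E P = {y \<in> E Q. \<exists>z\<in>E y. True}" by blast
  have P_iff: "y \<in> E P \<longleftrightarrow> isset M y \<and> E y \<subseteq> E X \<and> E y \<noteq> {}" for y
    unfolding P(2) Q(2) by auto
  have "\<forall>x\<in>E P. E x \<noteq> {}" by (simp add: P_iff)
  then obtain f where f: "is_fun M f P" "\<And>x y. related M f x y \<Longrightarrow> y \<in> E x"
    using assms(1) P(1) unfolding AC_def by metis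
  have fU: "f \<in> U" using f(1) by (simp add: is_fun_def isset_def)
  \<comment> \<open>The next point after \<open>a\<close> is the value of the choice function at the
    complement of \<open>a\<close> in \<open>X\<close>.\<close>
  define pick where "pick a c \<longleftrightarrow>
    (\<exists>D\<in>U. (\<forall>x\<in>U. x \<in> E D \<longleftrightarrow> x \<in> E X \<and> x \<notin> E a) \<and> related M f D c)" for a c
  have D: "(\<forall>x\<in>U. x \<in> E D \<longleftrightarrow> x \<in> E X \<and> x \<notin> E a) \<longleftrightarrow> E D = E X - E a" for D a
    using elems_Univ[of _ M] by auto
  interpret choice_tower M X pick
  proof
    show "dfn M (\<lambda>v. pick (v 0) (v 1))"
      unfolding pick_def by (intro dfn_rules isset_Univ[OF assms(2)] fU)
    show "\<exists>c. pick a c" if a: "isset M a" "E a \<subseteq> E X" "E a \<noteq> E X" for a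
    proof -
      have "\<exists>D. isset M D \<and> E D = {x \<in> E X. x \<notin> E a}"
        by (intro separation dfn_rules isset_Univ[OF assms(2)] isset_Univ[OF a(1)])
      then obtain D' where D': "isset M D'" "E D' = E X - E a" by (auto simp: set_diff_eq)
      then have "D' \<in> E P" using a(2,3) unfolding P_iff D'(2) by auto
      then obtain c where "related M f D' c" using fun_total[OF f(1)] by blast
      then show ?thesis unfolding pick_def D using D'(2) isset_Univ[OF D'(1)] by metis
    qed
    show "c = d" if cd: "pick a c" "pick a d" for a c d
    proof -
      obtain D1 D2 where D12: "E D1 = E X - E a" "related M f D1 c" "E D2 = E X - E a" "related M f D2 d"
        using cd unfolding pick_def D by auto
      then have "isset M D1" "isset M D2" using fun_domain[OF f(1)] P_iff by blast+
      then have "D1 = D2" using isset_extensional[of D1 D2] D12 by simp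
      then show ?thesis using D12 fun_unique[OF f(1), of D1] by simp
    qed
    show "c \<in> E X \<and> c \<notin> E a" if "pick a c" for a c
      using that f(2) unfolding pick_def D by auto
  qed (rule assms(2))
  obtain S where S: "is_rel S X X"
    "\<And>x y. related M S x y \<longleftrightarrow> x \<in> E X \<and> y \<in> E X \<and> before x y"
    using well_ordering_relation by blast
  have "\<exists>m\<in>E T. \<forall>t\<in>E T. related M S m t" if "T \<in> U" "E T \<subseteq> E X" "E T \<noteq> {}" for T
    using before_least[OF that] that(2) unfolding S(2) by blast
  then have "wo S X"
    unfolding wo_def using S before_antisym by (auto simp: before_def)
  then show ?thesis by blast
qed

lemma wo_least:
  assumes "wo S X" "T \<in> U" "E T \<subseteq> E X" "t \<in> E T"
  shows "\<exists>m\<in>E T. \<forall>t\<in>E T. related M S m t"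
  using assms unfolding wo_def by blast

lemma wo_antisym: "wo S X \<Longrightarrow> related M S x y \<Longrightarrow> related M S y x \<Longrightarrow> x = y"
  unfolding wo_def by blast

lemma wo_trans: "wo S X \<Longrightarrow> related M S x y \<Longrightarrow> related M S y z \<Longrightarrow> related M S x z"
  unfolding wo_def by blast

lemma wo_refl: "wo S X \<Longrightarrow> x \<in> E X \<Longrightarrow> related M S x x"
  unfolding wo_def by blast

lemma wo_field: "wo S X \<Longrightarrow> related M S x y \<Longrightarrow> x \<in> E X \<and> y \<in> E X"
  unfolding wo_def by blast

lemma wo_linear:
  assumes "wo S X" "x \<in> E X" "y \<in> E X"
  shows "related M S x y \<or> related M S y x"
proof -
  obtain T where T: "isset M T" "E T = {x, y}"
    using ex_upair elems_Univ[OF assms(2)] elems_Univ[OF assms(3)] by blast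
  have "\<exists>m\<in>E T. \<forall>t\<in>E T. related M S m t"
    by (rule wo_least[OF assms(1) isset_Univ[OF T(1)], of x]) (use assms T in auto)
  then show ?thesis unfolding T(2) by blast
qed

lemma wo_Univ: "wo S X \<Longrightarrow> S \<in> U"
  unfolding wo_def is_rel_def isset_def by blast

end

section \<open>The permutation model\<close>

context zfa
begin

lemma transitive_insert:
  assumes "is_transitive M t" "isset M u" "E u \<subseteq> E t"
  shows "\<exists>t'. is_transitive M t' \<and> E t' = insert u (E t)"
proof -
  obtain t' where t': "isset M t'" "E t' = insert u (E t)"
    using ex_insert[OF isset_Univ[OF assms(2)] transitive_Univ[OF assms(1)]] by blast
  then have "is_transitive M t'" using assms(1,3) unfolding is_transitive_def by auto
  then show ?thesis using t'(2) by blast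
qed

lemma tset_subset: "is_transitive M t \<Longrightarrow> isset M u \<Longrightarrow> E u \<subseteq> E t \<Longrightarrow> tset u"
  using transitive_insert unfolding tset_def by blast

lemma transitive_Un:
  assumes "is_transitive M s" "is_transitive M t"
  shows "\<exists>r. is_transitive M r \<and> E r = E s \<union> E t"
proof -
  obtain r where r: "isset M r" "E r = E s \<union> E t"
    using ex_Un transitive_Univ assms by metis
  then have "is_transitive M r" using assms unfolding is_transitive_def by auto
  then show ?thesis using r(2) by blast
qed

lemma transitive_Pow:
  assumes "is_transitive M t"
  shows "\<exists>r. is_transitive M r \<and> E r = E t \<union> {u. isset M u \<and> E u \<subseteq> E t}"
proof -
  obtain q where q: "isset M q" "E q = {u. isset M u \<and> E u \<subseteq> E t}"
    using ex_Pow[OF transitive_Univ[OF assms]] by blast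
  obtain r where r: "isset M r" "E r = E t \<union> E q"
    using ex_Un transitive_Univ[OF assms] isset_Univ[OF q(1)] by metis
  have "is_transitive M r"
    using assms r(1) unfolding is_transitive_def r(2) q(2) by auto
  then show ?thesis using r(2) q(2) by auto
qed

text \<open>Pairs of members of \<open>t\<close> appear after two power sets, and adding all its
  subsets to a transitive set keeps it transitive.\<close>

lemma tset_rel:
  assumes t: "is_transitive M t" and S: "isset M S"
    and p: "\<And>p. p \<in> E S \<Longrightarrow> \<exists>x\<in>E t. \<exists>y\<in>E t. is_pair M p x y"
  shows "tset S"
proof -
  obtain t1 where t1: "is_transitive M t1" "E t1 = E t \<union> {u. isset M u \<and> E u \<subseteq> E t}"
    using transitive_Pow[OF t] by blast
  obtain t2 where t2: "is_transitive M t2" "E t2 = E t1 \<union> {u. isset M u \<and> E u \<subseteq> E t1}"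
    using transitive_Pow[OF t1(1)] by blast
  have "E S \<subseteq> E t2"
  proof
    fix p assume "p \<in> E S"
    then obtain x y where xy: "x \<in> E t" "y \<in> E t" "is_pair M p x y" using p by blast
    then obtain u v where uv: "represents M u {x}" "represents M v {x, y}" "represents M p {u, v}"
      unfolding is_pair_def by blast
    then have "u \<in> E t1" "v \<in> E t1" using xy(1,2) unfolding t1(2) represents_def by auto
    then show "p \<in> E t2" using uv(3) unfolding t2(2) represents_def by auto
  qed
  then show ?thesis using tset_subset[OF t2(1) S] by blast
qed

end

section \<open>Closure properties of the permutation model\<close>

locale perm_model = zfa_group M G for M :: "'m zfa_structure" and G +
  fixes F :: 'm
  assumes filter: "normal_filter M G F"
begin

definition N :: "'m zfa_structure" where
  "N = permutation_model M G F"

lemma N_Univ: "Univ N = {x \<in> U. hereditarily_symmetric M G F x}"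
  by (simp add: N_def permutation_model_def)

lemma elems_N: "elems N x = E x \<inter> Univ N"
  by (auto simp: N_def permutation_model_def elems_def)

lemma Atoms_N: "Atoms N = A"
  by (simp add: N_def permutation_model_def)

lemma N_in_Univ: "x \<in> Univ N \<Longrightarrow> x \<in> U"
  by (simp add: N_Univ)

lemma F_Univ: "F \<in> U"
  using filter by (simp add: normal_filter_def isset_def)

lemma F_subgroup: "L \<in> E F \<Longrightarrow> perm_group M L" "L \<in> E F \<Longrightarrow> E L \<subseteq> E G"
  using filter by (auto simp: normal_filter_def subgroup_def)

lemma F_G: "k \<in> E L \<Longrightarrow> L \<in> E F \<Longrightarrow> k \<in> E G"
  using F_subgroup(2) by blast

lemma G_in_F: "G \<in> E F"
  using filter by (simp add: normal_filter_def)

lemma F_upward: "L \<in> E F \<Longrightarrow> subgroup M K G \<Longrightarrow> E L \<subseteq> E K \<Longrightarrow> K \<in> E F"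
  using filter unfolding normal_filter_def by blast

lemma F_Int: "L \<in> E F \<Longrightarrow> K \<in> E F \<Longrightarrow> \<exists>H\<in>E F. E H = E L \<inter> E K"
  using filter unfolding normal_filter_def represents_def by meson

lemma F_comp:
  assumes "L \<in> E F" "k \<in> E L" "l \<in> E L" "m \<in> E G" "is_comp M m k l"
  shows "m \<in> E L"
proof -
  obtain m' where m': "m' \<in> E L" "is_comp M m' k l"
    using F_subgroup(1)[OF assms(1)] assms(2,3) unfolding perm_group_def by blast
  have "m = m'" using G_comp_unique[OF _ _ assms(5) m'(2)] F_G assms(1-3) by blast
  then show ?thesis using m'(1) by simp
qed

lemma F_inverse:
  assumes "L \<in> E F" "k \<in> E L"
  obtains l where "l \<in> E L" "\<And>x. tset x \<Longrightarrow> act l (act k x) = x" "\<And>x. tset x \<Longrightarrow> act k (act l x) = x"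
proof -
  obtain l where l: "l \<in> E L" "is_inverse M l k"
    using F_subgroup(1)[OF assms(1)] assms(2) unfolding perm_group_def by blast
  have "k \<in> E G" "l \<in> E G" using F_G assms l(1) by auto
  then show ?thesis using that[OF l(1)] act_inverse[OF _ _ l(2)] by blast
qed

lemma F_id:
  assumes "L \<in> E F"
  obtains e where "e \<in> E L" "\<And>x. tset x \<Longrightarrow> act e x = x"
proof -
  obtain e where e: "e \<in> E L" "is_id M e"
    using F_subgroup(1)[OF assms(1)] unfolding perm_group_def by blast
  then show ?thesis using that act_id[OF G_perm[OF F_G[OF e(1) assms]] e(2)] by blast
qed

lemma F_compose:
  assumes "L \<in> E F" "k \<in> E L" "l \<in> E L"
  obtains m where "m \<in> E L" "\<And>x. tset x \<Longrightarrow> act m x = act k (act l x)"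
proof -
  obtain m where m: "m \<in> E L" "is_comp M m k l"
    using F_subgroup(1)[OF assms(1)] assms(2,3) unfolding perm_group_def by blast
  have "perm k" "perm l" "perm m" using G_perm F_G assms m(1) by blast+
  then show ?thesis using that[OF m(1)] act_comp[OF _ _ _ m(2)] by blast
qed

text \<open>The stabilizer is a group in the filter, hence nonempty. The extension of any of its
  elements is defined at \<open>x\<close>, which happens only for members of transitive
  sets.\<close>

lemma symmetric_tset:
  assumes "symmetric M G F x" shows "tset x"
proof -
  obtain H where H: "H \<in> E F" "E H = {g \<in> E G. ext_maps M g x x}"
    using assms unfolding symmetric_def is_sym_def represents_def by blast
  obtain e where "e \<in> E H" using F_id[OF H(1)] by blast
  then show ?thesis using ext_maps_tset unfolding H(2) by blast
qed

lemma N_tset: "x \<in> Univ N \<Longrightarrow> tset x"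
  using symmetric_tset by (simp add: N_Univ hereditarily_symmetric_def)

lemma N_trans:
  assumes "x \<in> Univ N" "y \<in> E x"
  shows "y \<in> Univ N"
proof -
  have yU: "y \<in> U" using assms(2) by (rule elems_Univ)
  have "y \<in> trcl M x" using assms(2) yU unfolding trcl_def by blast
  moreover have "trcl M y \<subseteq> trcl M x"
    using assms(2) unfolding trcl_def is_transitive_def by blast
  ultimately show ?thesis
    using assms(1) yU unfolding N_Univ hereditarily_symmetric_def by blast
qed

lemma N_elems: "x \<in> Univ N \<Longrightarrow> elems N x = E x"
  using N_trans unfolding elems_N by blast

lemma N_isset: "x \<in> Univ N \<Longrightarrow> isset N x \<longleftrightarrow> isset M x"
  using N_in_Univ by (auto simp: isset_def elems_N Atoms_N)

lemma N_issetD: "isset N x \<Longrightarrow> x \<in> Univ N"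
  by (simp add: isset_def)

lemma stabilizer:
  assumes "x \<in> Univ N"
  obtains L where "L \<in> E F" "\<And>k. k \<in> E L \<Longrightarrow> act k x = x"
proof -
  obtain H where H: "H \<in> E F" "E H = {g \<in> E G. ext_maps M g x x}"
    using assms unfolding N_Univ hereditarily_symmetric_def symmetric_def is_sym_def represents_def
    by blast
  have "act k x = x" if "k \<in> E H" for k
    using that ext_maps_act[OF G_perm N_tset[OF assms], of k x] unfolding H(2) by auto
  then show ?thesis using that[OF H(1)] by blast
qed

lemma stabilizer2:
  assumes "x \<in> Univ N" "y \<in> Univ N"
  obtains L where "L \<in> E F" "\<And>k. k \<in> E L \<Longrightarrow> act k x = x" "\<And>k. k \<in> E L \<Longrightarrow> act k y = y"
proof -
  obtain H where H: "H \<in> E F" "\<And>k. k \<in> E H \<Longrightarrow> act k x = x" using stabilizer[OF assms(1)] by blast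
  obtain K where K: "K \<in> E F" "\<And>k. k \<in> E K \<Longrightarrow> act k y = y" using stabilizer[OF assms(2)] by blast
  obtain L where "L \<in> E F" "E L = E H \<inter> E K" using F_Int[OF H(1) K(1)] by blast
  then show ?thesis using that[of L] H(2) K(2) by auto
qed

text \<open>The model is a class of the structure; this allows its part inside a transitive set to
  be separated, as \<open>N_closed\<close> requires.\<close>

lemma dfn_hereditarily_symmetric: "dfn M (\<lambda>v. hereditarily_symmetric M G F (v 0))"
proof -
  have s: "dfn M (\<lambda>v. symmetric M G F (v 0))"
    unfolding symmetric_def is_sym_def
    by (intro dfn_rules dfn_ext_maps F_Univ G_Univ A_Univ) (auto intro: elems_Univ)
  have "dfn M (\<lambda>v. symmetric M G F (v 0) \<and> (\<forall>y\<in>U.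
      (\<forall>t\<in>U. is_transitive M t \<and> E (v 0) \<subseteq> E t \<longrightarrow> y \<in> E t) \<longrightarrow> symmetric M G F y))"
    by (intro dfn_rules dfn_is_transitive dfn_subset dfn1[of M "symmetric M G F", OF s])
  moreover have "y \<in> trcl M x \<longleftrightarrow> y \<in> U \<and> (\<forall>t\<in>U. is_transitive M t \<and> E x \<subseteq> E t \<longrightarrow> y \<in> E t)" for x y
    unfolding trcl_def using transitive_Univ by blast
  ultimately show ?thesis
    by (elim dfn_cong) (auto simp: hereditarily_symmetric_def)
qed

text \<open>The stabilizer of \<open>x\<close> is a subgroup containing \<open>L\<close>, so it is
  in the filter by upward closure. For the transitive closure, the hereditarily symmetric members of
  a transitive set around \<open>x\<close> form a transitive set containing the elements of
  \<open>x\<close>.\<close>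

lemma N_closed:
  assumes x: "isset M x" "E x \<subseteq> Univ N" "tset x" and L: "L \<in> E F" "\<And>k. k \<in> E L \<Longrightarrow> act k x = x"
  shows "x \<in> Univ N"
proof -
  have "\<exists>H. isset M H \<and> E H = {g \<in> E G. ext_maps M g x x}"
    by (intro separation dfn_rules dfn_ext_maps G_Univ tset_Univ[OF x(3)])
  then obtain H where H: "isset M H" "E H = {g \<in> E G. ext_maps M g x x}" by blast
  have H_iff: "g \<in> E H \<longleftrightarrow> g \<in> E G \<and> act g x = x" for g
    using ext_maps_act[OF G_perm x(3), of g x] unfolding H(2) by auto
  have "perm_group M H"
    unfolding perm_group_def
  proof (intro conjI ballI)
    show "is_bij M g A A" if "g \<in> E H" for g
      using that G_perm unfolding H_iff perm_def by blast
    obtain e where e: "e \<in> E G" "is_id M e" using G_id by blast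
    then show "\<exists>e\<in>E H. is_id M e" using act_id[OF G_perm _ x(3)] unfolding Bex_def H_iff by blast
    show "\<exists>k\<in>E H. is_comp M k g h" if gh: "g \<in> E H" "h \<in> E H" for g h
    proof -
      have g: "g \<in> E G" "h \<in> E G" "act g x = x" "act h x = x" using gh unfolding H_iff by auto
      obtain k where k: "k \<in> E G" "is_comp M k g h" using G_comp[OF g(1,2)] by blast
      have "act k x = x"
        using act_comp[OF G_perm[OF k(1)] G_perm[OF g(1)] G_perm[OF g(2)] k(2) x(3)] g(3,4) by simp
      then show ?thesis using k H_iff by blast
    qed
    show "\<exists>k\<in>E H. is_inverse M k g" if gh: "g \<in> E H" for g
    proof -
      have g: "g \<in> E G" "act g x = x" using gh unfolding H_iff by auto
      obtain k where k: "k \<in> E G" "is_inverse M k g" using G_inverse[OF g(1)] by blast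
      have "act k x = x" using act_inverse(1)[OF g(1) k x(3)] g(2) by simp
      then show ?thesis using k H_iff by blast
    qed
  qed (rule H(1))
  then have "subgroup M H G" unfolding subgroup_def by (auto simp: H_iff)
  moreover have "E L \<subseteq> E H" using L F_G unfolding subset_iff H_iff by blast
  ultimately have "H \<in> E F" using F_upward[OF L(1)] by blast
  then have sym: "symmetric M G F x" using H unfolding symmetric_def is_sym_def represents_def by blast
  have "symmetric M G F y" if y: "y \<in> trcl M x" for y
  proof -
    obtain t where t: "is_transitive M t" "x \<in> E t" using x(3) unfolding tset_def by blast
    have "\<exists>s. isset M s \<and> E s = {z \<in> E t. hereditarily_symmetric M G F z}"
      by (intro separation dfn_hereditarily_symmetric transitive_Univ[OF t(1)])
    then obtain s where s: "isset M s" "E s = {z \<in> E t. hereditarily_symmetric M G F z}" by blast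
    have Es: "E s = E t \<inter> Univ N" unfolding s(2) N_Univ using elems_Univ by auto
    have "is_transitive M s"
      unfolding is_transitive_def Es using s(1) transitiveD[OF t(1)] N_trans by blast
    moreover have "E x \<subseteq> E s" unfolding Es using x(2) transitiveD[OF t] by blast
    ultimately have "y \<in> E s" using y unfolding trcl_def by blast
    then show ?thesis unfolding s(2) hereditarily_symmetric_def by blast
  qed
  then show ?thesis
    using sym tset_Univ[OF x(3)] unfolding N_Univ hereditarily_symmetric_def by blast
qed

text \<open>Invariance under \<open>k\<close> gives one inclusion, and invariance under its inverse,
  which is also in \<open>L\<close>, gives the other.\<close>

lemma invariant_fixed:
  assumes L: "L \<in> E F" and x: "isset M x" "tset x"
    and inv: "\<And>k y. k \<in> E L \<Longrightarrow> y \<in> E x \<Longrightarrow> act k y \<in> E x" and k: "k \<in> E L"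
  shows "act k x = x"
proof -
  have p: "perm k" using G_perm F_G[OF k L] by blast
  obtain l where l: "l \<in> E L" "\<And>y. tset y \<Longrightarrow> act k (act l y) = y" using F_inverse[OF L k] by blast
  have "y \<in> act k ` E x" if "y \<in> E x" for y
    using inv[OF l(1) that] l(2)[OF tset_elem[OF x(2) that]] by force
  then have "act k ` E x = E x" using inv[OF k] by blast
  then have "E (act k x) = E x" using act_set(2)[OF p x(2,1)] by simp
  then show ?thesis using isset_extensional[OF act_set(1)[OF p x(2,1)] x(1)] by simp
qed

text \<open>The route by which unions of orbits, such as the cofinal sets, enter the model.\<close>

lemma N_subset:
  assumes "P \<in> Univ N" "isset M W" "E W \<subseteq> E P" "L \<in> E F"
    "\<And>k y. k \<in> E L \<Longrightarrow> y \<in> E W \<Longrightarrow> act k y \<in> E W"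
  shows "W \<in> Univ N"
proof (rule N_closed)
  obtain t where t: "is_transitive M t" "P \<in> E t" using N_tset[OF assms(1)] unfolding tset_def by blast
  show "tset W" using tset_subset[OF t(1) assms(2)] assms(3) transitiveD[OF t] by blast
  then show "act k W = W" if "k \<in> E L" for k using invariant_fixed assms that by blast
qed (use assms N_trans in blast)+

lemma N_upair:
  assumes "x \<in> Univ N" "y \<in> Univ N" "isset M u" "E u = {x, y}"
  shows "u \<in> Univ N"
proof -
  obtain L where L: "L \<in> E F" "\<And>k. k \<in> E L \<Longrightarrow> act k x = x" "\<And>k. k \<in> E L \<Longrightarrow> act k y = y"
    using stabilizer2[OF assms(1,2)] by blast
  obtain s t where "is_transitive M s" "x \<in> E s" "is_transitive M t" "y \<in> E t"
    using N_tset[OF assms(1)] N_tset[OF assms(2)] unfolding tset_def by blast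
  then obtain r where r: "is_transitive M r" "x \<in> E r" "y \<in> E r"
    using transitive_Un[of s t] by auto
  have t: "tset u" using tset_subset[OF r(1) assms(3)] r(2,3) unfolding assms(4) by blast
  show ?thesis
  proof (rule N_closed[OF assms(3) _ t L(1)])
    show "act k u = u" if "k \<in> E L" for k
      using invariant_fixed[OF L(1) assms(3) t _ that] L(2,3) unfolding assms(4) by auto
  qed (use assms in auto)
qed

lemma N_pair:
  assumes "x \<in> Univ N" "y \<in> Univ N" "is_pair M p x y"
  shows "p \<in> Univ N"
proof -
  obtain u v where uv: "represents M u {x}" "represents M v {x, y}" "represents M p {u, v}"
    using assms(3) unfolding is_pair_def by blast
  have "u \<in> Univ N" using N_upair[OF assms(1,1)] uv(1) unfolding represents_def by auto
  moreover have "v \<in> Univ N" using N_upair[OF assms(1,2)] uv(2) unfolding represents_def by auto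
  ultimately show ?thesis using N_upair uv(3) unfolding represents_def by blast
qed

text \<open>The counterpart of \<open>N_subset\<close> for relations: invariance is checked on
  related points instead of on pairs, and \<open>t\<close> bounds both coordinates.\<close>

lemma N_rel:
  assumes t: "is_transitive M t" and S: "isset M S" and L: "L \<in> E F"
    and p: "\<And>p. p \<in> E S \<Longrightarrow> \<exists>x\<in>E t \<inter> Univ N. \<exists>y\<in>E t \<inter> Univ N. is_pair M p x y"
    and inv: "\<And>k x y. k \<in> E L \<Longrightarrow> related M S x y \<Longrightarrow> related M S (act k x) (act k y)"
  shows "S \<in> Univ N"
proof (rule N_closed[OF S _ _ L])
  show tS: "tset S" using p by (intro tset_rel[OF t S]) blast
  show "E S \<subseteq> Univ N" using p N_pair by blast
  have "act k q \<in> E S" if kq: "k \<in> E L" "q \<in> E S" for k q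
  proof -
    obtain x y where xy: "is_pair M q x y" using p[OF kq(2)] by blast
    then have "related M S (act k x) (act k y)" using inv[OF that(1)] related_pair that(2) by blast
    moreover have "is_pair M (act k q) (act k x) (act k y)"
      using act_pair[OF F_G[OF that(1) L] tset_elem[OF tS that(2)] xy] .
    ultimately show ?thesis using related_pair by blast
  qed
  then show "act k S = S" if "k \<in> E L" for k using invariant_fixed[OF L S tS] that by blast
qed

section \<open>Absoluteness between the structure and the permutation model\<close>

lemma represents_N: "represents N u X \<longleftrightarrow> u \<in> Univ N \<and> represents M u X"
  using N_isset N_elems N_issetD unfolding represents_def by metis

text \<open>\<open>N\<close> is transitive, so the singleton and the doubleton inside a pair of
  \<open>N\<close> are themselves in \<open>N\<close>. The equivalences that follow rest on the same
  fact.\<close>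

lemma is_pair_N: "is_pair N p x y \<longleftrightarrow> p \<in> Univ N \<and> is_pair M p x y"
proof
  assume "is_pair N p x y"
  then show "p \<in> Univ N \<and> is_pair M p x y" unfolding is_pair_def represents_N by blast
next
  assume p: "p \<in> Univ N \<and> is_pair M p x y"
  then obtain u v where uv: "represents M u {x}" "represents M v {x, y}" "represents M p {u, v}"
    unfolding is_pair_def by blast
  have "u \<in> Univ N" "v \<in> Univ N" using N_trans[of p] p uv(3) unfolding represents_def by auto
  then show "is_pair N p x y" using p uv unfolding is_pair_def represents_N by blast
qed

lemma related_N:
  assumes "r \<in> Univ N" shows "related N r x y \<longleftrightarrow> related M r x y"
  using N_trans[OF assms] unfolding related_def N_elems[OF assms] is_pair_N by blast

lemma related_in_N:
  assumes "r \<in> Univ N" "related M r x y" shows "x \<in> Univ N" "y \<in> Univ N"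
proof -
  obtain p where p: "p \<in> E r" "is_pair M p x y" using assms(2) unfolding related_def by blast
  then obtain u v where uv: "represents M v {x, y}" "represents M p {u, v}"
    unfolding is_pair_def by blast
  have "p \<in> Univ N" using N_trans assms(1) p(1) by blast
  then have "v \<in> Univ N" using N_trans[of p v] uv(2) unfolding represents_def by auto
  then show "x \<in> Univ N" "y \<in> Univ N" using N_trans[of v] uv(1) unfolding represents_def by auto
qed

lemma is_fun_N:
  assumes "f \<in> Univ N" "X \<in> Univ N" shows "is_fun N f X \<longleftrightarrow> is_fun M f X"
  using N_trans[OF assms(1)]
  unfolding is_fun_def N_isset[OF assms(1)] N_elems[OF assms(1)] N_elems[OF assms(2)]
    related_N[OF assms(1)] is_pair_N by blast

lemma poset_N:
  assumes "P \<in> Univ N" "R \<in> Univ N" shows "poset N P R \<longleftrightarrow> poset M P R"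
  using N_trans[OF assms(2)]
  unfolding poset_def N_isset[OF assms(1)] N_isset[OF assms(2)] N_elems[OF assms(1)]
    N_elems[OF assms(2)] related_N[OF assms(2)] is_pair_N by blast

lemma poset_in_N: "poset N P R \<Longrightarrow> P \<in> Univ N \<and> R \<in> Univ N"
  by (auto simp: poset_def isset_def)

lemma poset_relatedD:
  assumes "poset M P R" "related M R x y" shows "x \<in> E P" "y \<in> E P"
proof -
  obtain p where p: "p \<in> E R" "is_pair M p x y" using assms(2) unfolding related_def by blast
  then obtain x' y' where "x' \<in> E P" "y' \<in> E P" "is_pair M p x' y'"
    using assms(1) unfolding poset_def by blast
  then show "x \<in> E P" "y \<in> E P" using is_pair_inject[OF p(2)] by auto
qed

lemma linear_order_N:
  assumes "P \<in> Univ N" "R \<in> Univ N" shows "linear_order N P R \<longleftrightarrow> linear_order M P R"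
  unfolding linear_order_def poset_N[OF assms] N_elems[OF assms(1)] related_N[OF assms(2)] ..

end

section \<open>Two-colouring an increasing function\<close>

text \<open>
  For \<open>f\<close> increasing with respect to a strict partial order, two points are equivalent if some
  point is reached from both by an even number of steps. The points equivalent to \<open>x\<close> or to
  \<open>f x\<close> form a set that is the same for \<open>x\<close> and \<open>f x\<close>, and its least element in a well-order
  is equivalent to exactly one of them.
\<close>

locale increasing_function = zfa M for M :: "'m zfa_structure" +
  fixes P S :: 'm and fr lt :: "'m \<Rightarrow> 'm \<Rightarrow> bool" and f :: "'m \<Rightarrow> 'm"
  assumes wo: "wo S P" and P_Univ: "P \<in> U"
    and dfn_fr0: "dfn M (\<lambda>v. fr (v 0) (v 1))" and dfn_lt0: "dfn M (\<lambda>v. lt (v 0) (v 1))"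
    and f_in: "\<And>x. x \<in> E P \<Longrightarrow> f x \<in> E P" and fr_iff: "\<And>x y. x \<in> E P \<Longrightarrow> fr x y \<longleftrightarrow> y = f x"
    and lt_irrefl: "\<And>x. x \<in> E P \<Longrightarrow> \<not> lt x x"
    and lt_trans: "\<And>x y z. x \<in> E P \<Longrightarrow> y \<in> E P \<Longrightarrow> z \<in> E P \<Longrightarrow> lt x y \<Longrightarrow> lt y z \<Longrightarrow> lt x z"
    and lt_f: "\<And>x. x \<in> E P \<Longrightarrow> lt x (f x)"
begin

lemma dfn_fr: "tm M s \<Longrightarrow> tm M t \<Longrightarrow> dfn M (\<lambda>v. fr (s v) (t v))"
  by (rule dfn2[of M fr, OF dfn_fr0])

lemma dfn_lt: "tm M s \<Longrightarrow> tm M t \<Longrightarrow> dfn M (\<lambda>v. lt (s v) (t v))"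
  by (rule dfn2[of M lt, OF dfn_lt0])

text \<open>The reflexive-transitive closure of the double step from \<open>u\<close> to
  \<open>f (f u)\<close>, given through closed sets so that the number of steps is not
  mentioned.\<close>

definition reach :: "'m \<Rightarrow> 'm \<Rightarrow> bool" where
  "reach x y \<longleftrightarrow> x \<in> E P \<and> y \<in> E P \<and> (\<forall>T\<in>U. x \<in> E T \<and>
     (\<forall>u\<in>E T. u \<in> E P \<longrightarrow> (\<forall>w\<in>U. \<forall>z\<in>U. fr u w \<and> fr w z \<longrightarrow> z \<in> E T)) \<longrightarrow> y \<in> E T)"

lemma dfn_reach: "tm M s \<Longrightarrow> tm M t \<Longrightarrow> dfn M (\<lambda>v. reach (s v) (t v))"
proof (rule dfn2)
  show "dfn M (\<lambda>v. reach (v 0) (v 1))"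
    unfolding reach_def by (intro dfn_rules dfn_fr P_Univ)
qed

lemma reach_in: "reach x y \<Longrightarrow> x \<in> E P" "reach x y \<Longrightarrow> y \<in> E P"
  by (auto simp: reach_def)

lemma reach_refl: "x \<in> E P \<Longrightarrow> reach x x"
  by (simp add: reach_def)

lemma reach_step:
  assumes "reach x y" shows "reach x (f (f y))"
proof -
  have y: "y \<in> E P" "f y \<in> E P" "f (f y) \<in> E P" using reach_in[OF assms] f_in by auto
  have "f (f y) \<in> E T" if T: "T \<in> U" "x \<in> E T"
    "\<forall>u\<in>E T. u \<in> E P \<longrightarrow> (\<forall>w\<in>U. \<forall>z\<in>U. fr u w \<and> fr w z \<longrightarrow> z \<in> E T)" for T
  proof -
    have "y \<in> E T" using assms T unfolding reach_def by blast
    moreover have "fr y (f y)" "fr (f y) (f (f y))" using fr_iff y by auto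
    ultimately show ?thesis using T(3) y elems_Univ by metis
  qed
  then show ?thesis using reach_in(1)[OF assms] y(3) unfolding reach_def by blast
qed

lemma reach_induct [consumes 1, case_names dfn refl step]:
  assumes "reach x y" "dfn M (\<lambda>v. Q (v 0))" "Q x" "\<And>u. u \<in> E P \<Longrightarrow> Q u \<Longrightarrow> Q (f (f u))"
  shows "Q y"
proof -
  have "\<exists>T. isset M T \<and> E T = {u \<in> E P. Q u}" by (intro separation assms(2) P_Univ)
  then obtain T where T: "isset M T" "E T = {u \<in> E P. Q u}" by blast
  have "z \<in> E T" if "u \<in> E T" "u \<in> E P" "fr u w" "fr w z" for u w z
    using that f_in fr_iff assms(4) unfolding T(2) by auto
  moreover have "x \<in> E T" using assms(3) reach_in(1)[OF assms(1)] unfolding T(2) by blast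
  ultimately have "y \<in> E T" using assms(1) isset_Univ[OF T(1)] unfolding reach_def by blast
  then show ?thesis unfolding T(2) by blast
qed

lemma reach_Univ: "reach x y \<Longrightarrow> x \<in> U \<and> y \<in> U"
  using reach_in elems_Univ by metis

lemma reach_trans:
  assumes "reach x y" "reach y z" shows "reach x z"
  using assms(2)
proof (induction rule: reach_induct)
  case dfn
  show ?case by (intro dfn_rules dfn_reach) (use reach_Univ assms in auto)
qed (auto intro: reach_step assms)

lemma reach_unfold:
  assumes "reach x y" shows "y = x \<or> reach (f (f x)) y"
proof -
  have x: "x \<in> E P" "f (f x) \<in> E P" using reach_in(1)[OF assms] f_in by auto
  show ?thesis
    using assms
  proof (induction rule: reach_induct)
    case dfn
    show ?case by (intro dfn_rules dfn_reach elems_Univ[OF x(1)] elems_Univ[OF x(2)])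
  next
    case (step u)
    then show ?case using reach_refl[OF x(2)] reach_step by auto
  qed simp
qed

lemma reach_linear:
  assumes "reach x y" "reach x z" shows "reach y z \<or> reach z y"
  using assms(1)
proof (induction rule: reach_induct)
  case dfn
  show ?case by (intro dfn_rules dfn_reach) (use reach_Univ[OF assms(2)] in auto)
next
  case (step u)
  then show ?case using reach_unfold[of u z] reach_step[of z u] reach_step[OF reach_refl[of u]] by auto
qed (use assms(2) in simp)

lemma reach_lt:
  assumes "reach x y" shows "y = x \<or> lt x y"
proof -
  have x: "x \<in> E P" using reach_in(1)[OF assms] .
  show ?thesis
    using assms
  proof (induction rule: reach_induct)
    case dfn
    show ?case by (intro dfn_rules dfn_lt elems_Univ[OF x])
  next
    case (step u)
    have "lt u (f (f u))"
      using lt_trans[OF _ _ _ lt_f lt_f, of u] f_in step(1) by blast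
    then show ?case using step lt_trans[OF x step(1) f_in[OF f_in[OF step(1)]]] by auto
  qed simp
qed

lemma not_reach_f: "x \<in> E P \<Longrightarrow> \<not> reach (f x) x"
  using reach_lt[of "f x" x] lt_f[of x] lt_trans[of x "f x" x] lt_irrefl[of x] f_in[of x] by auto

text \<open>A parity argument without parity. If \<open>u\<close> and \<open>f u\<close> both reach
  \<open>z\<close>, then \<open>u\<close> differs from \<open>z\<close>, because \<open>f u\<close>
  cannot come back to \<open>u\<close>; so \<open>f (f u)\<close> still reaches \<open>z\<close>,
  and the same holds one step later. The property thus travels along the path from \<open>y\<close>
  to \<open>z\<close>, and at \<open>z\<close> it says that \<open>f z\<close> reaches
  \<open>z\<close>.\<close>

lemma not_reach_odd: "\<not> (reach y z \<and> reach (f y) z)"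
proof
  assume yz: "reach y z \<and> reach (f y) z"
  have z: "z \<in> E P" using reach_in yz by blast
  have "reach y z" using yz by blast
  then have "z \<in> E P \<longrightarrow> (\<forall>w\<in>U. fr z w \<longrightarrow> reach z z \<and> reach w z)"
  proof (induction rule: reach_induct[where Q = "\<lambda>u. u \<in> E P \<longrightarrow> (\<forall>w\<in>U. fr u w \<longrightarrow> reach u z \<and> reach w z)"])
    case dfn
    show ?case by (intro dfn_rules dfn_reach dfn_fr) (use P_Univ elems_Univ[OF z] in auto)
  next
    case refl
    then show ?case using yz fr_iff by auto
  next
    case (step u)
    note fu = f_in[OF step(1)]
    have u: "reach u z" "reach (f u) z"
      using step fr_iff[OF step(1)] elems_Univ[OF fu] by auto
    have "z \<noteq> u" using u(2) not_reach_f[OF step(1)] by auto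
    then have 1: "reach (f (f u)) z" using reach_unfold[OF u(1)] by blast
    then have "z \<noteq> f u" using not_reach_f[OF fu] by auto
    then have "reach (f (f (f u))) z" using reach_unfold[OF u(2)] by blast
    then show ?case using 1 fr_iff[OF f_in[OF fu]] by auto
  qed
  then show False using not_reach_f[OF z] fr_iff[OF z] z elems_Univ[OF f_in[OF z]] by auto
qed

definition sim :: "'m \<Rightarrow> 'm \<Rightarrow> bool" where
  "sim x y \<longleftrightarrow> (\<exists>w\<in>E P. reach x w \<and> reach y w)"

lemma dfn_sim: "tm M s \<Longrightarrow> tm M t \<Longrightarrow> dfn M (\<lambda>v. sim (s v) (t v))"
proof (rule dfn2)
  show "dfn M (\<lambda>v. sim (v 0) (v 1))"
    unfolding sim_def by (intro dfn_rules dfn_reach P_Univ)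
qed

text \<open>The points reached from \<open>y\<close> are \<open>y\<close> and those reached from
  \<open>f (f y)\<close>. If the common point is \<open>y\<close> itself, it is moved on by a double
  step.\<close>

lemma sim_step:
  assumes "y \<in> E P" shows "sim z (f (f y)) \<longleftrightarrow> sim z y"
proof
  assume "sim z (f (f y))"
  then show "sim z y"
    using reach_trans[OF reach_step[OF reach_refl[OF assms]]] unfolding sim_def by blast
next
  assume "sim z y"
  then obtain w where w: "reach z w" "reach y w" unfolding sim_def by blast
  from reach_unfold[OF w(2)] show "sim z (f (f y))"
  proof
    assume "w = y"
    then show ?thesis using reach_step[OF w(1)] reach_refl f_in assms unfolding sim_def by blast
  qed (use w(1) reach_in in \<open>auto simp: sim_def\<close>)
qed

text \<open>The two meeting points are both reached from \<open>r\<close>, hence one reaches the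
  other. The further one is reached from \<open>y\<close> and from \<open>f y\<close>, against
  \<open>not_reach_odd\<close>.\<close>

lemma not_sim_both: "\<not> (sim r y \<and> sim r (f y))"
proof
  assume "sim r y \<and> sim r (f y)"
  then obtain w w' where w: "reach r w" "reach y w" "reach r w'" "reach (f y) w'"
    unfolding sim_def by blast
  then show False
    using reach_linear[OF w(1,3)] reach_trans[OF w(2)] reach_trans[OF w(4)] not_reach_odd by blast
qed

definition is_root :: "'m \<Rightarrow> 'm \<Rightarrow> bool" where
  "is_root r x \<longleftrightarrow> r \<in> E P \<and> (\<exists>y\<in>U. fr x y \<and> (sim r x \<or> sim r y) \<and>
     (\<forall>z\<in>E P. sim z x \<or> sim z y \<longrightarrow> related M S r z))"

lemma is_root_iff: "x \<in> E P \<Longrightarrow> is_root r x \<longleftrightarrow> r \<in> E P \<and> (sim r x \<or> sim r (f x)) \<and>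
     (\<forall>z\<in>E P. sim z x \<or> sim z (f x) \<longrightarrow> related M S r z)"
  using fr_iff[of x] elems_Univ[OF f_in[of x]] unfolding is_root_def by auto

lemma dfn_is_root: "tm M s \<Longrightarrow> tm M t \<Longrightarrow> dfn M (\<lambda>v. is_root (s v) (t v))"
proof (rule dfn2)
  show "dfn M (\<lambda>v. is_root (v 0) (v 1))"
    unfolding is_root_def by (intro dfn_rules dfn_fr dfn_sim P_Univ wo_Univ[OF wo])
qed

lemma is_root_f: "x \<in> E P \<Longrightarrow> is_root r (f x) \<longleftrightarrow> is_root r x"
  using is_root_iff[of x] is_root_iff[OF f_in[of x]] sim_step[of x] by auto

lemma ex_root:
  assumes x: "x \<in> E P" shows "\<exists>r. is_root r x"
proof -
  have "\<exists>K. isset M K \<and> E K = {z \<in> E P. sim z x \<or> sim z (f x)}"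
    by (intro separation dfn_rules dfn_sim P_Univ elems_Univ[OF x] elems_Univ[OF f_in[OF x]])
  then obtain K where K: "isset M K" "E K = {z \<in> E P. sim z x \<or> sim z (f x)}" by blast
  have "x \<in> E K" using x reach_refl unfolding K(2) sim_def by blast
  then have "\<exists>m\<in>E K. \<forall>t\<in>E K. related M S m t"
    by (intro wo_least[OF wo isset_Univ[OF K(1)]]) (auto simp: K(2))
  then show ?thesis unfolding is_root_iff[OF x] K(2) by auto
qed

lemma root_unique: "x \<in> E P \<Longrightarrow> is_root r x \<Longrightarrow> is_root s x \<Longrightarrow> r = s"
  using is_root_iff[of x] wo_antisym[OF wo, of r s] by auto

lemma two_colouring: "\<exists>C. isset M C \<and> E C \<subseteq> E P \<and> (\<forall>x\<in>E P. x \<in> E C \<longleftrightarrow> f x \<notin> E C)"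
proof -
  have "\<exists>C. isset M C \<and> E C = {x \<in> E P. \<exists>r\<in>E P. is_root r x \<and> sim r x}"
    by (intro separation dfn_rules dfn_sim dfn_is_root P_Univ)
  then obtain C where C: "isset M C" "E C = {x \<in> E P. \<exists>r\<in>E P. is_root r x \<and> sim r x}" by blast
  have "x \<in> E C \<longleftrightarrow> f x \<notin> E C" if x: "x \<in> E P" for x
  proof -
    obtain r where r: "is_root r x" using ex_root[OF x] by blast
    have 1: "y \<in> E C \<longleftrightarrow> sim r y" if "y \<in> E P" "is_root r y" for y
      using that root_unique[OF that(1) that(2)] is_root_iff[OF that(1)] unfolding C(2) by blast
    have "sim r x \<or> sim r (f x)" using r is_root_iff[OF x] by blast
    then show ?thesis
      using 1[OF x r] 1[OF f_in[OF x]] r is_root_f[OF x] not_sim_both by blast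
  qed
  then show ?thesis using C by blast
qed

end

section \<open>Orbits on a well-ordered invariant set\<close>

locale orbits = perm_model M G F for M :: "'m zfa_structure" and G F +
  fixes P S L :: 'm
  assumes P_N: "P \<in> Univ N" and wo: "wo S P" and L: "L \<in> E F"
    and fix_P: "\<And>k. k \<in> E L \<Longrightarrow> act k P = P"
begin

lemma P_Univ: "P \<in> U"
  using P_N by (rule N_in_Univ)

lemma L_Univ: "L \<in> U"
  using L by (rule elems_Univ)

lemma P_tset: "x \<in> E P \<Longrightarrow> tset x"
  using tset_elem N_tset P_N by blast

lemma L_perm: "k \<in> E L \<Longrightarrow> perm k"
  using G_perm F_G[OF _ L] by blast

lemma act_P: "k \<in> E L \<Longrightarrow> x \<in> E P \<Longrightarrow> act k x \<in> E P"
  using act_elem_iff[OF F_G[OF _ L] N_tset[OF P_N] P_tset, of k x] fix_P by simp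

lemma L_maps: "k \<in> E L \<Longrightarrow> x \<in> E P \<Longrightarrow> ext_maps M k x y \<longleftrightarrow> y = act k x"
  using ext_maps_act[OF L_perm P_tset] by blast

text \<open>Orbits are not collected into a set. Each is represented by its \<open>S\<close>-least
  point, and the well-order of orbits is \<open>S\<close> on representatives.\<close>

definition is_rep :: "'m \<Rightarrow> 'm \<Rightarrow> bool" where
  "is_rep r x \<longleftrightarrow> (\<exists>k\<in>E L. ext_maps M k x r) \<and>
     (\<forall>k\<in>E L. \<forall>z\<in>U. ext_maps M k x z \<longrightarrow> related M S r z)"

lemma dfn_is_rep: "tm M s \<Longrightarrow> tm M t \<Longrightarrow> dfn M (\<lambda>v. is_rep (s v) (t v))"
proof (rule dfn2)
  show "dfn M (\<lambda>v. is_rep (v 0) (v 1))"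
    unfolding is_rep_def by (intro dfn_rules dfn_ext_maps L_Univ wo_Univ[OF wo])
qed

lemma is_rep_iff:
  "x \<in> E P \<Longrightarrow> is_rep r x \<longleftrightarrow> (\<exists>k\<in>E L. r = act k x) \<and> (\<forall>k\<in>E L. related M S r (act k x))"
  unfolding is_rep_def using L_maps elems_Univ[OF act_P] by simp

lemma ex_rep:
  assumes x: "x \<in> E P" shows "\<exists>r. is_rep r x"
proof -
  have "\<exists>T. isset M T \<and> E T = {z \<in> E P. \<exists>k\<in>E L. ext_maps M k x z}"
    by (intro separation dfn_rules dfn_ext_maps P_Univ L_Univ elems_Univ[OF x])
  then obtain T where T: "isset M T" "E T = {z \<in> E P. \<exists>k\<in>E L. ext_maps M k x z}" by blast
  have T_eq: "E T = (\<lambda>k. act k x) ` E L"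
    unfolding T(2) using L_maps[OF _ x] act_P[OF _ x] by auto
  obtain e where "e \<in> E L" using F_id[OF L] by blast
  then have "act e x \<in> E T" unfolding T_eq by blast
  moreover have "E T \<subseteq> E P" unfolding T(2) by blast
  ultimately obtain m where "m \<in> E T" "\<forall>t\<in>E T. related M S m t"
    using wo_least[OF wo isset_Univ[OF T(1)]] by metis
  then show ?thesis unfolding is_rep_iff[OF x] T_eq by auto
qed

definition rep :: "'m \<Rightarrow> 'm" where
  "rep x = (SOME r. is_rep r x)"

lemma is_rep_eq: "x \<in> E P \<Longrightarrow> is_rep r x \<longleftrightarrow> r = rep x"
proof -
  assume x: "x \<in> E P"
  have r: "is_rep (rep x) x" unfolding rep_def using ex_rep[OF x] by (rule someI_ex)
  show ?thesis
    using r wo_antisym[OF wo, of r "rep x"] is_rep_iff[OF x] by metis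
qed

lemma rep_in_orbit: "x \<in> E P \<Longrightarrow> \<exists>k\<in>E L. rep x = act k x"
  using is_rep_eq is_rep_iff by blast

lemma rep_in: "x \<in> E P \<Longrightarrow> rep x \<in> E P"
  using rep_in_orbit act_P by fastforce

lemma rep_act:
  assumes k: "k \<in> E L" and x: "x \<in> E P" shows "rep (act k x) = rep x"
proof -
  have kx: "act k x \<in> E P" using act_P[OF k x] .
  have "\<exists>m\<in>E L. act l (act k x) = act m x" if l: "l \<in> E L" for l
  proof -
    obtain m where "m \<in> E L" "act m x = act l (act k x)"
      using F_compose[OF L l k] P_tset[OF x] by metis
    then show ?thesis by metis
  qed
  moreover have "\<exists>m\<in>E L. act l x = act m (act k x)" if l: "l \<in> E L" for l
  proof -
    obtain k' where k': "k' \<in> E L" "act k' (act k x) = x"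
      using F_inverse[OF L k] P_tset[OF x] by metis
    obtain m where "m \<in> E L" "act m (act k x) = act l (act k' (act k x))"
      using F_compose[OF L l k'(1)] P_tset[OF kx] by metis
    then show ?thesis using k'(2) by metis
  qed
  ultimately have "is_rep r (act k x) \<longleftrightarrow> is_rep r x" for r
    unfolding is_rep_iff[OF kx] is_rep_iff[OF x] by metis
  then show ?thesis using is_rep_eq[OF x] is_rep_eq[OF kx] by blast
qed

lemma rep_back: "x \<in> E P \<Longrightarrow> \<exists>k\<in>E L. x = act k (rep x)"
proof -
  assume x: "x \<in> E P"
  obtain k where k: "k \<in> E L" "rep x = act k x" using rep_in_orbit[OF x] by blast
  obtain l where "l \<in> E L" "act l (act k x) = x" using F_inverse[OF L k(1)] P_tset[OF x] by metis
  then show ?thesis using k(2) by metis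
qed

lemma rep_eq_orbit:
  assumes "x \<in> E P" "y \<in> E P" "rep x = rep y" shows "\<exists>k\<in>E L. y = act k x"
proof -
  obtain k where k: "k \<in> E L" "rep x = act k x" using rep_in_orbit[OF assms(1)] by blast
  obtain l where l: "l \<in> E L" "y = act l (rep y)" using rep_back[OF assms(2)] by blast
  obtain m where "m \<in> E L" "act m x = act l (act k x)"
    using F_compose[OF L l(1) k(1)] P_tset[OF assms(1)] by metis
  then show ?thesis using k(2) l(2) assms(3) by metis
qed

text \<open>The representatives of points of \<open>T\<close> form a subset of \<open>P\<close>,
  although they need not lie in \<open>T\<close>; its \<open>S\<close>-least member is the
  representative of the required \<open>m\<close>.\<close>

lemma rep_least:
  assumes "T \<in> U" "E T \<subseteq> E P" "t \<in> E T"
  shows "\<exists>m\<in>E T. \<forall>t\<in>E T. related M S (rep m) (rep t)"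
proof -
  have "\<exists>Q. isset M Q \<and> E Q = {r \<in> E P. \<exists>x\<in>E T. is_rep r x}"
    by (intro separation dfn_rules dfn_is_rep P_Univ assms)
  then obtain Q where Q: "isset M Q" "E Q = {r \<in> E P. \<exists>x\<in>E T. is_rep r x}" by blast
  have Q_eq: "E Q = rep ` E T"
  proof -
    have "is_rep r x \<longleftrightarrow> r = rep x" "rep x \<in> E P" if "x \<in> E T" for r x
      using that assms(2) is_rep_eq rep_in by blast+
    then show ?thesis unfolding Q(2) image_def by auto
  qed
  have "\<exists>m\<in>E Q. \<forall>t\<in>E Q. related M S m t"
    by (rule wo_least[OF wo isset_Univ[OF Q(1)], of "rep t"]) (use assms(3) Q_eq Q(2) in auto)
  then show ?thesis unfolding Q_eq by auto
qed

end

section \<open>Orbits are antichains\<close>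

locale torsion_model = perm_model M G F for M :: "'m zfa_structure" and G F +
  assumes G_torsion: "\<And>g. g \<in> E G \<Longrightarrow> torsion g" and choice: "AC M"
begin

text \<open>\<open>torsion_antichain\<close> for the stabilizer of \<open>r\<close> in
  \<open>L\<close>. The parameter \<open>r\<close> is there for orders indexed by a family, which
  are preserved only by permutations fixing their index; for a single poset \<open>r\<close> is the
  poset itself.\<close>

lemma poset_antichain:
  assumes R: "poset M P R" "tset P" "tset R" and L: "L \<in> E F" and r: "tset r"
    and fix_r: "\<And>k. k \<in> E L \<Longrightarrow> act k r = r \<Longrightarrow> act k R = R"
    and k: "k \<in> E L" "act k r = r" and x: "related M R x (act k x)"
  shows "act k x = x"
proof -
  have "\<exists>K. isset M K \<and> E K = {k \<in> E L. ext_maps M k r r}"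
    by (intro separation dfn_rules dfn_ext_maps elems_Univ[OF L] tset_Univ[OF r])
  then obtain K where K: "isset M K" "E K = {k \<in> E L. ext_maps M k r r}" by blast
  have K_iff: "k \<in> E K \<longleftrightarrow> k \<in> E L \<and> act k r = r" for k
    using ext_maps_act[OF G_perm[OF F_G[OF _ L]] r, of k r] unfolding K(2) by auto
  show ?thesis
  proof (rule torsion_antichain)
    show "torsion k" using G_torsion F_G[OF k(1) L] .
    show "K \<in> U" using K(1) by (rule isset_Univ)
    show "E K \<subseteq> E G" using F_G[OF _ L] unfolding subset_iff K_iff by blast
    show "k \<in> E K" using k K_iff by blast
    show "m \<in> E K" if m: "k \<in> E K" "l \<in> E K" "m \<in> E G" "is_comp M m k l" for k l m
    proof -
      have "act m r = act k (act l r)"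
        using m F_G[OF _ L] K_iff by (intro act_comp[OF _ _ _ m(4) r] G_perm) auto
      then show ?thesis using m F_comp[OF L _ _ m(3,4)] K_iff by simp
    qed
    show "R \<in> U" using R(3) by (rule tset_Univ)
    show "related M R z z" if "related M R y z" for y z
      using poset_relatedD(2)[OF R(1) that] R(1) unfolding poset_def by blast
    show "related M R x z" if "related M R x y" "related M R y z" for x y z
      using that R(1) unfolding poset_def by blast
    show "y = z" if "related M R y z" "related M R z y" for y z
      using that R(1) unfolding poset_def by blast
    show "related M R (act k y) (act k z)" if "k \<in> E K" "related M R y z" for k y z
      using act_related[OF F_G[OF _ L] R(3) that(2), of k] fix_r that(1) K_iff by auto
    show "tset x" using poset_relatedD(1)[OF R(1) x] tset_elem R(2) by blast
  qed (rule x)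
qed

text \<open>Linearity makes \<open>x\<close> and \<open>k x\<close> comparable. If x \<le> k x, the
  antichain property applies to \<open>k\<close>; otherwise applying the inverse \<open>l\<close>
  gives x \<le> l x, and it applies to \<open>l\<close>.\<close>

lemma linear_order_fixed:
  assumes R: "linear_order M X R" "tset X" "tset R" and L: "L \<in> E F" and r: "tset r"
    and fix_r: "\<And>k. k \<in> E L \<Longrightarrow> act k r = r \<Longrightarrow> act k X = X \<and> act k R = R"
    and k: "k \<in> E L" "act k r = r" and x: "x \<in> E X"
  shows "act k x = x"
proof -
  have tx: "tset x" using tset_elem[OF R(2) x] .
  have po: "poset M X R" using R(1) by (simp add: linear_order_def)
  note anti = poset_antichain[OF po R(2,3) L r, rotated]
  have kx: "act k x \<in> E X"
    using act_elem_iff[OF F_G[OF k(1) L] R(2) tx] fix_r[OF k] x by simp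
  have "related M R x (act k x) \<or> related M R (act k x) x"
    using R(1) x kx unfolding linear_order_def by blast
  then show ?thesis
  proof
    assume "related M R x (act k x)"
    then show ?thesis by (rule anti[OF k]) (use fix_r in blast)
  next
    assume le: "related M R (act k x) x"
    obtain l where l: "l \<in> E L" "\<And>x. tset x \<Longrightarrow> act l (act k x) = x"
      "\<And>x. tset x \<Longrightarrow> act k (act l x) = x" using F_inverse[OF L k(1)] by metis
    have lr: "act l r = r" using l(2)[OF r] k(2) by simp
    have "related M R (act l (act k x)) (act l x)"
      using act_related[OF F_G[OF l(1) L] R(3) le] fix_r[OF l(1) lr] by simp
    then have "related M R x (act l x)" using l(2)[OF tx] by simp
    then have "act l x = x" by (rule anti[OF l(1) lr]) (use fix_r in blast)
    then show ?thesis using l(3)[OF tx] by simp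
  qed
qed

end

section \<open>Cofinal subsets of posets\<close>

locale poset_orbits = torsion_model M G F + orbits M G F P S L
  for M :: "'m zfa_structure" and G F P S L +
  fixes R :: 'm
  assumes po: "poset M P R" and R_N: "R \<in> Univ N" and fix_R: "\<And>k. k \<in> E L \<Longrightarrow> act k R = R"
begin

lemma R_Univ: "R \<in> U"
  using R_N by (rule N_in_Univ)

lemma R_in: "related M R x y \<Longrightarrow> x \<in> E P" "related M R x y \<Longrightarrow> y \<in> E P"
  using poset_relatedD[OF po] by auto

lemma R_refl: "x \<in> E P \<Longrightarrow> related M R x x"
  using po unfolding poset_def by blast

lemma R_trans: "related M R x y \<Longrightarrow> related M R y z \<Longrightarrow> related M R x z"
  using po unfolding poset_def by blast

lemma R_antisym: "related M R x y \<Longrightarrow> related M R y x \<Longrightarrow> x = y"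
  using po unfolding poset_def by blast

lemma R_act: "k \<in> E L \<Longrightarrow> related M R x y \<Longrightarrow> related M R (act k x) (act k y)"
  using act_related[OF F_G[OF _ L] N_tset[OF R_N], of k x y] fix_R by simp

lemma antichain:
  assumes "k \<in> E L" "related M R x (act k x)" shows "act k x = x"
  by (rule poset_antichain[OF po N_tset[OF P_N] N_tset[OF R_N] L N_tset[OF P_N]])
    (use assms fix_R fix_P in auto)

lemma cofinal_well_founded:
  "\<exists>W. cofinal_subset N W P R \<and> well_founded_subset N W P R"
proof -
  have "\<exists>W. isset M W \<and> E W = {x \<in> E P. \<forall>y\<in>E P. \<forall>r\<in>E P. \<forall>s\<in>E P.
      is_rep r y \<and> is_rep s x \<and> related M S r s \<and> r \<noteq> s \<longrightarrow> \<not> related M R x y}"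
    by (intro separation dfn_rules dfn_is_rep P_Univ R_Univ wo_Univ[OF wo])
  then obtain W where W: "isset M W" "E W = {x \<in> E P. \<forall>y\<in>E P. \<forall>r\<in>E P. \<forall>s\<in>E P.
      is_rep r y \<and> is_rep s x \<and> related M S r s \<and> r \<noteq> s \<longrightarrow> \<not> related M R x y}" by blast
  have W_iff: "x \<in> E W \<longleftrightarrow> x \<in> E P \<and>
      (\<forall>y. related M R x y \<and> related M S (rep y) (rep x) \<longrightarrow> rep y = rep x)" for x
    unfolding W(2) using is_rep_eq rep_in R_in by auto
  have WN: "W \<in> Univ N"
  proof (rule N_subset[OF P_N W(1) _ L])
    \<comment> \<open>The inverse of \<open>k\<close> moves a point above \<open>k x\<close> to a
      point above \<open>x\<close> without changing its orbit.\<close>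
    show "act k x \<in> E W" if k: "k \<in> E L" and x: "x \<in> E W" for k x
    proof -
      have xP: "x \<in> E P" using x W_iff by blast
      obtain l where l: "l \<in> E L" "act l (act k x) = x"
        using F_inverse[OF L k] P_tset[OF xP] by metis
      have "rep y = rep (act k x)"
        if y: "related M R (act k x) y" "related M S (rep y) (rep (act k x))" for y
      proof -
        have "related M R x (act l y)" using R_act[OF l(1) y(1)] l(2) by simp
        then show ?thesis
          using x y(2) rep_act[OF k xP] rep_act[OF l(1) R_in(2)[OF y(1)]] W_iff by metis
      qed
      then show ?thesis using act_P[OF k xP] W_iff by blast
    qed
  qed (auto simp: W_iff)
  \<comment> \<open>Among the points above \<open>x\<close>, one in the earliest orbit is in
    \<open>W\<close>: by transitivity, whatever lies above it lies above \<open>x\<close>.\<close>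
  have "\<exists>c\<in>E W. related M R x c" if x: "x \<in> E P" for x
  proof -
    have "\<exists>T. isset M T \<and> E T = {y \<in> E P. related M R x y}"
      by (intro separation dfn_rules P_Univ R_Univ elems_Univ[OF x])
    then obtain T where T: "isset M T" "E T = {y \<in> E P. related M R x y}" by blast
    have "x \<in> E T" using x R_refl T(2) by simp
    moreover have "E T \<subseteq> E P" unfolding T(2) by blast
    ultimately obtain m where m: "m \<in> E T" "\<And>t. t \<in> E T \<Longrightarrow> related M S (rep m) (rep t)"
      using rep_least[OF isset_Univ[OF T(1)]] by metis
    have "rep y = rep m" if y: "related M R m y" "related M S (rep y) (rep m)" for y
    proof -
      have "y \<in> E T" using m(1) y(1) R_trans R_in(2) unfolding T(2) by blast
      then show ?thesis using wo_antisym[OF wo y(2)] m(2) by blast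
    qed
    then have "m \<in> E W" using m(1) W_iff T(2) by blast
    then show ?thesis using m(1) T(2) by blast
  qed
  then have 1: "cofinal_subset N W P R"
    unfolding cofinal_subset_def N_isset[OF WN] N_elems[OF WN] N_elems[OF P_N] related_N[OF R_N]
    using W(1) W_iff by blast
  \<comment> \<open>A point of \<open>T\<close> in the earliest orbit is minimal: if x \<le> m with
    \<open>x\<close> in \<open>W\<close>, the orbit of \<open>m\<close> cannot precede that of
    \<open>x\<close>, so the orbits coincide, and orbits are antichains.\<close>
  have min: "\<exists>m. is_minimal N T R m" if T: "isset N T" "E T \<subseteq> E W" "E T \<noteq> {}" for T
  proof -
    have TN: "T \<in> Univ N" using T(1) by (rule N_issetD)
    obtain t where "t \<in> E T" using T(3) by blast
    then obtain m where m: "m \<in> E T" "\<And>t. t \<in> E T \<Longrightarrow> related M S (rep m) (rep t)"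
      using rep_least[OF N_in_Univ[OF TN]] T(2) W_iff by blast
    have "x = m" if x: "x \<in> E T" "related M R x m" for x
    proof -
      have "rep m = rep x" using x T(2) m(2)[OF x(1)] W_iff by blast
      then obtain k where k: "k \<in> E L" "m = act k x"
        using rep_eq_orbit[of x m] R_in[OF x(2)] by metis
      then show ?thesis using antichain[OF k(1), of x] x(2) by metis
    qed
    then show ?thesis
      using m(1) unfolding is_minimal_def N_elems[OF TN] related_N[OF R_N] by blast
  qed
  have "\<exists>m. is_minimal N T R m" if "isset N T \<and> elems N T \<subseteq> E W \<and> elems N T \<noteq> {}" for T
    using that min[of T] N_elems[OF N_issetD, of T] by metis
  then have 2: "well_founded_subset N W P R"
    unfolding well_founded_subset_def N_isset[OF WN] N_elems[OF WN] N_elems[OF P_N]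
    using W(1) W_iff by blast
  show ?thesis using 1 2 by blast
qed

text \<open>The strict order on orbits, lifted to points: \<open>x\<close> is strictly below some
  point of the orbit of \<open>y\<close>. It is irreflexive because orbits are antichains.\<close>

definition less_orbit :: "'m \<Rightarrow> 'm \<Rightarrow> bool" where
  "less_orbit x y \<longleftrightarrow> (\<exists>k\<in>E L. \<exists>z\<in>U. ext_maps M k y z \<and> related M R x z \<and> x \<noteq> z)"

lemma less_orbit_iff:
  "y \<in> E P \<Longrightarrow> less_orbit x y \<longleftrightarrow> (\<exists>k\<in>E L. related M R x (act k y) \<and> x \<noteq> act k y)"
  unfolding less_orbit_def using L_maps elems_Univ[OF act_P] by auto

text \<open>The value is a representative, which need not lie above \<open>x\<close>; only some
  translate of it does. This is why the map increases for \<open>less_orbit\<close> and not for the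
  order itself.\<close>

definition is_next :: "'m \<Rightarrow> 'm \<Rightarrow> bool" where
  "is_next x r \<longleftrightarrow> (\<exists>z\<in>E P. related M R x z \<and> x \<noteq> z \<and> is_rep r z) \<and>
     (\<forall>z\<in>E P. \<forall>s\<in>E P. related M R x z \<and> x \<noteq> z \<and> is_rep s z \<longrightarrow> related M S r s)"

lemma is_next_iff: "is_next x r \<longleftrightarrow> (\<exists>z. related M R x z \<and> x \<noteq> z \<and> r = rep z) \<and>
     (\<forall>z. related M R x z \<and> x \<noteq> z \<longrightarrow> related M S r (rep z))"
  unfolding is_next_def using is_rep_eq rep_in R_in by metis

lemma is_next_unique: "is_next x r \<Longrightarrow> is_next x s \<Longrightarrow> r = s"
  unfolding is_next_iff using wo_antisym[OF wo, of r s] by blast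

lemma disjoint_cofinal:
  assumes "\<nexists>m. is_maximal N P R m"
  shows "\<exists>C D. cofinal_subset N C P R \<and> cofinal_subset N D P R \<and> elems N C \<inter> elems N D = {}"
proof -
  have above: "\<exists>z. related M R x z \<and> x \<noteq> z" if x: "x \<in> E P" for x
    using assms x unfolding is_maximal_def N_elems[OF P_N] related_N[OF R_N] by blast
  have ex: "\<exists>r. is_next x r" if x: "x \<in> E P" for x
  proof -
    have "\<exists>T. isset M T \<and> E T = {z \<in> E P. related M R x z \<and> x \<noteq> z}"
      by (intro separation dfn_rules P_Univ R_Univ elems_Univ[OF x])
    then obtain T where T: "isset M T" "E T = {z \<in> E P. related M R x z \<and> x \<noteq> z}" by blast
    have T_iff: "z \<in> E T \<longleftrightarrow> related M R x z \<and> x \<noteq> z" for z using R_in unfolding T(2) by blast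
    obtain t where "t \<in> E T" using above[OF x] T_iff by blast
    moreover have "E T \<subseteq> E P" unfolding T(2) by blast
    ultimately obtain m where "m \<in> E T" "\<And>t. t \<in> E T \<Longrightarrow> related M S (rep m) (rep t)"
      using rep_least[OF isset_Univ[OF T(1)]] by metis
    then show ?thesis unfolding is_next_iff using T_iff by blast
  qed
  define f where "f x = (SOME r. is_next x r)" for x
  have f: "is_next x r \<longleftrightarrow> r = f x" if "x \<in> E P" for x r
    using someI_ex[OF ex[OF that]] is_next_unique unfolding f_def by blast
  have f_above: "\<exists>k\<in>E L. related M R x (act k (f x)) \<and> x \<noteq> act k (f x)" if x: "x \<in> E P" for x
  proof -
    obtain z where z: "related M R x z" "x \<noteq> z" "f x = rep z"
      using f[OF x, of "f x"] is_next_iff by auto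
    then show ?thesis using rep_back[OF R_in(2)[OF z(1)]] by metis
  qed
  have f_in: "f x \<in> E P" if x: "x \<in> E P" for x
  proof -
    obtain z where z: "related M R x z" "f x = rep z"
      using f[OF x, of "f x"] is_next_iff by auto
    then show ?thesis using rep_in[OF R_in(2)[OF z(1)]] by simp
  qed
  interpret increasing_function M P S is_next less_orbit f
  proof
    show "dfn M (\<lambda>v. is_next (v 0) (v 1))"
      unfolding is_next_def by (intro dfn_rules dfn_is_rep P_Univ R_Univ wo_Univ[OF wo])
    show "dfn M (\<lambda>v. less_orbit (v 0) (v 1))"
      unfolding less_orbit_def by (intro dfn_rules dfn_ext_maps L_Univ R_Univ)
    show "\<not> less_orbit x x" if "x \<in> E P" for x
      using that antichain less_orbit_iff by metis
    show "less_orbit x z" if xyz: "x \<in> E P" "y \<in> E P" "z \<in> E P" "less_orbit x y" "less_orbit y z" for x y z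
    proof -
      obtain k l where k: "k \<in> E L" "related M R x (act k y)" "x \<noteq> act k y"
        and l: "l \<in> E L" "related M R y (act l z)" using xyz less_orbit_iff by metis
      obtain m where m: "m \<in> E L" "act m z = act k (act l z)"
        using F_compose[OF L k(1) l(1)] P_tset[OF xyz(3)] by metis
      have "related M R (act k y) (act m z)" using R_act[OF k(1) l(2)] m(2) by simp
      then have "related M R x (act m z)" "x \<noteq> act m z"
        using R_trans[OF k(2)] R_antisym[OF k(2)] k(3) by auto
      then show ?thesis using m(1) less_orbit_iff[OF xyz(3)] by blast
    qed
    show "less_orbit x (f x)" if "x \<in> E P" for x
      using f_above[OF that] less_orbit_iff[OF f_in[OF that]] by blast
  qed (use wo P_Univ f f_in in auto)
  obtain C where C: "isset M C" "E C \<subseteq> E P" "\<And>x. x \<in> E P \<Longrightarrow> x \<in> E C \<longleftrightarrow> f x \<notin> E C"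
    using two_colouring by blast
  \<comment> \<open>The points strictly above \<open>k x\<close> are the translates by
    \<open>k\<close> of those strictly above \<open>x\<close>, so they meet the same orbits.\<close>
  have f_act: "f (act k x) = f x" if k: "k \<in> E L" and x: "x \<in> E P" for k x
  proof -
    obtain l where l: "l \<in> E L" "\<And>x. tset x \<Longrightarrow> act l (act k x) = x"
      "\<And>x. tset x \<Longrightarrow> act k (act l x) = x" using F_inverse[OF L k] by metis
    have 1: "related M R (act k x) (act k z) \<and> act k x \<noteq> act k z \<and> rep (act k z) = rep z"
      if "related M R x z" "x \<noteq> z" for z
      using that R_act[OF k that(1)] act_inject[OF F_G[OF k L]] P_tset R_in[OF that(1)] rep_act[OF k]
      by blast
    have 2: "related M R x (act l z) \<and> x \<noteq> act l z \<and> rep (act l z) = rep z"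
      if z: "related M R (act k x) z" "act k x \<noteq> z" for z
      using z R_act[OF l(1) z(1)] l(2)[OF P_tset[OF x]] l(3)[OF P_tset[OF R_in(2)[OF z(1)]]]
        rep_act[OF l(1) R_in(2)[OF z(1)]] by auto
    have "is_next (act k x) r" if "is_next x r" for r
      using that 1 2 unfolding is_next_iff by metis
    then have "is_next (act k x) (f x)" using f[OF x, of "f x"] by simp
    then show ?thesis using f[OF act_P[OF k x], of "f x"] by simp
  qed
  \<comment> \<open>The colour of a point is opposite to that of its image under \<open>f\<close>,
    and this image is constant on orbits; so the colour classes are unions of orbits.\<close>
  have C_act: "act k x \<in> E C \<longleftrightarrow> x \<in> E C" if "k \<in> E L" "x \<in> E P" for k x
    using C(3)[OF that(2)] C(3)[OF act_P[OF that]] f_act[OF that] by simp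
  have "\<exists>D. isset M D \<and> E D = {x \<in> E P. x \<notin> E C}"
    by (intro separation dfn_rules P_Univ isset_Univ[OF C(1)])
  then obtain D where D: "isset M D" "E D = {x \<in> E P. x \<notin> E C}" by blast
  have CN: "C \<in> Univ N"
    by (rule N_subset[OF P_N C(1,2) L]) (use C(2) C_act in blast)
  have DN: "D \<in> Univ N"
    by (rule N_subset[OF P_N D(1) _ L]) (use D(2) C_act act_P in auto)
  \<comment> \<open>A translate of \<open>f x\<close> lies above \<open>x\<close>, and by invariance
    it has the colour of \<open>f x\<close>. Together with reflexivity this makes both classes
    cofinal.\<close>
  have up: "\<exists>y. related M R x y \<and> y \<in> E P \<and> (y \<in> E C \<longleftrightarrow> x \<notin> E C)" if x: "x \<in> E P" for x
  proof -
    obtain k where k: "k \<in> E L" "related M R x (act k (f x))" using f_above[OF x] by blast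
    then show ?thesis using C_act[OF k(1) f_in[OF x]] C(3)[OF x] R_in(2) by blast
  qed
  have "\<exists>c\<in>E C. related M R x c" "\<exists>d\<in>E D. related M R x d" if x: "x \<in> E P" for x
    unfolding D(2) using up[OF x] R_refl[OF x] x by blast+
  then have "cofinal_subset N C P R \<and> cofinal_subset N D P R"
    unfolding cofinal_subset_def N_isset[OF CN] N_isset[OF DN] N_elems[OF CN] N_elems[OF DN]
      N_elems[OF P_N] related_N[OF R_N]
    using C(1,2) D(1) by (auto simp: D(2))
  moreover have "elems N C \<inter> elems N D = {}"
    unfolding N_elems[OF CN] N_elems[OF DN] D(2) by blast
  ultimately show ?thesis by blast
qed

end

section \<open>The choice principles\<close>

context torsion_model
begin

lemma poset_orbits_exist:
  assumes "poset N P R"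
  shows "\<exists>S L. poset_orbits M G F P S L R"
proof -
  have PR: "P \<in> Univ N" "R \<in> Univ N" using poset_in_N[OF assms] by auto
  then have po: "poset M P R" using assms poset_N by blast
  obtain L where L: "L \<in> E F" "\<And>k. k \<in> E L \<Longrightarrow> act k P = P" "\<And>k. k \<in> E L \<Longrightarrow> act k R = R"
    using stabilizer2[OF PR] by metis
  have "isset M P" using po by (simp add: poset_def)
  then obtain S where S: "wo S P" using well_ordering[OF choice] by blast
  have "poset_orbits M G F P S L R"
    by unfold_locales (fact PR po L S)+
  then show ?thesis by blast
qed

lemma CWF_N: "CWF N"
  unfolding CWF_def using poset_orbits_exist poset_orbits.cofinal_well_founded[of M G F] by meson

lemma CS_N: "CS N"
  unfolding CS_def using poset_orbits_exist poset_orbits.disjoint_cofinal[of M G F] by meson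

lemma LW_N: "LW N"
  unfolding LW_def
proof (intro allI impI)
  fix X R assume R: "linear_order N X R"
  then have XR: "X \<in> Univ N" "R \<in> Univ N" using poset_in_N unfolding linear_order_def by auto
  have lin: "linear_order M X R" using R linear_order_N[OF XR] by blast
  obtain L where L: "L \<in> E F" "\<And>k. k \<in> E L \<Longrightarrow> act k X = X" "\<And>k. k \<in> E L \<Longrightarrow> act k R = R"
    using stabilizer2[OF XR] by metis
  \<comment> \<open>With \<open>X\<close> as the fixed object \<open>r\<close> of
    \<open>linear_order_fixed\<close>, the stabilizer of \<open>r\<close> in \<open>L\<close> is all
    of \<open>L\<close>.\<close>
  have fixed: "act k x = x" if "k \<in> E L" "x \<in> E X" for k x
    by (rule linear_order_fixed[OF lin N_tset[OF XR(1)] N_tset[OF XR(2)] L(1) N_tset[OF XR(1)]])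
      (use L that in auto)
  have "isset M X" using lin by (simp add: linear_order_def poset_def)
  then obtain S where S: "wo S X" using well_ordering[OF choice] by blast
  have Sp: "isset M S" "\<And>p. p \<in> E S \<Longrightarrow> \<exists>x\<in>E X. \<exists>y\<in>E X. is_pair M p x y"
    using S[unfolded wo_def, THEN conjunct1] unfolding is_rel_def by auto
  obtain t where t: "is_transitive M t" "X \<in> E t" using N_tset[OF XR(1)] unfolding tset_def by blast
  have SN: "S \<in> Univ N"
  proof (rule N_rel[OF t(1) Sp(1) L(1)])
    show "\<exists>x\<in>E t \<inter> Univ N. \<exists>y\<in>E t \<inter> Univ N. is_pair M p x y" if "p \<in> E S" for p
      using Sp(2)[OF that] transitiveD[OF t] N_trans[OF XR(1)] by blast
    show "related M S (act k x) (act k y)" if "k \<in> E L" "related M S x y" for k x y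
      using that fixed wo_field[OF S that(2)] by simp
  qed
  have "poset M X S"
    unfolding poset_def
  proof (intro conjI allI impI ballI; (elim conjE)?)
    show "x = y" if "related M S x y" "related M S y x" for x y using wo_antisym[OF S that] .
    show "related M S x z" if "related M S x y" "related M S y z" for x y z
      using wo_trans[OF S that] .
  qed (use \<open>isset M X\<close> Sp wo_refl[OF S] in auto)
  then have "linear_order M X S" unfolding linear_order_def using wo_linear[OF S] by blast
  then have linS: "linear_order N X S" unfolding linear_order_N[OF XR(1) SN] .
  \<comment> \<open>Subsets of \<open>X\<close> in \<open>N\<close> are also sets of the ground
    structure, where \<open>S\<close> gives a least element; by antisymmetry it is minimal.\<close>
  have min: "\<exists>m. is_minimal N T S m" if T: "isset N T" "E T \<subseteq> E X" "E T \<noteq> {}" for T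
  proof -
    have TN: "T \<in> Univ N" using T(1) by (rule N_issetD)
    obtain m where m: "m \<in> E T" "\<forall>t\<in>E T. related M S m t"
      using T(2,3) wo_least[OF S N_in_Univ[OF TN]] by blast
    then have "is_minimal N T S m"
      unfolding is_minimal_def N_elems[OF TN] related_N[OF SN] using wo_antisym[OF S] by blast
    then show ?thesis by blast
  qed
  have "\<exists>m. is_minimal N T S m" if "isset N T \<and> elems N T \<subseteq> E X \<and> elems N T \<noteq> {}" for T
    using that min[of T] N_elems[OF N_issetD, of T] by metis
  moreover have "isset N X" using R unfolding linear_order_def poset_def by blast
  ultimately have "well_founded_subset N X X S"
    unfolding well_founded_subset_def N_elems[OF XR(1)] by blast
  then show "\<exists>S. well_order N X S" using linS unfolding well_order_def by blast
qed

section \<open>Choice from families of linear orders\<close>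

lemma empty_N: "\<exists>z\<in>Univ N. is_empty N z"
proof -
  obtain z where z: "isset M z" "E z = {}" using ex_empty by blast
  have "is_transitive M z" using z unfolding is_transitive_def by simp
  then have "tset z" using tset_subset z by blast
  then have "z \<in> Univ N"
    using N_closed[OF z(1) _ _ G_in_F] invariant_fixed[OF G_in_F z(1)] z(2) by auto
  moreover have "represents M z {}" using z by (simp add: represents_def)
  ultimately show ?thesis unfolding is_empty_def represents_N by blast
qed

text \<open>The empty set is a natural number of \<open>N\<close>, so the pair coding the integer 0
  is there, and the isomorphism gives it a preimage in \<open>X\<close>.\<close>

lemma iso_to_int_nonempty:
  assumes "iso_to_int N X R" "X \<in> Univ N"
  shows "E X \<noteq> {}"
proof -
  obtain Z f where Z: "elems N Z = {x. \<exists>n. nonneg_int N x n \<or> neg_int N x n}" and f: "is_bij N f X Z"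
    using assms(1) unfolding iso_to_int_def is_int_order_def order_iso_def represents_def by blast
  obtain z where z: "z \<in> Univ N" "is_empty N z" using empty_N by blast
  have "is_nat N z"
  proof -
    have "z \<in> elems N I" if "is_inductive N I" for I
    proof -
      obtain z' where "z' \<in> elems N I" "is_empty N z'" using \<open>is_inductive N I\<close>
        unfolding is_inductive_def by blast
      moreover have "z' = z"
        using is_empty_unique[of z' z] z(2) calculation(2) unfolding is_empty_def represents_N by blast
      ultimately show ?thesis by simp
    qed
    then show ?thesis using z(1) unfolding is_nat_def by blast
  qed
  moreover obtain p where p: "is_pair M p z z" using ex_pair N_in_Univ[OF z(1)] by blast
  ultimately have "nonneg_int N p z"
    using z N_pair[OF z(1) z(1) p] unfolding nonneg_int_def is_pair_N by blast
  then have "p \<in> elems N Z" unfolding Z by blast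
  then obtain x where x: "related N f x p" using f unfolding is_bij_def by blast
  have "f \<in> Univ N" using f N_issetD unfolding is_bij_def is_fun_def by blast
  then have "is_fun M f X" "related M f x p"
    using f x is_fun_N[OF _ assms(2)] related_N unfolding is_bij_def by blast+
  then show ?thesis using fun_domain by blast
qed

lemma pair_transitive:
  assumes "is_transitive M t" "p \<in> E t" "is_pair M p x y"
  shows "x \<in> E t" "y \<in> E t"
proof -
  obtain u v where uv: "represents M v {x, y}" "represents M p {u, v}"
    using assms(3) unfolding is_pair_def by blast
  then have "v \<in> E t" using transitiveD[OF assms(1,2)] unfolding represents_def by auto
  then show "x \<in> E t" "y \<in> E t"
    using transitiveD[OF assms(1)] uv(1) unfolding represents_def by blast+
qed

text \<open>
  Choose a point \<open>s\<close> over a representative \<open>r\<close> of each orbit of indices, and let \<open>k s\<close> be the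
  value at \<open>k r\<close>. This is well defined since a permutation fixing \<open>r\<close> acts on a linear order and
  hence fixes each of its points.
\<close>

lemma vDCP_N: "vDCP N"
  unfolding vDCP_def
proof (intro allI impI, elim conjE)
  fix I B
  assume I: "isset N I" and B: "is_fun N B I"
    and fam: "\<forall>i q. related N B i q \<longrightarrow>
      (\<exists>X R. is_pair N q X R \<and> linear_order N X R \<and> iso_to_int N X R)"
  have IN: "I \<in> Univ N" using I by (rule N_issetD)
  have BN: "B \<in> Univ N" using B N_issetD unfolding is_fun_def by blast
  have Bf: "is_fun M B I" using B is_fun_N[OF BN IN] by blast
  have BU: "B \<in> U" and IU: "I \<in> U" using BN IN N_in_Univ by auto
  obtain L where L: "L \<in> E F" "\<And>k. k \<in> E L \<Longrightarrow> act k I = I" "\<And>k. k \<in> E L \<Longrightarrow> act k B = B"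
    using stabilizer2[OF IN BN] by metis
  have LU: "L \<in> U" using L(1) by (rule elems_Univ)
  have LG: "k \<in> E G" if "k \<in> E L" for k using F_G[OF that L(1)] .
  have B_act: "related M B (act k i) (act k q)" if "k \<in> E L" "related M B i q" for k i q
    using act_related[OF LG[OF that(1)] N_tset[OF BN] that(2)] L(3)[OF that(1)] by simp
  have fam': "\<exists>X R. is_pair M q X R \<and> X \<in> Univ N \<and> R \<in> Univ N \<and> linear_order M X R \<and> E X \<noteq> {}"
    if q: "related M B i q" for i q
  proof -
    obtain X R where XR: "is_pair N q X R" "linear_order N X R" "iso_to_int N X R"
      using fam q unfolding related_N[OF BN] by blast
    have N: "X \<in> Univ N" "R \<in> Univ N" using poset_in_N XR(2) unfolding linear_order_def by auto
    show ?thesis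
      using XR(1,2) N linear_order_N[OF N] iso_to_int_nonempty[OF XR(3) N(1)]
      unfolding is_pair_N by blast
  qed
  obtain t1 t2 where "is_transitive M t1" "I \<in> E t1" "is_transitive M t2" "B \<in> E t2"
    using N_tset[OF IN] N_tset[OF BN] unfolding tset_def by blast
  then obtain t where t: "is_transitive M t" "I \<in> E t" "B \<in> E t"
    using transitive_Un[of t1 t2] by auto
  have tU: "t \<in> U" using t(1) by (rule transitive_Univ)
  \<comment> \<open>The relation that \<open>x\<close> lies in the ordered set with index
    \<open>i\<close>, written with bounded quantifiers for definability.\<close>
  define pt where "pt i x \<longleftrightarrow> (\<exists>q\<in>U. \<exists>X\<in>U. \<exists>R\<in>U. related M B i q \<and> is_pair M q X R \<and> x \<in> E X)" for i x
  have dfn_pt: "dfn M (\<lambda>v. pt (a v) (b v))" if "tm M a" "tm M b" for a b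
  proof (rule dfn2[OF _ that])
    show "dfn M (\<lambda>v. pt (v 0) (v 1))" unfolding pt_def by (intro dfn_rules BU)
  qed
  have pt_iff: "pt i x \<longleftrightarrow> (\<exists>q X R. related M B i q \<and> is_pair M q X R \<and> x \<in> E X)" for i x
    unfolding pt_def using is_pair_Univ[of M] by metis
  have pt_in: "x \<in> E t \<and> x \<in> Univ N" if x: "pt i x" for i x
  proof -
    obtain q X R where q: "related M B i q" "is_pair M q X R" "x \<in> E X" using x pt_iff by blast
    obtain p where p: "p \<in> E B" "is_pair M p i q" using q(1) unfolding related_def by blast
    have "q \<in> E t" using pair_transitive(2)[OF t(1) transitiveD[OF t(1,3) p(1)] p(2)] .
    then have "X \<in> E t" using pair_transitive(1)[OF t(1) _ q(2)] by blast
    moreover have "X \<in> Univ N" using fam'[OF q(1)] is_pair_inject[OF q(2)] by blast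
    ultimately show ?thesis using q(3) transitiveD[OF t(1)] N_trans by blast
  qed
  have pt_act: "pt (act k i) (act k x)" if k: "k \<in> E L" and x: "pt i x" for k i x
  proof -
    obtain q X R where q: "related M B i q" "is_pair M q X R" "x \<in> E X" using x pt_iff by blast
    have "tset q" "tset X"
      using N_tset related_in_N(2)[OF BN q(1)] fam'[OF q(1)] is_pair_inject[OF q(2)] by blast+
    then have "is_pair M (act k q) (act k X) (act k R)" "act k x \<in> E (act k X)"
      using act_pair[OF LG[OF k] _ q(2)] act_elem_iff[OF LG[OF k], of X x] tset_elem q(3) by auto
    then show ?thesis using B_act[OF k q(1)] pt_iff by blast
  qed
  have pt_fixed: "act k x = x" if k: "k \<in> E L" "act k i = i" and x: "pt i x" for k i x
  proof -
    obtain q X R where q: "related M B i q" "is_pair M q X R" "x \<in> E X" using x pt_iff by blast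
    have XR: "X \<in> Univ N" "R \<in> Univ N" "linear_order M X R"
      using fam'[OF q(1)] is_pair_inject[OF q(2)] by blast+
    have ti: "tset i" "tset q" using N_tset related_in_N[OF BN q(1)] by auto
    \<comment> \<open>The function \<open>B\<close> is fixed by \<open>l\<close>, so if
      \<open>l\<close> fixes the index it fixes the value there, and with it both
      components.\<close>
    have "act l X = X \<and> act l R = R" if l: "l \<in> E L" "act l i = i" for l
    proof -
      have "related M B i (act l q)" using B_act[OF l(1) q(1)] l(2) by simp
      then have "act l q = q" using fun_unique[OF Bf _ q(1)] by blast
      then have "is_pair M q (act l X) (act l R)" using act_pair[OF LG[OF l(1)] ti(2) q(2)] by simp
      then show ?thesis using is_pair_inject[OF q(2), of "act l X" "act l R"] by simp
    qed
    with XR(3) N_tset[OF XR(1)] N_tset[OF XR(2)] L(1) ti(1) show ?thesis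
      using k q(3) by (rule linear_order_fixed)
  qed
  have pt_ex: "\<exists>x. pt i x" if i: "i \<in> E I" for i
  proof -
    obtain q where "related M B i q" using fun_total[OF Bf i] by blast
    then show ?thesis using fam' pt_iff by blast
  qed
  have "isset M I" using I N_isset[OF IN] by blast
  then obtain S where S: "wo S I" using well_ordering[OF choice] by blast
  have "isset M t" using t(1) by (simp add: is_transitive_def)
  then obtain S' where S': "wo S' t" using well_ordering[OF choice] by blast
  interpret orb: orbits M G F I S L
    by unfold_locales (fact IN S L)+
  \<comment> \<open>All points of the family lie in \<open>t\<close>, so one well-order
    \<open>S'\<close> of \<open>t\<close> makes the choice over every index definable.\<close>
  define first where "first i x \<longleftrightarrow> pt i x \<and> (\<forall>y\<in>U. pt i y \<longrightarrow> related M S' x y)" for i x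
  have first_ex: "\<exists>x. first i x" if i: "i \<in> E I" for i
  proof -
    have "\<exists>T. isset M T \<and> E T = {x \<in> E t. pt i x}"
      by (intro separation dfn_rules dfn_pt tU elems_Univ[OF i])
    then obtain T where T: "isset M T" "E T = {x \<in> E t. pt i x}" by blast
    then have T_iff: "x \<in> E T \<longleftrightarrow> pt i x" for x using pt_in by blast
    obtain x where "x \<in> E T" using pt_ex[OF i] T_iff by blast
    moreover have "E T \<subseteq> E t" unfolding T(2) by blast
    ultimately obtain m where "m \<in> E T" "\<forall>y\<in>E T. related M S' m y"
      using wo_least[OF S' isset_Univ[OF T(1)]] by metis
    then show ?thesis unfolding first_def using T_iff by blast
  qed
  have first_unique: "x = y" if "first i x" "first i y" for i x y
    using that wo_antisym[OF S', of x y] elems_Univ pt_in unfolding first_def by metis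
  \<comment> \<open>\<open>k\<close> carries the representative \<open>r\<close> to \<open>i\<close>
    and the point \<open>s\<close> chosen over \<open>r\<close> to the value \<open>x\<close> at
    \<open>i\<close>.\<close>
  define ch where "ch i x \<longleftrightarrow> (\<exists>k\<in>E L. \<exists>r\<in>E I. \<exists>s\<in>E t. orb.is_rep r i \<and> first r s \<and>
    ext_maps M k r i \<and> ext_maps M k s x)" for i x
  have "\<exists>c. is_rel c I t \<and> (\<forall>i x. related M c i x \<longleftrightarrow> i \<in> E I \<and> x \<in> E t \<and> ch i x)"
    unfolding ch_def first_def
    by (intro ex_rel dfn_rules dfn_ext_maps orb.dfn_is_rep dfn_pt LU IU tU wo_Univ[OF S'])
  then obtain c where c: "is_rel c I t"
    "\<And>i x. related M c i x \<longleftrightarrow> i \<in> E I \<and> x \<in> E t \<and> ch i x" by blast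
  have first_tset: "tset s" if "first r s" for r s
    using that pt_in N_tset unfolding first_def by blast
  have ch_iff: "ch i x \<longleftrightarrow> (\<exists>k\<in>E L. \<exists>s. first (orb.rep i) s \<and> i = act k (orb.rep i) \<and> x = act k s)"
    if i: "i \<in> E I" for i x
    unfolding ch_def
    using orb.is_rep_eq[OF i] orb.rep_in[OF i] orb.L_maps ext_maps_act[OF orb.L_perm first_tset]
      pt_in first_def by metis
  have c_iff: "related M c i x \<longleftrightarrow> i \<in> E I \<and>
      (\<exists>k\<in>E L. \<exists>s. first (orb.rep i) s \<and> i = act k (orb.rep i) \<and> x = act k s)" for i x
    using c(2) ch_iff pt_act pt_in unfolding first_def by metis
  have c_pt: "pt i x" if "related M c i x" for i x
    using that pt_act unfolding c_iff first_def by metis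
  have c_unique: "x = y" if xy: "related M c i x" "related M c i y" for i x y
  proof -
    obtain k l s where k: "k \<in> E L" "first (orb.rep i) s" "i = act k (orb.rep i)" "x = act k s"
      and l: "l \<in> E L" "i = act l (orb.rep i)" "y = act l s" and i: "i \<in> E I"
      using xy first_unique unfolding c_iff by metis
    obtain k' where k': "k' \<in> E L" "\<And>x. tset x \<Longrightarrow> act k' (act k x) = x"
      "\<And>x. tset x \<Longrightarrow> act k (act k' x) = x" using F_inverse[OF L(1) k(1)] by metis
    \<comment> \<open>Both \<open>k\<close> and \<open>l\<close> carry the representative to
      \<open>i\<close>. Hence \<open>m\<close>, which is \<open>l\<close> followed by the inverse of
      \<open>k\<close>, fixes the representative, and so it fixes \<open>s\<close> by
      \<open>pt_fixed\<close>.\<close>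
    obtain m where m: "m \<in> E L" "\<And>x. tset x \<Longrightarrow> act m x = act k' (act l x)"
      using F_compose[OF L(1) k'(1) l(1)] by metis
    have tr: "tset (orb.rep i)" using orb.P_tset orb.rep_in i by blast
    have ts: "tset s" using first_tset k(2) .
    have "act m (orb.rep i) = orb.rep i"
      using m(2)[OF tr] k'(2)[OF tr] k(3) l(2) by simp
    then have "act m s = s" using pt_fixed[OF m(1)] k(2) unfolding first_def by blast
    then have "act k' (act l s) = s" using m(2)[OF ts] by simp
    then have "act l s = act k s"
      using k'(3)[of "act l s"] tset_act[OF orb.L_perm[OF l(1)] ts] by simp
    then show ?thesis using k(4) l(3) by simp
  qed
  have c_ex: "\<exists>x. related M c i x" if i: "i \<in> E I" for i
  proof -
    obtain k where "k \<in> E L" "i = act k (orb.rep i)" using orb.rep_back[OF i] by blast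
    moreover obtain s where "first (orb.rep i) s" using first_ex[OF orb.rep_in[OF i]] by blast
    ultimately show ?thesis unfolding c_iff using i by blast
  qed
  have c_rel: "isset M c" "\<And>p. p \<in> E c \<Longrightarrow> \<exists>i\<in>E I. \<exists>x\<in>E t. is_pair M p i x"
    using c(1) unfolding is_rel_def by auto
  have "is_fun M c I"
    unfolding is_fun_def using c_rel c_ex c_unique by metis
  moreover have cN: "c \<in> Univ N"
  proof (rule N_rel[OF t(1) c_rel(1) L(1)])
    show "\<exists>i\<in>E t \<inter> Univ N. \<exists>x\<in>E t \<inter> Univ N. is_pair M p i x" if p: "p \<in> E c" for p
    proof -
      obtain i x where ix: "i \<in> E I" "x \<in> E t" "is_pair M p i x" using c_rel(2)[OF p] by blast
      then have "x \<in> Univ N" using c_pt[of i x] pt_in p related_pair by blast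
      moreover have "i \<in> Univ N" "i \<in> E t" using ix(1) N_trans[OF IN] transitiveD[OF t(1,2)] by auto
      ultimately show ?thesis using ix by blast
    qed
    show "related M c (act l i) (act l x)" if l: "l \<in> E L" and ix: "related M c i x" for l i x
    proof -
      obtain k s where k: "k \<in> E L" "first (orb.rep i) s" "i = act k (orb.rep i)" "x = act k s"
        and i: "i \<in> E I" using ix unfolding c_iff by blast
      \<comment> \<open>\<open>i\<close> and its image under \<open>l\<close> have the same
        representative, so \<open>k\<close> followed by \<open>l\<close> witnesses the value at the
        image.\<close>
      obtain m where m: "m \<in> E L" "\<And>x. tset x \<Longrightarrow> act m x = act l (act k x)"
        using F_compose[OF L(1) l k(1)] by metis
      have "act l i = act m (orb.rep i)"
        using m(2) orb.P_tset[OF orb.rep_in[OF i]] k(3) by metis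
      moreover have "act l x = act m s" using m(2)[OF first_tset[OF k(2)]] k(4) by simp
      ultimately show ?thesis
        unfolding c_iff orb.rep_act[OF l i] using orb.act_P[OF l i] m(1) k(2) by blast
    qed
  qed
  ultimately have "is_fun N c I" using is_fun_N[OF cN IN] by blast
  moreover have "x \<in> elems N X"
    if x: "related N B i q \<and> is_pair N q X R \<and> related N c i x" for i q X R x
  proof -
    have q: "related M B i q" "is_pair M q X R" "related M c i x"
      using x related_N[OF BN] related_N[OF cN] is_pair_N by auto
    obtain q' X' R' where q': "related M B i q'" "is_pair M q' X' R'" "x \<in> E X'"
      using c_pt[OF q(3)] pt_iff by blast
    have "q' = q" using fun_unique[OF Bf q'(1) q(1)] .
    then have "X' = X" using is_pair_inject[OF q(2)] q'(2) by blast
    then show ?thesis using q'(3) pt_in c_pt[OF q(3)] unfolding elems_N by blast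
  qed
  ultimately show "\<exists>c. is_fun N c I \<and>
      (\<forall>i q X R x. related N B i q \<and> is_pair N q X R \<and> related N c i x \<longrightarrow> x \<in> elems N X)"
    by blast
qed

end

theorem lemma5p1:
  fixes M :: "'m zfa_structure" and G F :: 'm
  assumes "ZFA_model M" and "AC M"
    and "perm_group M G"
    and "(\<forall>g\<in>elems M G. moves_finitely_many M g) \<or> bounded_exponent M G"
    and "finite_support_filter M G F"
  shows "CS (permutation_model M G F) \<and> CWF (permutation_model M G F) \<and>
         vDCP (permutation_model M G F) \<and> LW (permutation_model M G F)"
proof -
  interpret perm_model M G F
    by unfold_locales (use assms in \<open>simp_all add: finite_support_filter_def\<close>)
  interpret torsion_model M G F
  proof
    show "torsion g" if "g \<in> elems M G" for g
      using assms(4) that bounded_exponent_torsion finite_support_torsion by blast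
  qed (rule assms(2))
  show ?thesis using CS_N CWF_N vDCP_N LW_N unfolding N_def by blast
qed

end
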